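(* Let $X$ be an $N=1$ superconformal curve over $\Lambda$. For every $m\in\mathbb C$, $m\neq0$, the set of differential operators $\nabla:\mathrm{Ber}_X\to\mathrm{Ber}_X^{\otimes2}$ locally of the form $\nabla_\alpha=-mD_\alpha+g_\alpha$ for odd functions $g_\alpha$ is in one to one correspondence with the set of affine structures on $X$. These in turn are in one to one correspondence with the set of splittings of the extension $$0\to\mathrm{Ber}_X\to\mathcal B(1)_{\le1/2}^*\to\mathcal O_X\to0 .$$
   Context: $\Lambda$ is a Grassmann algebra over $\mathbb C$; work in the complex analytic category. An $N=1$ superconformal curve over $\Lambda$ is a superspace $(X,\mathcal O_X)$ over $\Lambda$ whose reduction is a smooth compact connected curve, locally of the form $\mathcal O_X=\mathcal O_X^{\mathrm{red}}\otimes\Lambda[\theta]$, with an atlas of coordinates $(z_\alpha,\theta_\alpha)$ on $U_\alpha$ (called compatible with the superconformal structure) whose transition functions $z_\beta=F_{\beta,\alpha}(z_\alpha,\theta_\alpha)$, $\theta_\beta=\Psi_{\beta,\alpha}(z_\alpha,\theta_\alpha)$ satisfy $D_\alpha F=\Psi D_\alpha\Psi$, where $D_\alpha=\partial_{\theta_\alpha}+\theta_\alpha\partial_{z_\alpha}$. Then $D_\alpha=(D_\alpha\Psi_{\beta,\alpha})D_\beta$. $\mathrm{Ber}_X$ is the Berezinian bundle, of rank $0|1$; on such a curve its local generators satisfy $[dz_\beta d\theta_\beta]=(D_\alpha\Psi_{\beta,\alpha})[dz_\alpha d\theta_\alpha]$. An operator $\nabla$ locally of the form $-mD_\alpha+g_\alpha$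 is one with $\nabla(f_\alpha[dz_\alpha d\theta_\alpha])=(-mD_\alpha f_\alpha+g_\alpha f_\alpha)[dz_\alpha d\theta_\alpha]^{\otimes2}$ in compatible coordinates; on overlaps this requires $\nabla_\alpha f=(D_\alpha\Psi_{\beta,\alpha})^2\nabla_\beta((D_\alpha\Psi_{\beta,\alpha})^{-1}f)$. An affine structure on $X$ is an equivalence class of coordinate atlases (compatible with the superconformal structure) whose transition functions are of the form $z_\beta=a^2z_\alpha+\theta_\alpha\xi a+b$, $\theta_\beta=\theta_\alpha a+\xi$, with $a,b$ even constants, $a$ invertible, and $\xi$ an odd constant in $\Lambda$ (depending on $\alpha,\beta$). The bundle. $\mathcal B(1)_{\le1/2}$ is the rank $1|1$ vector bundle on $X$ associated with the submodule spanned by the vacuum $|0\rangle$ and the fermion $\varphi$ in the boson-fermion system (the vertex algebra generated by an even $\alpha$ and odd $\varphi$ with $[\alpha_\lambda\alpha]=\lambda$, $[\varphi_\lambda\varphi]=1$, $[\alpha_\lambda\varphi]=0$ and $N=1$ superconformal vector $\alpha_{(-1)}\varphi+m\varphi_{(-2)}|0\rangle$). Explicitly, in compatible coordinates $(z_\alpha,\theta_\alpha)$ it has a local frame consisting of an even element $|0\rangle_\alpha$ and an odd element $\varphi_\alpha$, and on overlaps $$|0\rangle_\alpha=|0\rangle_\beta,\qquad \varphi_\alpha=(D_\alpha\Psi_{\beta,\alpha})\,\varphi_\beta-m\frac{D_\alpha^2\Psi_{\beta,\alpha}}{D_\alpha\Psi_{\beta,\alpha}}\,|0\rangle_\beta .$$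 The extension in the claim is the dual of $0\to\mathcal O_X|0\rangle\to\mathcal B(1)_{\le1/2}\to\mathcal B(1)_{\le1/2}/\mathcal O_X|0\rangle\to0$. A splitting is an even $\mathcal O_X$-linear section of the surjection onto $\mathcal O_X$. *)

theory Defs
  imports "HOL-Analysis.Analysis" "HOL-Algebra.Ring"
begin

section \<open>Grassmann algebras and superfunctions\<close>

text \<open>
  An element of the Grassmann algebra on anticommuting generators \<open>e\<^sub>i\<close>, \<open>i \<in> G \<subseteq> \<nat>\<close>, is given by
  its coefficients: \<open>a S\<close> is the coefficient of the product of the \<open>e\<^sub>i\<close>, \<open>i \<in> S\<close>, taken in
  increasing order of \<open>i\<close>. The sign below counts the transpositions needed to sort
  \<open>e\<^sub>T e\<^bsub>S - T\<^esub>\<close>. The index set \<open>G\<close> is finite in all uses.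
\<close>

type_synonym grass = "nat set \<Rightarrow> complex"

definition gmult :: "grass \<Rightarrow> grass \<Rightarrow> grass" where
  "gmult a b = (\<lambda>S. \<Sum>T\<in>Pow S. (-1) ^ card {(i, j). i \<in> T \<and> j \<in> S - T \<and> j < i} * a T * b (S - T))"

definition gscalar :: "complex \<Rightarrow> grass" where
  "gscalar k = (\<lambda>S. if S = {} then k else 0)"

definition grassmann :: "nat set \<Rightarrow> grass ring" where
  "grassmann G =
    \<lparr>carrier = {a. \<forall>S. a S \<noteq> 0 \<longrightarrow> S \<subseteq> G}, mult = gmult, one = gscalar 1,
     zero = (\<lambda>S. 0), add = (\<lambda>a b S. a S + b S)\<rparr>"

text \<open>Parities are truth values throughout: \<open>True\<close> is odd, and the sum of parities is \<open>\<noteq>\<close>.\<close>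

definition grass_part :: "nat set \<Rightarrow> bool \<Rightarrow> grass set" where
  "grass_part G p = {a \<in> carrier (grassmann G). \<forall>S. a S \<noteq> 0 \<longrightarrow> odd (card S) = p}"

text \<open>
  The ground algebra \<open>\<Lambda>\<close> has \<open>n\<close> generators, numbered \<open>1, \<dots>, n\<close>; the additional generator
  number \<open>0\<close> is \<open>\<theta>\<close>, so that \<open>\<Lambda>[\<theta>]\<close> is \<open>grassmann {..n}\<close> and \<open>\<theta>\<close> stands to the left in
  \<open>f\<^sub>0(z) + \<theta> f\<^sub>1(z)\<close>. The superfunctions \<open>\<O>(V) \<otimes> \<Lambda>[\<theta>]\<close> on an open \<open>V \<subseteq> \<complex>\<close> are the
  \<open>\<Lambda>[\<theta>]\<close>-valued functions with holomorphic coefficients, normalised to be \<open>0\<close> outside \<open>V\<close>.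
\<close>

definition sfun_ring :: "nat \<Rightarrow> complex set \<Rightarrow> (complex \<Rightarrow> grass) ring" where
  "sfun_ring n V =
    \<lparr>carrier = {f. (\<forall>w. f w \<in> carrier (grassmann {..n})) \<and>
                   (\<forall>S. (\<lambda>w. f w S) holomorphic_on V) \<and> (\<forall>w S. w \<notin> V \<longrightarrow> f w S = 0)},
     mult = (\<lambda>f g w. gmult (f w) (g w)),
     one = (\<lambda>w S. if w \<in> V then gscalar 1 S else 0),
     zero = (\<lambda>w S. 0),
     add = (\<lambda>f g w S. f w S + g w S)\<rparr>"

definition sfun_part :: "nat \<Rightarrow> bool \<Rightarrow> complex set \<Rightarrow> (complex \<Rightarrow> grass) set" where
  "sfun_part n p V = {f \<in> carrier (sfun_ring n V). \<forall>w. f w \<in> grass_part {..n} p}"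

definition sfun_restrict :: "complex set \<Rightarrow> (complex \<Rightarrow> grass) \<Rightarrow> complex \<Rightarrow> grass" where
  "sfun_restrict V f = (\<lambda>w S. if w \<in> V then f w S else 0)"

definition sfun_z :: "complex set \<Rightarrow> complex \<Rightarrow> grass" where
  "sfun_z V = sfun_restrict V gscalar"

definition sfun_theta :: "complex set \<Rightarrow> complex \<Rightarrow> grass" where
  "sfun_theta V = sfun_restrict V (\<lambda>w S. if S = {0} then 1 else 0)"

text \<open>
  \<open>D = \<partial>\<^sub>\<theta> + \<theta> \<partial>\<^sub>z\<close>, that is \<open>D(f\<^sub>0 + \<theta> f\<^sub>1) = f\<^sub>1 + \<theta> f\<^sub>0'\<close>. As \<open>0\<close> is the least index, the
  coefficient of \<open>f\<^sub>1\<close> at \<open>S\<close> is that of \<open>f\<close> at \<open>insert 0 S\<close>, without a sign.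
\<close>

definition sfun_D :: "complex set \<Rightarrow> (complex \<Rightarrow> grass) \<Rightarrow> complex \<Rightarrow> grass" where
  "sfun_D V f = sfun_restrict V
     (\<lambda>w S. if 0 \<in> S then deriv (\<lambda>u. f u (S - {0})) w else f w (insert 0 S))"


section \<open>Superspaces over a Grassmann algebra\<close>

text \<open>
  \<open>sec X U\<close> is the ring of sections of the structure sheaf over \<open>U\<close>, \<open>res X U V\<close> the restriction
  from \<open>U\<close> to \<open>V \<subseteq> U\<close>, \<open>cst X U\<close> the structure map from \<open>\<Lambda>\<close>, and \<open>part X p U\<close> the sections of
  parity \<open>p\<close>. The values at sets that are not open are irrelevant.
\<close>

record ('a, 's) superspace =
  ngens :: nat
  tsp :: "'a topology"
  sec :: "'a set \<Rightarrow> 's ring"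
  res :: "'a set \<Rightarrow> 'a set \<Rightarrow> 's \<Rightarrow> 's"
  cst :: "'a set \<Rightarrow> grass \<Rightarrow> 's"
  part :: "bool \<Rightarrow> 'a set \<Rightarrow> 's set"

abbreviation Lam_part :: "('a, 's, 'm) superspace_scheme \<Rightarrow> bool \<Rightarrow> grass set" where
  "Lam_part X p \<equiv> grass_part {1..ngens X} p"

abbreviation Lam :: "('a, 's, 'm) superspace_scheme \<Rightarrow> grass ring" where
  "Lam X \<equiv> grassmann {1..ngens X}"

abbreviation opens :: "('a, 's, 'm) superspace_scheme \<Rightarrow> 'a set set" where
  "opens X \<equiv> {U. openin (tsp X) U}"

definition superalgebra :: "('a, 's, 'm) superspace_scheme \<Rightarrow> 'a set \<Rightarrow> bool" where
  "superalgebra X U \<longleftrightarrow>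
     ring (sec X U) \<and>
     (\<forall>p. part X p U \<subseteq> carrier (sec X U) \<and> \<zero>\<^bsub>sec X U\<^esub> \<in> part X p U \<and>
          (\<forall>s\<in>part X p U. \<forall>t\<in>part X p U. s \<ominus>\<^bsub>sec X U\<^esub> t \<in> part X p U)) \<and>
     (\<forall>s\<in>carrier (sec X U). \<exists>!(t, u). t \<in> part X False U \<and> u \<in> part X True U \<and> s = t \<oplus>\<^bsub>sec X U\<^esub> u) \<and>
     (\<forall>p q. \<forall>s\<in>part X p U. \<forall>t\<in>part X q U.
        s \<otimes>\<^bsub>sec X U\<^esub> t \<in> part X (p \<noteq> q) U \<and>
        s \<otimes>\<^bsub>sec X U\<^esub> t =
          (if p \<and> q then \<ominus>\<^bsub>sec X U\<^esub> (t \<otimes>\<^bsub>sec X U\<^esub> s) else t \<otimes>\<^bsub>sec X U\<^esub> s)) \<and>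
     cst X U \<in> ring_hom (Lam X) (sec X U) \<and>
     (\<forall>p. \<forall>a\<in>Lam_part X p. cst X U a \<in> part X p U)"

definition superalgebra_presheaf :: "('a, 's, 'm) superspace_scheme \<Rightarrow> bool" where
  "superalgebra_presheaf X \<longleftrightarrow>
     (\<forall>U\<in>opens X. superalgebra X U \<and> (\<forall>s\<in>carrier (sec X U). res X U U s = s)) \<and>
     (\<forall>U\<in>opens X. \<forall>V\<in>opens X. V \<subseteq> U \<longrightarrow>
        res X U V \<in> ring_hom (sec X U) (sec X V) \<and>
        (\<forall>p. \<forall>s\<in>part X p U. res X U V s \<in> part X p V) \<and>
        (\<forall>a\<in>carrier (Lam X). res X U V (cst X U a) = cst X V a) \<and>
        (\<forall>W\<in>opens X. W \<subseteq> V \<longrightarrow> (\<forall>s\<in>carrier (sec X U). res X V W (res X U V s) = res X U W s)))"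

definition superspace :: "('a, 's, 'm) superspace_scheme \<Rightarrow> bool" where
  "superspace X \<longleftrightarrow>
     superalgebra_presheaf X \<and>
     (\<forall>\<U> s. \<U> \<subseteq> opens X \<and> (\<forall>U\<in>\<U>. s U \<in> carrier (sec X U)) \<and>
        (\<forall>U\<in>\<U>. \<forall>V\<in>\<U>. res X U (U \<inter> V) (s U) = res X V (U \<inter> V) (s V)) \<longrightarrow>
        (\<exists>!t. t \<in> carrier (sec X (\<Union>\<U>)) \<and> (\<forall>U\<in>\<U>. res X (\<Union>\<U>) U t = s U)))"

text \<open>
  A chart (coordinate system) on \<open>U = cdom c\<close> is an isomorphism of \<open>U\<close>, with the restricted sheaf,
  onto a superdomain of dimension \<open>1|1\<close> over \<open>\<Lambda>\<close>: a homeomorphism \<open>cbody c\<close> onto an open subset of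
  \<open>\<complex>\<close>, and compatible isomorphisms \<open>ciso c W\<close> of superalgebras over \<open>\<Lambda>\<close> from the sections over the
  open \<open>W \<subseteq> U\<close> to the superfunctions on \<open>cbody c ` W\<close>. The coordinates \<open>(z, \<theta>)\<close> are the sections
  corresponding to the standard coordinates. Locality of the stalks is a consequence of the
  existence of such charts.
\<close>

record ('a, 's) chart =
  cdom :: "'a set"
  cbody :: "'a \<Rightarrow> complex"
  ciso :: "'a set \<Rightarrow> 's \<Rightarrow> complex \<Rightarrow> grass"

definition is_chart :: "('a, 's, 'm) superspace_scheme \<Rightarrow> ('a, 's) chart \<Rightarrow> bool" where
  "is_chart X c \<longleftrightarrow>
     cdom c \<in> opens X \<and> open (cbody c ` cdom c) \<and>
     homeomorphic_map (subtopology (tsp X) (cdom c)) (top_of_set (cbody c ` cdom c)) (cbody c) \<and>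
     (\<forall>W\<in>opens X. W \<subseteq> cdom c \<longrightarrow>
        ciso c W \<in> ring_hom (sec X W) (sfun_ring (ngens X) (cbody c ` W)) \<and>
        bij_betw (ciso c W) (carrier (sec X W)) (carrier (sfun_ring (ngens X) (cbody c ` W))) \<and>
        (\<forall>p. \<forall>s\<in>part X p W. ciso c W s \<in> sfun_part (ngens X) p (cbody c ` W)) \<and>
        (\<forall>a\<in>carrier (Lam X). ciso c W (cst X W a) = sfun_restrict (cbody c ` W) (\<lambda>w. a)) \<and>
        (\<forall>W'\<in>opens X. W' \<subseteq> W \<longrightarrow> (\<forall>s\<in>carrier (sec X W).
           ciso c W' (res X W W' s) = sfun_restrict (cbody c ` W') (ciso c W s))))"

definition from_chart ::
  "('a, 's, 'm) superspace_scheme \<Rightarrow> ('a, 's) chart \<Rightarrow> 'a set \<Rightarrow> (complex \<Rightarrow> grass) \<Rightarrow> 's" where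
  "from_chart X c W = the_inv_into (carrier (sec X W)) (ciso c W)"

text \<open>The coordinates of \<open>c\<close>, and the operator \<open>D = \<partial>\<^sub>\<theta> + \<theta> \<partial>\<^sub>z\<close> in them, over an open \<open>W \<subseteq> cdom c\<close>.\<close>

definition zc :: "('a, 's, 'm) superspace_scheme \<Rightarrow> ('a, 's) chart \<Rightarrow> 'a set \<Rightarrow> 's" where
  "zc X c W = from_chart X c W (sfun_z (cbody c ` W))"

definition thetac :: "('a, 's, 'm) superspace_scheme \<Rightarrow> ('a, 's) chart \<Rightarrow> 'a set \<Rightarrow> 's" where
  "thetac X c W = from_chart X c W (sfun_theta (cbody c ` W))"

definition Dc :: "('a, 's, 'm) superspace_scheme \<Rightarrow> ('a, 's) chart \<Rightarrow> 'a set \<Rightarrow> 's \<Rightarrow> 's" where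
  "Dc X c W s = from_chart X c W (sfun_D (cbody c ` W) (ciso c W s))"


section \<open>Superconformal curves\<close>

text \<open>
  The transition functions \<open>z\<^sub>d = F(z\<^sub>c, \<theta>\<^sub>c)\<close>, \<open>\<theta>\<^sub>d = \<Psi>(z\<^sub>c, \<theta>\<^sub>c)\<close> are the coordinates of \<open>d\<close> written
  in the chart \<open>c\<close>; here they are kept as sections over \<open>cdom c \<inter> cdom d\<close>. The condition is
  \<open>D\<^sub>c F = \<Psi> D\<^sub>c \<Psi>\<close>.
\<close>

definition superconformal_change ::
  "('a, 's, 'm) superspace_scheme \<Rightarrow> ('a, 's) chart \<Rightarrow> ('a, 's) chart \<Rightarrow> bool" where
  "superconformal_change X c d \<longleftrightarrow>
     (let W = cdom c \<inter> cdom d in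
      Dc X c W (zc X d W) = thetac X d W \<otimes>\<^bsub>sec X W\<^esub> Dc X c W (thetac X d W))"

record ('a, 's) scurve = "('a, 's) superspace" +
  atlas :: "('a, 's) chart set"

definition superconformal_curve :: "('a, 's) scurve \<Rightarrow> bool" where
  "superconformal_curve X \<longleftrightarrow>
     superspace X \<and>
     topspace (tsp X) \<noteq> {} \<and> compact_space (tsp X) \<and> connected_space (tsp X) \<and> Hausdorff_space (tsp X) \<and>
     (\<forall>c\<in>atlas X. is_chart X c) \<and> \<Union>(cdom ` atlas X) = topspace (tsp X) \<and>
     (\<forall>c\<in>atlas X. \<forall>d\<in>atlas X. superconformal_change X c d)"

text \<open>Coordinates compatible with the superconformal structure.\<close>

definition coords :: "('a, 's) scurve \<Rightarrow> ('a, 's) chart set" where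
  "coords X = {c. is_chart X c \<and> (\<forall>d\<in>atlas X. superconformal_change X d c)}"

text \<open>\<open>jac X c d W\<close> is \<open>D\<^sub>c \<Psi>\<close> for the transition from \<open>c\<close> to \<open>d\<close>, over \<open>W \<subseteq> cdom c \<inter> cdom d\<close>.\<close>

definition jac :: "('a, 's) scurve \<Rightarrow> ('a, 's) chart \<Rightarrow> ('a, 's) chart \<Rightarrow> 'a set \<Rightarrow> 's" where
  "jac X c d W = Dc X c W (thetac X d W)"


section \<open>The Berezinian bundle and the differential operators\<close>

text \<open>
  A section of the \<open>k\<close>-th tensor power of \<open>Ber\<close> over \<open>U\<close> is given by its coefficients
  \<open>s c \<in> \<O>(U \<inter> cdom c)\<close> with respect to the generators \<open>[dz\<^sub>c d\<theta>\<^sub>c]\<^sup>\<otimes>\<^sup>k\<close>, for all compatible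
  coordinates \<open>c\<close>. From \<open>[dz\<^sub>d d\<theta>\<^sub>d] = (D\<^sub>c \<Psi>) [dz\<^sub>c d\<theta>\<^sub>c]\<close> one gets \<open>s c = s d (D\<^sub>c \<Psi>)\<^sup>k\<close>.
\<close>

definition ber :: "('a, 's) scurve \<Rightarrow> nat \<Rightarrow> 'a set \<Rightarrow> (('a, 's) chart \<Rightarrow> 's) set" where
  "ber X k U = {s \<in> (\<Pi>\<^sub>E c\<in>coords X. carrier (sec X (U \<inter> cdom c))).
     \<forall>c\<in>coords X. \<forall>d\<in>coords X. let W = U \<inter> cdom c \<inter> cdom d in
       res X (U \<inter> cdom c) W (s c) =
       res X (U \<inter> cdom d) W (s d) \<otimes>\<^bsub>sec X W\<^esub> (jac X c d W [^]\<^bsub>sec X W\<^esub> k)}"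

definition ber_res ::
  "('a, 's) scurve \<Rightarrow> 'a set \<Rightarrow> 'a set \<Rightarrow> (('a, 's) chart \<Rightarrow> 's) \<Rightarrow> ('a, 's) chart \<Rightarrow> 's" where
  "ber_res X U V s = (\<lambda>c\<in>coords X. res X (U \<inter> cdom c) (V \<inter> cdom c) (s c))"

text \<open>\<open>- m D\<^sub>c f + g f\<close>, for \<open>f \<in> \<O>(W)\<close>, \<open>W \<subseteq> cdom c\<close>.\<close>

definition local_op ::
  "('a, 's) scurve \<Rightarrow> complex \<Rightarrow> ('a, 's) chart \<Rightarrow> 'a set \<Rightarrow> 's \<Rightarrow> 's \<Rightarrow> 's" where
  "local_op X m c W g f =
     (\<ominus>\<^bsub>sec X W\<^esub> (cst X W (gscalar m) \<otimes>\<^bsub>sec X W\<^esub> Dc X c W f)) \<oplus>\<^bsub>sec X W\<^esub> (g \<otimes>\<^bsub>sec X W\<^esub> f)"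

text \<open>
  \<open>\<D>\<close> is given by \<open>- m D\<^sub>c + g\<close> in the coordinates \<open>c\<close>, with \<open>g \<in> \<O>(cdom c)\<close>.
\<close>

definition has_local_form ::
  "('a, 's) scurve \<Rightarrow> complex \<Rightarrow> ('a set \<Rightarrow> (('a, 's) chart \<Rightarrow> 's) \<Rightarrow> ('a, 's) chart \<Rightarrow> 's) \<Rightarrow>
   ('a, 's) chart \<Rightarrow> 's \<Rightarrow> bool" where
  "has_local_form X m \<D> c g \<longleftrightarrow>
     (\<forall>U\<in>opens X. \<forall>s\<in>ber X 1 U.
        \<D> U s c = local_op X m c (U \<inter> cdom c) (res X (cdom c) (U \<inter> cdom c) g) (s c))"

definition ber_ops ::
  "('a, 's) scurve \<Rightarrow> complex \<Rightarrow> ('a set \<Rightarrow> (('a, 's) chart \<Rightarrow> 's) \<Rightarrow> ('a, 's) chart \<Rightarrow> 's) set" where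
  "ber_ops X m = {\<D> \<in> (\<Pi>\<^sub>E U\<in>opens X. ber X 1 U \<rightarrow>\<^sub>E ber X 2 U).
     (\<forall>U\<in>opens X. \<forall>V\<in>opens X. V \<subseteq> U \<longrightarrow>
        (\<forall>s\<in>ber X 1 U. \<D> V (ber_res X U V s) = ber_res X U V (\<D> U s))) \<and>
     (\<forall>c\<in>coords X. \<exists>g\<in>part X True (cdom c). has_local_form X m \<D> c g)}"


section \<open>Affine structures\<close>

text \<open>
  The transition is \<open>z\<^sub>d = a\<^sup>2 z\<^sub>c + \<theta>\<^sub>c \<xi> a + b\<close>, \<open>\<theta>\<^sub>d = \<theta>\<^sub>c a + \<xi>\<close>. As overlaps may be disconnected, the
  constants are only required to be locally constant; otherwise equivalence of atlases would not
  be transitive.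
\<close>

definition affine_change :: "('a, 's) scurve \<Rightarrow> ('a, 's) chart \<Rightarrow> ('a, 's) chart \<Rightarrow> bool" where
  "affine_change X c d \<longleftrightarrow>
     (\<forall>x\<in>cdom c \<inter> cdom d. \<exists>W\<in>opens X. x \<in> W \<and> W \<subseteq> cdom c \<inter> cdom d \<and>
        (\<exists>a\<in>Lam_part X False \<inter> Units (Lam X). \<exists>b\<in>Lam_part X False. \<exists>\<xi>\<in>Lam_part X True.
           zc X d W =
             (cst X W (a \<otimes>\<^bsub>Lam X\<^esub> a) \<otimes>\<^bsub>sec X W\<^esub> zc X c W)
             \<oplus>\<^bsub>sec X W\<^esub> (thetac X c W \<otimes>\<^bsub>sec X W\<^esub> cst X W (\<xi> \<otimes>\<^bsub>Lam X\<^esub> a))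
             \<oplus>\<^bsub>sec X W\<^esub> cst X W b \<and>
           thetac X d W =
             (thetac X c W \<otimes>\<^bsub>sec X W\<^esub> cst X W a) \<oplus>\<^bsub>sec X W\<^esub> cst X W \<xi>))"

definition affine_atlas :: "('a, 's) scurve \<Rightarrow> ('a, 's) chart set \<Rightarrow> bool" where
  "affine_atlas X A \<longleftrightarrow>
     A \<subseteq> coords X \<and> \<Union>(cdom ` A) = topspace (tsp X) \<and> (\<forall>c\<in>A. \<forall>d\<in>A. affine_change X c d)"

definition affine_equiv :: "('a, 's) scurve \<Rightarrow> (('a, 's) chart set \<times> ('a, 's) chart set) set" where
  "affine_equiv X = {(A, B). affine_atlas X A \<and> affine_atlas X B \<and> affine_atlas X (A \<union> B)}"

definition affine_structures :: "('a, 's) scurve \<Rightarrow> ('a, 's) chart set set set" where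
  "affine_structures X = {A. affine_atlas X A} // affine_equiv X"


section \<open>The bundle \<open>\<B>(1)\<^bsub>\<le> 1/2\<^esub>\<close>, its dual, and splittings\<close>

text \<open>
  A section over \<open>U\<close> is given by the coefficients \<open>(p, q) = b c\<close> in \<open>|0\<rangle>\<^sub>c p + \<phi>\<^sub>c q\<close>, for all
  compatible coordinates \<open>c\<close>. The transition rule
  \<open>\<phi>\<^sub>c = (D\<^sub>c \<Psi>) \<phi>\<^sub>d - m (D\<^sub>c\<^sup>2 \<Psi> / D\<^sub>c \<Psi>) |0\<rangle>\<^sub>d\<close> becomes \<open>q\<^sub>d = (D\<^sub>c \<Psi>) q\<^sub>c\<close> and
  \<open>p\<^sub>d = p\<^sub>c - m (D\<^sub>c\<^sup>2 \<Psi> / D\<^sub>c \<Psi>) q\<^sub>c\<close>. Writing the coefficients to the right makes the bundle a right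
  module and avoids all signs: in the transition rule, the even \<open>D\<^sub>c \<Psi>\<close> commutes with \<open>\<phi>\<^sub>d\<close>, and
  the even \<open>|0\<rangle>\<^sub>d\<close> commutes with everything.
\<close>

definition bun :: "('a, 's) scurve \<Rightarrow> complex \<Rightarrow> 'a set \<Rightarrow> (('a, 's) chart \<Rightarrow> 's \<times> 's) set" where
  "bun X m U = {b \<in> (\<Pi>\<^sub>E c\<in>coords X. carrier (sec X (U \<inter> cdom c)) \<times> carrier (sec X (U \<inter> cdom c))).
     \<forall>c\<in>coords X. \<forall>d\<in>coords X.
       let W = U \<inter> cdom c \<inter> cdom d; J = jac X c d W;
           pc = res X (U \<inter> cdom c) W (fst (b c)); qc = res X (U \<inter> cdom c) W (snd (b c));
           pd = res X (U \<inter> cdom d) W (fst (b d)); qd = res X (U \<inter> cdom d) W (snd (b d)) in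
       qd = J \<otimes>\<^bsub>sec X W\<^esub> qc \<and>
       pd = pc \<ominus>\<^bsub>sec X W\<^esub>
              (cst X W (gscalar m) \<otimes>\<^bsub>sec X W\<^esub> (Dc X c W J \<otimes>\<^bsub>sec X W\<^esub> inv\<^bsub>sec X W\<^esub> J) \<otimes>\<^bsub>sec X W\<^esub> qc)}"

text \<open>\<open>|0\<rangle>\<close> is even and \<open>\<phi>\<close> is odd.\<close>

definition bun_part ::
  "('a, 's) scurve \<Rightarrow> complex \<Rightarrow> bool \<Rightarrow> 'a set \<Rightarrow> (('a, 's) chart \<Rightarrow> 's \<times> 's) set" where
  "bun_part X m p U = {b \<in> bun X m U. \<forall>c\<in>coords X.
     fst (b c) \<in> part X p (U \<inter> cdom c) \<and> snd (b c) \<in> part X (\<not> p) (U \<inter> cdom c)}"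

definition bun_res ::
  "('a, 's) scurve \<Rightarrow> 'a set \<Rightarrow> 'a set \<Rightarrow> (('a, 's) chart \<Rightarrow> 's \<times> 's) \<Rightarrow> ('a, 's) chart \<Rightarrow> 's \<times> 's" where
  "bun_res X U V b = (\<lambda>c\<in>coords X.
     map_prod (res X (U \<inter> cdom c) (V \<inter> cdom c)) (res X (U \<inter> cdom c) (V \<inter> cdom c)) (b c))"

definition bun_add ::
  "('a, 's) scurve \<Rightarrow> 'a set \<Rightarrow> (('a, 's) chart \<Rightarrow> 's \<times> 's) \<Rightarrow> (('a, 's) chart \<Rightarrow> 's \<times> 's) \<Rightarrow>
   ('a, 's) chart \<Rightarrow> 's \<times> 's" where
  "bun_add X U b b' = (\<lambda>c\<in>coords X.
     (fst (b c) \<oplus>\<^bsub>sec X (U \<inter> cdom c)\<^esub> fst (b' c), snd (b c) \<oplus>\<^bsub>sec X (U \<inter> cdom c)\<^esub> snd (b' c)))"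

definition bun_mult ::
  "('a, 's) scurve \<Rightarrow> 'a set \<Rightarrow> (('a, 's) chart \<Rightarrow> 's \<times> 's) \<Rightarrow> 's \<Rightarrow> ('a, 's) chart \<Rightarrow> 's \<times> 's" where
  "bun_mult X U b f = (\<lambda>c\<in>coords X.
     (fst (b c) \<otimes>\<^bsub>sec X (U \<inter> cdom c)\<^esub> res X U (U \<inter> cdom c) f,
      snd (b c) \<otimes>\<^bsub>sec X (U \<inter> cdom c)\<^esub> res X U (U \<inter> cdom c) f))"

definition vac :: "('a, 's) scurve \<Rightarrow> 'a set \<Rightarrow> ('a, 's) chart \<Rightarrow> 's \<times> 's" where
  "vac X U = (\<lambda>c\<in>coords X. (\<one>\<^bsub>sec X (U \<inter> cdom c)\<^esub>, \<zero>\<^bsub>sec X (U \<inter> cdom c)\<^esub>))"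

text \<open>
  The sections over \<open>U\<close> of the dual bundle are the morphisms of sheaves of right modules from the
  bundle to the structure sheaf, both restricted to \<open>U\<close>. A section \<open>f\<close> acts by
  \<open>(f \<omega>)(b) = f \<omega>(b)\<close>. The dual of \<open>\<O> |0\<rangle> \<subseteq> \<B>\<close> is the map \<open>\<omega> \<mapsto> \<omega>(|0\<rangle>)\<close> onto the structure sheaf;
  its kernel, the dual of the quotient by \<open>\<O> |0\<rangle>\<close>, is identified with \<open>Ber\<close> by
  letting \<open>f [dz\<^sub>c d\<theta>\<^sub>c]\<close> act as \<open>|0\<rangle>\<^sub>c p + \<phi>\<^sub>c q \<mapsto> f q\<close>.
\<close>

definition dual ::
  "('a, 's) scurve \<Rightarrow> complex \<Rightarrow> 'a set \<Rightarrow> ('a set \<Rightarrow> (('a, 's) chart \<Rightarrow> 's \<times> 's) \<Rightarrow> 's) set" where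
  "dual X m U = {\<omega> \<in> (\<Pi>\<^sub>E V\<in>{V \<in> opens X. V \<subseteq> U}. bun X m V \<rightarrow>\<^sub>E carrier (sec X V)).
     \<forall>V\<in>opens X. V \<subseteq> U \<longrightarrow> (\<forall>b\<in>bun X m V.
       (\<forall>W\<in>opens X. W \<subseteq> V \<longrightarrow> \<omega> W (bun_res X V W b) = res X V W (\<omega> V b)) \<and>
       (\<forall>b'\<in>bun X m V. \<omega> V (bun_add X V b b') = \<omega> V b \<oplus>\<^bsub>sec X V\<^esub> \<omega> V b') \<and>
       (\<forall>f\<in>carrier (sec X V). \<omega> V (bun_mult X V b f) = \<omega> V b \<otimes>\<^bsub>sec X V\<^esub> f))}"

definition dual_part ::
  "('a, 's) scurve \<Rightarrow> complex \<Rightarrow> bool \<Rightarrow> 'a set \<Rightarrow>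
   ('a set \<Rightarrow> (('a, 's) chart \<Rightarrow> 's \<times> 's) \<Rightarrow> 's) set" where
  "dual_part X m p U = {\<omega> \<in> dual X m U.
     \<forall>V\<in>opens X. V \<subseteq> U \<longrightarrow> (\<forall>q. \<forall>b\<in>bun_part X m q V. \<omega> V b \<in> part X (p \<noteq> q) V)}"

definition dual_res ::
  "('a, 's) scurve \<Rightarrow> complex \<Rightarrow> 'a set \<Rightarrow> ('a set \<Rightarrow> (('a, 's) chart \<Rightarrow> 's \<times> 's) \<Rightarrow> 's) \<Rightarrow>
   'a set \<Rightarrow> (('a, 's) chart \<Rightarrow> 's \<times> 's) \<Rightarrow> 's" where
  "dual_res X m V \<omega> = restrict \<omega> {W \<in> opens X. W \<subseteq> V}"

definition dual_add ::
  "('a, 's) scurve \<Rightarrow> complex \<Rightarrow> 'a set \<Rightarrow> ('a set \<Rightarrow> (('a, 's) chart \<Rightarrow> 's \<times> 's) \<Rightarrow> 's) \<Rightarrow>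
   ('a set \<Rightarrow> (('a, 's) chart \<Rightarrow> 's \<times> 's) \<Rightarrow> 's) \<Rightarrow> 'a set \<Rightarrow> (('a, 's) chart \<Rightarrow> 's \<times> 's) \<Rightarrow> 's" where
  "dual_add X m U \<omega> \<eta> = (\<lambda>V\<in>{V \<in> opens X. V \<subseteq> U}. \<lambda>b\<in>bun X m V. \<omega> V b \<oplus>\<^bsub>sec X V\<^esub> \<eta> V b)"

definition dual_mult ::
  "('a, 's) scurve \<Rightarrow> complex \<Rightarrow> 'a set \<Rightarrow> 's \<Rightarrow> ('a set \<Rightarrow> (('a, 's) chart \<Rightarrow> 's \<times> 's) \<Rightarrow> 's) \<Rightarrow>
   'a set \<Rightarrow> (('a, 's) chart \<Rightarrow> 's \<times> 's) \<Rightarrow> 's" where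
  "dual_mult X m U f \<omega> = (\<lambda>V\<in>{V \<in> opens X. V \<subseteq> U}. \<lambda>b\<in>bun X m V. res X U V f \<otimes>\<^bsub>sec X V\<^esub> \<omega> V b)"

text \<open>Even linear sections \<open>\<O> \<rightarrow> \<B>\<^sup>*\<close> of the surjection \<open>\<omega> \<mapsto> \<omega>(|0\<rangle>)\<close>.\<close>

definition splittings ::
  "('a, 's) scurve \<Rightarrow> complex \<Rightarrow>
   ('a set \<Rightarrow> 's \<Rightarrow> 'a set \<Rightarrow> (('a, 's) chart \<Rightarrow> 's \<times> 's) \<Rightarrow> 's) set" where
  "splittings X m = {\<sigma> \<in> (\<Pi>\<^sub>E U\<in>opens X. carrier (sec X U) \<rightarrow>\<^sub>E dual X m U).
     \<forall>U\<in>opens X.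
       (\<forall>V\<in>opens X. V \<subseteq> U \<longrightarrow>
          (\<forall>f\<in>carrier (sec X U). \<sigma> V (res X U V f) = dual_res X m V (\<sigma> U f))) \<and>
       (\<forall>f\<in>carrier (sec X U). \<forall>g\<in>carrier (sec X U).
          \<sigma> U (f \<oplus>\<^bsub>sec X U\<^esub> g) = dual_add X m U (\<sigma> U f) (\<sigma> U g) \<and>
          \<sigma> U (f \<otimes>\<^bsub>sec X U\<^esub> g) = dual_mult X m U f (\<sigma> U g)) \<and>
       (\<forall>p. \<forall>f\<in>part X p U. \<sigma> U f \<in> dual_part X m p U) \<and>
       (\<forall>f\<in>carrier (sec X U). \<sigma> U f U (vac X U) = f)}"

text \<open>
  In the coordinates \<open>c\<close>, the functional \<open>\<sigma>(1)\<close> is the element \<open>|0\<rangle>\<^sub>c\<^sup>*\<close> of the frame dual to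
  \<open>|0\<rangle>\<^sub>c, \<phi>\<^sub>c\<close>.
\<close>

definition split_trivial ::
  "('a, 's) scurve \<Rightarrow> complex \<Rightarrow>
   ('a set \<Rightarrow> 's \<Rightarrow> 'a set \<Rightarrow> (('a, 's) chart \<Rightarrow> 's \<times> 's) \<Rightarrow> 's) \<Rightarrow> ('a, 's) chart \<Rightarrow> bool" where
  "split_trivial X m \<sigma> c \<longleftrightarrow>
     (\<forall>U\<in>opens X. U \<subseteq> cdom c \<longrightarrow> (\<forall>b\<in>bun X m U. \<sigma> U \<one>\<^bsub>sec X U\<^esub> U b = fst (b c)))"

end

theory Submission
  imports Defs "HOL-Complex_Analysis.Complex_Analysis"
begin

text \<open>
  All three sets are compared with a fourth one, the set of connections: families of odd functions
  \<open>g\<^sub>c\<close>, one for every compatible chart \<open>c\<close>, such that \<open>g\<^sub>c = J g\<^sub>d + m (D\<^sub>c J) / J\<close> on overlaps, where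
  \<open>J = D\<^sub>c \<Psi>\<close> is the Jacobian of the change from \<open>c\<close> to \<open>d\<close>.

  Since \<open>D\<^sub>c = J D\<^sub>d\<close>, this law says precisely that the local operators \<open>- m D\<^sub>c + g\<^sub>c\<close> fit together to an
  operator from \<open>Ber\<close> to its square. Applied to the generator \<open>[dz\<^sub>c d\<theta>\<^sub>c]\<close>, the operator returns \<open>g\<^sub>c\<close>
  (\<open>bij_conn_op\<close>). The same law makes the local functionals \<open>|0\<rangle>\<^sub>c p + \<phi>\<^sub>c q \<mapsto> p - g\<^sub>c q\<close> fit together, and
  these are the possible values \<open>\<sigma>(1)\<close> of a splitting, with \<open>- g\<^sub>c\<close> as value at \<open>\<phi>\<^sub>c\<close>
  (\<open>bij_conn_split\<close>).

  The affine structure of a connection consists of the charts with \<open>g\<^sub>c = 0\<close>. Between two of them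
  \<open>D\<^sub>c J = 0\<close>, so \<open>J\<close> is locally constant, and integrating \<open>D\<^sub>c \<Psi> = J\<close> and \<open>D\<^sub>c F = \<Psi> J\<close> shows that the
  change is affine (\<open>flat_affine_change\<close>). Conversely, the charts of an affine atlas have vanishing
  logarithmic derivatives \<open>(D\<^sub>c J) / J\<close> among each other, and the law then defines \<open>g\<close> in all other
  charts (\<open>affine_atlas_connection\<close>).

  The main point is that charts with \<open>g\<^sub>c = 0\<close> exist around every point (\<open>flat_chart\<close>), that is, that
  \<open>m (D J) / J = g\<close> can be solved by the Jacobian of a change of coordinates. The change is composed
  of simple ones that are visibly invertible. A change \<open>z' = f(z)\<close>, \<open>\<theta>' = a(z) \<theta>\<close> with \<open>f' = a\<^sup>2\<close>
  removes from \<open>g\<close> the terms without nilpotent constants. The rest is removed one monomial \<open>e\<^sub>S\<close> of the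
  Grassmann algebra at a time. For an even multiple \<open>k\<close> of \<open>e\<^sub>S\<close> the derivation
  \<open>v = 2 k D\<^sup>2 + (D k) D\<close> satisfies \<open>v(s) v(t) = 0\<close> and \<open>v(v(s)) = 0\<close>, so \<open>1 - v\<close> is an automorphism with
  inverse \<open>1 + v\<close>; the corresponding change of coordinates is superconformal with \<open>J = 1 + D\<^sup>2 k\<close> and
  \<open>(D J) / J = D\<^sup>3 k\<close>. On a disc \<open>D\<close> is surjective, and \<open>k\<close> can be chosen such that \<open>m D\<^sup>3 k\<close> is the
  part of \<open>g\<close> belonging to \<open>e\<^sub>S\<close>.
\<close>

section \<open>Superfunctions\<close>

definition gsign :: "nat set \<Rightarrow> nat set \<Rightarrow> complex" where
  "gsign T U = (-1) ^ card {(i, j). i \<in> T \<and> j \<in> U \<and> j < i}"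

lemma gmult_eq: "gmult a b S = (\<Sum>T\<in>Pow S. gsign T (S - T) * a T * b (S - T))"
  by (simp add: gmult_def gsign_def)

lemma gsign_insert0_left: "gsign (insert 0 T) U = gsign T U"
proof -
  have "{(i, j). i \<in> insert 0 T \<and> j \<in> U \<and> j < i} = {(i, j). i \<in> T \<and> j \<in> U \<and> j < (i::nat)}"
    by auto
  then show ?thesis by (simp add: gsign_def)
qed

lemma gsign_insert0_right:
  assumes "finite T" "finite U" "0 \<notin> T" "0 \<notin> U"
  shows "gsign T (insert 0 U) = (-1) ^ card T * gsign T U"
proof -
  have eq: "{(i, j). i \<in> T \<and> j \<in> insert 0 U \<and> j < i} =
      (\<lambda>i. (i, 0)) ` T \<union> {(i, j). i \<in> T \<and> j \<in> U \<and> j < i}"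
    using assms by (auto intro: gr0I)
  have "finite {(i, j). i \<in> T \<and> j \<in> U \<and> j < i}"
    by (rule finite_subset[of _ "T \<times> U"]) (use assms in auto)
  then have "card {(i, j). i \<in> T \<and> j \<in> insert 0 U \<and> j < i} =
      card T + card {(i, j). i \<in> T \<and> j \<in> U \<and> j < i}"
    unfolding eq using assms
    by (subst card_Un_disjoint) (auto simp: card_image inj_on_def)
  then show ?thesis by (simp add: gsign_def power_add)
qed

lemma gsign_empty [simp]: "gsign {} U = 1" "gsign T {} = 1"
  by (simp_all add: gsign_def)

lemma gmult_infinite: "infinite S \<Longrightarrow> gmult a b S = 0"
  by (simp add: gmult_eq)

text \<open>
  Splitting the sum over \<open>T \<subseteq> S \<union> {0}\<close> by whether the factor \<open>\<theta>\<close> comes from \<open>a\<close> or from \<open>b\<close>; in the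
  second case it has to pass the monomial taken from \<open>a\<close>.
\<close>

lemma gmult_insert0:
  assumes "finite S" "0 \<notin> S"
  shows "gmult a b (insert 0 S) =
    (\<Sum>T\<in>Pow S. gsign T (S - T) * ((-1) ^ card T * a T * b (insert 0 (S - T)) + a (insert 0 T) * b (S - T)))"
proof -
  let ?h = "\<lambda>T. gsign T (insert 0 S - T) * a T * b (insert 0 S - T)"
  have "gmult a b (insert 0 S) = sum ?h (Pow S) + sum ?h (insert 0 ` Pow S)"
    unfolding gmult_eq Pow_insert using assms
    by (subst sum.union_disjoint) auto
  also have "sum ?h (insert 0 ` Pow S) = (\<Sum>T\<in>Pow S. gsign T (S - T) * a (insert 0 T) * b (S - T))"
  proof (subst sum.reindex)
    show "inj_on (insert 0) (Pow S)"
      using assms(2) by (intro inj_onI) (metis PowD insert_ident subsetD)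
    show "sum (?h \<circ> insert 0) (Pow S) = (\<Sum>T\<in>Pow S. gsign T (S - T) * a (insert 0 T) * b (S - T))"
      using assms by (intro sum.cong) (auto simp: gsign_insert0_left insert_Diff_if)
  qed
  also have "sum ?h (Pow S) = (\<Sum>T\<in>Pow S. gsign T (S - T) * ((-1) ^ card T * a T * b (insert 0 (S - T))))"
  proof (intro sum.cong refl)
    fix T assume "T \<in> Pow S"
    then have "finite T" "0 \<notin> T" "insert 0 S - T = insert 0 (S - T)"
      using assms finite_subset by auto
    then show "?h T = gsign T (S - T) * ((-1) ^ card T * a T * b (insert 0 (S - T)))"
      using gsign_insert0_right[of T "S - T"] assms by simp
  qed
  finally show ?thesis
    by (simp add: sum.distrib[symmetric] algebra_simps)
qed

lemma gmult_scalar_left: "finite S \<Longrightarrow> gmult (gscalar k) a S = k * a S"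
proof -
  assume S: "finite S"
  have "gmult (gscalar k) a S = (\<Sum>T\<in>Pow S. if T = {} then k * a S else 0)"
    unfolding gmult_eq by (intro sum.cong) (auto simp: gscalar_def)
  then show ?thesis using S by (simp add: sum.delta)
qed

lemma gmult_theta_left:
  assumes "finite S"
  shows "gmult (\<lambda>S. if S = {0} then k else 0) a S = (if 0 \<in> S then k * a (S - {0}) else 0)"
proof -
  have "gsign {0} U = 1" for U
    using gsign_insert0_left[of "{}" U] by simp
  then have "gmult (\<lambda>S. if S = {0} then k else 0) a S =
      (\<Sum>T\<in>Pow S. if T = {0} then (if 0 \<in> S then k * a (S - {0}) else 0) else 0)"
    unfolding gmult_eq by (intro sum.cong) auto
  then show ?thesis using assms by (simp add: sum.delta)
qed

lemma gmult_zero [simp]: "gmult (\<lambda>S. 0) b = (\<lambda>S. 0)" "gmult a (\<lambda>S. 0) = (\<lambda>S. 0)"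
  by (simp_all add: gmult_eq fun_eq_iff)

lemma gscalar_0 [simp]: "gscalar 0 = (\<lambda>S. 0)"
  by (simp add: gscalar_def fun_eq_iff)

lemma gscalar_Lam: "gscalar k \<in> grass_part G False"
  by (auto simp: gscalar_def grass_part_def grassmann_def)

lemma sfun_carrier_iff:
  "f \<in> carrier (sfun_ring n V) \<longleftrightarrow>
     (\<forall>w S. f w S \<noteq> 0 \<longrightarrow> w \<in> V \<and> S \<subseteq> {..n}) \<and> (\<forall>S. (\<lambda>w. f w S) holomorphic_on V)"
  by (auto simp: sfun_ring_def grassmann_def)

lemma sfun_part_iff:
  "f \<in> sfun_part n p V \<longleftrightarrow>
     f \<in> carrier (sfun_ring n V) \<and> (\<forall>w S. f w S \<noteq> 0 \<longrightarrow> odd (card S) = p)"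
  by (auto simp: sfun_part_def grass_part_def sfun_ring_def)

lemma sfun_infinite: "f \<in> carrier (sfun_ring n V) \<Longrightarrow> infinite S \<Longrightarrow> f w S = 0"
  using finite_subset[of S "{..n}"] by (auto simp: sfun_carrier_iff)

lemma sfun_ops [simp]:
  "f \<oplus>\<^bsub>sfun_ring n V\<^esub> g = (\<lambda>w S. f w S + g w S)"
  "f \<otimes>\<^bsub>sfun_ring n V\<^esub> g = (\<lambda>w. gmult (f w) (g w))"
  "\<zero>\<^bsub>sfun_ring n V\<^esub> = (\<lambda>w S. 0)"
  by (simp_all add: sfun_ring_def)

lemma sfun_one: "\<one>\<^bsub>sfun_ring n V\<^esub> = sfun_restrict V (\<lambda>w. gscalar 1)"
  by (simp add: sfun_ring_def sfun_restrict_def)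

lemma sfun_restrict_carrier:
  assumes "\<And>w S. f w S \<noteq> 0 \<Longrightarrow> w \<in> V \<Longrightarrow> S \<subseteq> {..n}" and "\<And>S. (\<lambda>w. f w S) holomorphic_on V"
  shows "sfun_restrict V f \<in> carrier (sfun_ring n V)"
proof -
  have "(\<lambda>w. sfun_restrict V f w S) holomorphic_on V" for S
    by (rule holomorphic_transform[OF assms(2)[of S]]) (simp add: sfun_restrict_def)
  then show ?thesis
    using assms(1) by (auto simp: sfun_carrier_iff sfun_restrict_def)
qed

lemma sfun_z_part: "sfun_z V \<in> sfun_part n False V"
proof -
  have "(\<lambda>w. gscalar w S) holomorphic_on V" for S
    by (cases "S = {}") (auto simp: gscalar_def)
  then have "sfun_z V \<in> carrier (sfun_ring n V)"
    unfolding sfun_z_def by (intro sfun_restrict_carrier) (auto simp: gscalar_def split: if_splits)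
  then show ?thesis
    by (auto simp: sfun_part_iff sfun_z_def sfun_restrict_def gscalar_def split: if_splits)
qed

lemma sfun_theta_part: "sfun_theta V \<in> sfun_part n True V"
proof -
  have "sfun_theta V \<in> carrier (sfun_ring n V)"
    unfolding sfun_theta_def by (intro sfun_restrict_carrier) (auto split: if_splits)
  then show ?thesis
    by (auto simp: sfun_part_iff sfun_theta_def sfun_restrict_def split: if_splits)
qed

lemma sfun_D_carrier:
  assumes "open V" "f \<in> carrier (sfun_ring n V)"
  shows "sfun_D V f \<in> carrier (sfun_ring n V)"
  unfolding sfun_D_def
proof (rule sfun_restrict_carrier)
  fix w S assume *: "(if 0 \<in> S then deriv (\<lambda>u. f u (S - {0})) w else f w (insert 0 S)) \<noteq> 0"
  show "S \<subseteq> {..n}"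
  proof (rule ccontr)
    assume "\<not> S \<subseteq> {..n}"
    then have "\<not> S - {0} \<subseteq> {..n}" by auto
    then have "f u (S - {0}) = 0" "f u (insert 0 S) = 0" for u
      using assms(2) \<open>\<not> S \<subseteq> {..n}\<close> unfolding sfun_carrier_iff by blast+
    with * show False by (simp split: if_splits)
  qed
next
  fix S
  have "deriv (\<lambda>u. f u (S - {0})) holomorphic_on V" "(\<lambda>w. f w (insert 0 S)) holomorphic_on V"
    using assms by (auto simp: sfun_carrier_iff intro: holomorphic_deriv)
  then show "(\<lambda>w. if 0 \<in> S then deriv (\<lambda>u. f u (S - {0})) w else f w (insert 0 S)) holomorphic_on V"
    by (cases "0 \<in> S") auto
qed

lemma sfun_D_part:
  assumes "open V" "f \<in> sfun_part n p V"
  shows "sfun_D V f \<in> sfun_part n (\<not> p) V"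
proof -
  have f: "f \<in> carrier (sfun_ring n V)" and odd: "\<And>w S. f w S \<noteq> 0 \<Longrightarrow> odd (card S) = p"
    using assms(2) by (auto simp: sfun_part_iff)
  have "odd (card S) = (\<not> p)" if nz: "sfun_D V f w S \<noteq> 0" for w S
  proof -
    have fin: "finite S"
      using nz sfun_infinite[OF sfun_D_carrier[OF assms(1) f]] by blast
    show ?thesis
    proof (cases "0 \<in> S")
      case True
      then have "deriv (\<lambda>u. f u (S - {0})) w \<noteq> 0"
        using nz by (simp add: sfun_D_def sfun_restrict_def split: if_splits)
      moreover have "deriv (\<lambda>u. f u (S - {0})) w = 0" if "\<And>u. f u (S - {0}) = 0"
        using that by simp
      ultimately obtain u where "f u (S - {0}) \<noteq> 0" by blast
      from odd[OF this] show ?thesis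
        using True fin card_gt_0_iff[of S] by (auto simp: card_Diff_singleton)
    next
      case False
      then have "f w (insert 0 S) \<noteq> 0"
        using nz by (simp add: sfun_D_def sfun_restrict_def split: if_splits)
      from odd[OF this] show ?thesis
        using False fin by auto
    qed
  qed
  then show ?thesis
    using sfun_D_carrier[OF assms(1) f] by (simp add: sfun_part_iff)
qed

lemma sfun_outside: "s \<in> carrier (sfun_ring n V) \<Longrightarrow> w \<notin> V \<Longrightarrow> s w S = 0"
  unfolding sfun_carrier_iff by blast

lemma sfun_field_differentiable:
  assumes "open V" "f \<in> carrier (sfun_ring n V)" "w \<in> V"
  shows "(\<lambda>u. f u S) field_differentiable (at w)"
  using assms unfolding sfun_carrier_iff by (blast intro: holomorphic_on_imp_differentiable_at)

lemma sfun_D_add: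
  assumes "open V" "f \<in> carrier (sfun_ring n V)" "g \<in> carrier (sfun_ring n V)"
  shows "sfun_D V (\<lambda>w S. f w S + g w S) = (\<lambda>w S. sfun_D V f w S + sfun_D V g w S)"
  using sfun_field_differentiable[OF assms(1,2)] sfun_field_differentiable[OF assms(1,3)]
  by (auto simp: sfun_D_def sfun_restrict_def fun_eq_iff)

lemma sfun_D_const:
  assumes "open V" "\<And>S. 0 \<in> S \<Longrightarrow> a S = 0"
  shows "sfun_D V (sfun_restrict V (\<lambda>w. a)) = (\<lambda>w S. 0)"
proof -
  have "deriv (\<lambda>u. if u \<in> V then k else 0) w = 0" if "w \<in> V" for w k
  proof -
    have "((\<lambda>u. k) has_field_derivative 0) (at w)" by simp
    then have "((\<lambda>u. if u \<in> V then k else 0) has_field_derivative 0) (at w)"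
      by (rule has_field_derivative_transform_within_open[OF _ assms(1) that]) auto
    then show ?thesis by (rule DERIV_imp_deriv)
  qed
  then show ?thesis
    using assms(2) by (auto simp: sfun_D_def sfun_restrict_def fun_eq_iff)
qed

text \<open>
  Both \<open>\<partial>\<^sub>\<theta>\<close> and the factor \<open>\<theta>\<close> of \<open>\<theta> \<partial>\<^sub>z\<close> have to pass the first factor to reach the second one, at the
  cost of a sign given by its parity. In coefficients: at \<open>S \<union> {0}\<close> with \<open>0 \<notin> S\<close>, the terms with two
  factors \<open>f\<^sub>1\<close> and \<open>g\<^sub>1\<close> cancel.
\<close>

lemma sfun_D_mult:
  assumes V: "open V" and f: "f \<in> sfun_part n p V" and g: "g \<in> carrier (sfun_ring n V)"
  shows "sfun_D V (\<lambda>w. gmult (f w) (g w)) =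
    (\<lambda>w S. gmult (sfun_D V f w) (g w) S + (if p then -1 else 1) * gmult (f w) (sfun_D V g w) S)"
proof (intro ext)
  fix w :: complex and S :: "nat set"
  let ?e = "if p then -1 else 1 :: complex"
  have fc: "f \<in> carrier (sfun_ring n V)" using f by (simp add: sfun_part_iff)
  have sgn: "(-1) ^ card T * f w T = ?e * f w T" for T
    using f by (cases "f w T = 0") (auto simp: sfun_part_iff)
  consider "w \<notin> V" | "infinite S" | "w \<in> V" "finite S" "0 \<notin> S" | "w \<in> V" "finite S" "0 \<in> S"
    by blast
  then show "sfun_D V (\<lambda>w. gmult (f w) (g w)) w S =
      gmult (sfun_D V f w) (g w) S + ?e * gmult (f w) (sfun_D V g w) S"
  proof cases
    case 1
    then have "sfun_D V h w = (\<lambda>S. 0)" for h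
      by (simp add: sfun_D_def sfun_restrict_def)
    then show ?thesis by simp
  next
    case 2
    then show ?thesis
      by (cases "0 \<in> S") (auto simp: gmult_infinite sfun_D_def sfun_restrict_def)
  next
    case 3
    have D: "sfun_D V h w T = h w (insert 0 T)" if "T \<subseteq> S" for h T
      using 3 that by (auto simp: sfun_D_def sfun_restrict_def)
    have "sfun_D V (\<lambda>w. gmult (f w) (g w)) w S = gmult (f w) (g w) (insert 0 S)"
      using D[of S] by simp
    also have "\<dots> = (\<Sum>T\<in>Pow S. gsign T (S - T) * ((-1) ^ card T * f w T * sfun_D V g w (S - T)
        + sfun_D V f w T * g w (S - T)))"
      unfolding gmult_insert0[OF 3(2,3)] by (intro sum.cong) (auto simp: D)
    also have "\<dots> = gmult (sfun_D V f w) (g w) S + ?e * gmult (f w) (sfun_D V g w) S"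
      unfolding gmult_eq sgn sum_distrib_left
      by (simp add: sum.distrib[symmetric] algebra_simps del: if_split)
    finally show ?thesis .
  next
    case 4
    define S' where "S' = S - {0}"
    have S': "S = insert 0 S'" "finite S'" "0 \<notin> S'" using 4 by (auto simp: S'_def)
    have D0: "sfun_D V h w T = h w (insert 0 T)" if "T \<subseteq> S'" for h T
      using 4 S' that by (auto simp: sfun_D_def sfun_restrict_def)
    have D1: "sfun_D V h w (insert 0 T) = deriv (\<lambda>u. h u T) w" if "T \<subseteq> S'" for h T
    proof -
      have "insert 0 T - {0} = T" using S' that by auto
      then show ?thesis using 4 by (auto simp: sfun_D_def sfun_restrict_def)
    qed
    have df: "((\<lambda>u. f u T) has_field_derivative deriv (\<lambda>u. f u T) w) (at w)" for T
      using sfun_field_differentiable[OF V fc 4(1)] by (simp add: field_differentiable_derivI)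
    have dg: "((\<lambda>u. g u T) has_field_derivative deriv (\<lambda>u. g u T) w) (at w)" for T
      using sfun_field_differentiable[OF V g 4(1)] by (simp add: field_differentiable_derivI)
    have "sfun_D V (\<lambda>w. gmult (f w) (g w)) w S = deriv (\<lambda>u. gmult (f u) (g u) S') w"
      using D1[of S'] S' by simp
    also have "\<dots> = (\<Sum>T\<in>Pow S'. gsign T (S' - T) *
        (deriv (\<lambda>u. f u T) w * g w (S' - T) + f w T * deriv (\<lambda>u. g u (S' - T)) w))"
      unfolding gmult_eq
      by (rule DERIV_imp_deriv) (auto intro!: derivative_eq_intros df dg simp: algebra_simps)
    also have "\<dots> = gmult (sfun_D V f w) (g w) S + ?e * gmult (f w) (sfun_D V g w) S"
      unfolding S'(1) gmult_insert0[OF S'(2,3)] sum_distrib_left sum.distrib[symmetric]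
    proof (intro sum.cong refl)
      fix T assume "T \<in> Pow S'"
      then have T: "T \<subseteq> S'" "S' - T \<subseteq> S'" "finite T" "0 \<notin> T" using S' finite_subset by auto
      have sgn0: "?e * f w (insert 0 T) = - ((-1) ^ card T * f w (insert 0 T))"
        using sgn[of "insert 0 T"] T by simp
      have "gsign T (S' - T) * ((-1) ^ card T * sfun_D V f w T * g w (insert 0 (S' - T)) +
               sfun_D V f w (insert 0 T) * g w (S' - T)) +
            ?e * (gsign T (S' - T) * ((-1) ^ card T * f w T * sfun_D V g w (insert 0 (S' - T)) +
               f w (insert 0 T) * sfun_D V g w (S' - T))) =
            gsign T (S' - T) * ((-1) ^ card T * f w (insert 0 T) * g w (insert 0 (S' - T)) +
               deriv (\<lambda>u. f u T) w * g w (S' - T)) +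
            gsign T (S' - T) * (?e * ?e * f w T * deriv (\<lambda>u. g u (S' - T)) w +
               (?e * f w (insert 0 T)) * g w (insert 0 (S' - T)))"
        unfolding D0[OF T(1)] D0[OF T(2)] D1[OF T(1)] D1[OF T(2)] sgn by (simp add: algebra_simps del: if_split)
      also have "\<dots> = gsign T (S' - T) *
        (deriv (\<lambda>u. f u T) w * g w (S' - T) + f w T * deriv (\<lambda>u. g u (S' - T)) w)"
        unfolding sgn0 by (simp add: algebra_simps)
      finally show "gsign T (S' - T) *
         (deriv (\<lambda>u. f u T) w * g w (S' - T) + f w T * deriv (\<lambda>u. g u (S' - T)) w) =
         gsign T (S' - T) * ((-1) ^ card T * sfun_D V f w T * g w (insert 0 (S' - T)) +
               sfun_D V f w (insert 0 T) * g w (S' - T)) +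
            ?e * (gsign T (S' - T) * ((-1) ^ card T * f w T * sfun_D V g w (insert 0 (S' - T)) +
               f w (insert 0 T) * sfun_D V g w (S' - T)))" by simp
    qed
    finally show ?thesis .
  qed
qed

lemma sfun_D_scalar:
  assumes V: "open V" and \<phi>: "\<phi> holomorphic_on V"
  shows "sfun_D V (sfun_restrict V (\<lambda>w. gscalar (\<phi> w))) =
    sfun_restrict V (\<lambda>w S. if S = {0} then deriv \<phi> w else 0)"
proof (intro ext)
  fix w :: complex and S :: "nat set"
  let ?f = "sfun_restrict V (\<lambda>w. gscalar (\<phi> w))"
  consider "w \<notin> V" | "w \<in> V" "0 \<notin> S" | "w \<in> V" "0 \<in> S" "S \<noteq> {0}" | "w \<in> V" "S = {0}" by blast
  then show "sfun_D V ?f w S = sfun_restrict V (\<lambda>w S. if S = {0} then deriv \<phi> w else 0) w S"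
  proof cases
    case 3
    then have "S - {0} \<noteq> {}" by blast
    then have "?f u (S - {0}) = 0" for u by (simp only: sfun_restrict_def gscalar_def if_False if_cancel)
    then show ?thesis using 3 by (simp add: sfun_D_def sfun_restrict_def[of V "\<lambda>w S. if 0 \<in> S then _ w S else _ w S"])
      (simp add: sfun_restrict_def)
  next
    case 4
    have "(\<phi> has_field_derivative deriv \<phi> w) (at w)"
      using \<phi> V 4(1) holomorphic_derivI by blast
    then have "((\<lambda>u. ?f u ({0} - {0})) has_field_derivative deriv \<phi> w) (at w)"
      by (rule has_field_derivative_transform_within_open[OF _ V 4(1)]) (simp add: sfun_restrict_def gscalar_def)
    then show ?thesis using 4(1)
      unfolding 4(2) sfun_D_def sfun_restrict_def Diff_cancel by (simp add: DERIV_imp_deriv)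
  qed (auto simp: sfun_D_def sfun_restrict_def gscalar_def)
qed

lemma sfun_D_theta_scalar:
  "sfun_D V (sfun_restrict V (\<lambda>w S. if S = {0} then \<phi> w else 0)) = sfun_restrict V (\<lambda>w. gscalar (\<phi> w))"
proof (intro ext)
  fix w :: complex and S :: "nat set"
  let ?f = "sfun_restrict V (\<lambda>w S. if S = {0} then \<phi> w else 0)"
  have "S - {0} \<noteq> {0}" by blast
  then have "?f u (S - {0}) = 0" for u by (simp add: sfun_restrict_def)
  moreover have "insert 0 S = {0} \<longleftrightarrow> S = {}" if "0 \<notin> S" using that by auto
  ultimately show "sfun_D V ?f w S = sfun_restrict V (\<lambda>w. gscalar (\<phi> w)) w S"
    by (auto simp: sfun_D_def sfun_restrict_def gscalar_def)
qed

lemma sfun_scalar_part: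
  assumes "\<phi> holomorphic_on V"
  shows "sfun_restrict V (\<lambda>w. gscalar (\<phi> w)) \<in> sfun_part n False V"
    "sfun_restrict V (\<lambda>w S. if S = {0} then \<phi> w else 0) \<in> sfun_part n True V"
proof -
  have "(\<lambda>w. gscalar (\<phi> w) S) holomorphic_on V" for S
    using assms by (cases "S = {}") (auto simp: gscalar_def)
  then have "sfun_restrict V (\<lambda>w. gscalar (\<phi> w)) \<in> carrier (sfun_ring n V)"
    by (intro sfun_restrict_carrier) (auto simp: gscalar_def split: if_splits)
  then show "sfun_restrict V (\<lambda>w. gscalar (\<phi> w)) \<in> sfun_part n False V"
    by (auto simp: sfun_part_iff sfun_restrict_def gscalar_def split: if_splits)
  have "(\<lambda>w. if S = {0} then \<phi> w else 0) holomorphic_on V" for S :: "nat set"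
    using assms by (cases "S = {0}") auto
  then have "sfun_restrict V (\<lambda>w S. if S = {0} then \<phi> w else 0) \<in> carrier (sfun_ring n V)"
    by (intro sfun_restrict_carrier) (auto split: if_splits)
  then show "sfun_restrict V (\<lambda>w S. if S = {0} then \<phi> w else 0) \<in> sfun_part n True V"
    by (auto simp: sfun_part_iff sfun_restrict_def split: if_splits)
qed

text \<open>
  Every superfunction is, up to a multiple of \<open>z - w\<^sub>0\<close>, its value at \<open>w\<^sub>0\<close>. This is what makes a
  derivation vanish once it annihilates the constants and the coordinates.
\<close>

lemma sfun_factor:
  assumes V: "open V" and f: "f \<in> carrier (sfun_ring n V)" and w0: "w0 \<in> V"
  obtains a b h where "a \<in> carrier (grassmann {1..n})" "b \<in> carrier (grassmann {1..n})"
    "h \<in> carrier (sfun_ring n V)"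
    "f = (\<lambda>w S. sfun_restrict V (\<lambda>w. a) w S + gmult (sfun_theta V w) (sfun_restrict V (\<lambda>w. b) w) S
            + gmult (\<lambda>T. sfun_z V w T + sfun_restrict V (\<lambda>w. gscalar (- w0)) w T) (h w) S)"
proof
  let ?a = "\<lambda>S. if 0 \<in> S then 0 else f w0 S"
  let ?b = "\<lambda>S. if 0 \<in> S then 0 else f w0 (insert 0 S)"
  let ?h = "\<lambda>w S. if w \<in> V then (if w = w0 then deriv (\<lambda>u. f u S) w0 else (f w S - f w0 S) / (w - w0)) else 0"
  have fn: "f w S \<noteq> 0 \<Longrightarrow> S \<subseteq> {..n}" for w S using f by (auto simp: sfun_carrier_iff)
  show "?a \<in> carrier (grassmann {1..n})"
    using fn by (force simp: grassmann_def Suc_le_eq intro: gr0I)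
  show "?b \<in> carrier (grassmann {1..n})"
    using fn by (force simp: grassmann_def Suc_le_eq intro: gr0I)
  have hol: "(\<lambda>w. f w S) holomorphic_on V" for S using f by (auto simp: sfun_carrier_iff)
  show h: "?h \<in> carrier (sfun_ring n V)"
    unfolding sfun_carrier_iff
  proof (intro conjI allI impI)
    fix S
    show "(\<lambda>w. ?h w S) holomorphic_on V"
    proof (rule pole_theorem_open_0[where a = w0 and g = "\<lambda>w. f w S - f w0 S"])
      show "(\<lambda>w. f w S - f w0 S) holomorphic_on V" using hol by (intro holomorphic_intros) auto
      show "?h w0 S = deriv (\<lambda>w. f w S - f w0 S) w0"
        using w0 sfun_field_differentiable[OF V f w0, of S] by simp
    qed (use V in auto)
  next
    fix w S assume *: "?h w S \<noteq> 0"
    then show "w \<in> V" by (auto split: if_splits)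
    show "S \<subseteq> {..n}"
    proof (rule ccontr)
      assume "\<not> S \<subseteq> {..n}"
      then have "f u S = 0" for u using fn by blast
      with * show False by (auto split: if_splits)
    qed
  qed
  show "f = (\<lambda>w S. sfun_restrict V (\<lambda>w. ?a) w S + gmult (sfun_theta V w) (sfun_restrict V (\<lambda>w. ?b) w) S
            + gmult (\<lambda>T. sfun_z V w T + sfun_restrict V (\<lambda>w. gscalar (- w0)) w T) (?h w) S)"
  proof (intro ext)
    fix w :: complex and S :: "nat set"
    consider "w \<notin> V" | "infinite S" "w \<in> V" | "w \<in> V" "finite S" by blast
    then show "f w S = sfun_restrict V (\<lambda>w. ?a) w S + gmult (sfun_theta V w) (sfun_restrict V (\<lambda>w. ?b) w) S
            + gmult (\<lambda>T. sfun_z V w T + sfun_restrict V (\<lambda>w. gscalar (- w0)) w T) (?h w) S"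
    proof cases
      case 1
      then show ?thesis using f by (auto simp: sfun_carrier_iff sfun_restrict_def gmult_eq)
    next
      case 2
      then show ?thesis
        using sfun_infinite[OF f 2(1)] by (simp add: gmult_infinite sfun_restrict_def)
    next
      case 3
      have "(\<lambda>T. sfun_z V w T + sfun_restrict V (\<lambda>w. gscalar (- w0)) w T) = gscalar (w - w0)"
        using 3 by (auto simp: sfun_z_def sfun_restrict_def gscalar_def)
      moreover have "sfun_theta V w = (\<lambda>S. if S = {0} then 1 else 0)"
        using 3 by (auto simp: sfun_theta_def sfun_restrict_def)
      moreover have "(w - w0) * ?h w S = f w S - f w0 S" using 3 by auto
      ultimately show ?thesis
        using 3 by (simp add: gmult_scalar_left gmult_theta_left sfun_restrict_def insert_absorb)
    qed
  qed
qed

section \<open>Primitives of superfunctions\<close>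

definition has_primitives :: "complex set \<Rightarrow> bool" where
  "has_primitives V \<longleftrightarrow>
     (\<forall>f. f holomorphic_on V \<longrightarrow> (\<exists>F. \<forall>w\<in>V. (F has_field_derivative f w) (at w)))"

lemma has_primitives_ball: "has_primitives (ball w r)"
  unfolding has_primitives_def
proof (intro allI impI)
  fix f assume "f holomorphic_on ball w r"
  then obtain F where "\<And>z. z \<in> ball w r \<Longrightarrow> (F has_field_derivative f z) (at z within ball w r)"
    using holomorphic_convex_primitive'[of "ball w r" f] by blast
  then show "\<exists>F. \<forall>z\<in>ball w r. (F has_field_derivative f z) (at z)"
    by (metis at_within_open open_ball)
qed

text \<open>
  \<open>D (u\<^sub>0 + \<theta> u\<^sub>1) = f\<^sub>0 + \<theta> f\<^sub>1\<close> means \<open>u\<^sub>1 = f\<^sub>0\<close> and \<open>u\<^sub>0' = f\<^sub>1\<close>. Zero is chosen as the primitive of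
  zero, so that coefficients that vanish in \<open>f\<close> also vanish in \<open>u\<close>.
\<close>

lemma sfun_D_surj:
  assumes V: "open V" "has_primitives V" and f: "f \<in> sfun_part n p V"
  obtains u where "u \<in> sfun_part n (\<not> p) V" "sfun_D V u = f"
    "\<forall>Q. (\<forall>w T. T - {0} \<in> Q \<longrightarrow> f w T = 0) \<longrightarrow> (\<forall>w T. T - {0} \<in> Q \<longrightarrow> u w T = 0)"
proof -
  have fc: "f \<in> carrier (sfun_ring n V)" and odd: "\<And>w S. f w S \<noteq> 0 \<Longrightarrow> odd (card S) = p"
    using f by (auto simp: sfun_part_iff)
  have supp: "\<And>w S. f w S \<noteq> 0 \<Longrightarrow> w \<in> V" "\<And>w S. f w S \<noteq> 0 \<Longrightarrow> S \<subseteq> {..n}"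
    and hol: "\<And>S. (\<lambda>w. f w S) holomorphic_on V"
    using fc by (auto simp: sfun_carrier_iff)
  have "\<exists>F. (\<forall>w\<in>V. (F has_field_derivative f w (insert 0 T)) (at w)) \<and>
      ((\<forall>w. f w (insert 0 T) = 0) \<longrightarrow> F = (\<lambda>_. 0))" for T
  proof (cases "\<forall>w. f w (insert 0 T) = 0")
    case False
    then show ?thesis using V(2) hol[of "insert 0 T"] unfolding has_primitives_def by blast
  qed (auto intro!: exI[of _ "\<lambda>_. 0"])
  then obtain F where F: "\<And>T w. w \<in> V \<Longrightarrow> (F T has_field_derivative f w (insert 0 T)) (at w)"
    and F0: "\<And>T. \<forall>w. f w (insert 0 T) = 0 \<Longrightarrow> F T = (\<lambda>_. 0)"
    by metis
  define u where "u = sfun_restrict V (\<lambda>w T. if 0 \<in> T then f w (T - {0}) else F T w)"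
  have nz: "(0 \<in> T \<and> f w (T - {0}) \<noteq> 0) \<or> (0 \<notin> T \<and> (\<exists>w. f w (insert 0 T) \<noteq> 0))"
    if "u w T \<noteq> 0" for w T
  proof -
    have "\<exists>w. f w (insert 0 T) \<noteq> 0" if nz: "F T w \<noteq> 0"
    proof (rule ccontr)
      assume "\<not> ?thesis"
      then have "F T = (\<lambda>_. 0)" by (intro F0) simp
      with nz show False by simp
    qed
    then show ?thesis using that by (simp add: u_def sfun_restrict_def split: if_splits)
  qed
  have uc: "u \<in> carrier (sfun_ring n V)"
    unfolding u_def
  proof (rule sfun_restrict_carrier)
    fix w S assume "(if 0 \<in> S then f w (S - {0}) else F S w) \<noteq> 0" "w \<in> V"
    then have "u w S \<noteq> 0" by (simp add: u_def sfun_restrict_def)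
    from nz[OF this] show "S \<subseteq> {..n}"
      using supp(2)[of w "S - {0}"] supp(2)[of _ "insert 0 S"] by auto
  next
    fix S
    have "F S holomorphic_on V"
      unfolding holomorphic_on_def field_differentiable_def using F has_field_derivative_at_within by blast
    then show "(\<lambda>w. if 0 \<in> S then f w (S - {0}) else F S w) holomorphic_on V"
      using hol[of "S - {0}"] by (cases "0 \<in> S") auto
  qed
  have "odd (card S) = (\<not> p)" if "u w S \<noteq> 0" for w S
  proof -
    have fin: "finite S" using that sfun_infinite[OF uc] by blast
    from nz[OF that] show ?thesis
    proof (elim disjE conjE exE)
      assume "0 \<in> S" "f w (S - {0}) \<noteq> 0"
      then show ?thesis using odd[of w "S - {0}"] fin card_gt_0_iff[of S] by (auto simp: card_Diff_singleton)
    next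
      fix w' assume "0 \<notin> S" "f w' (insert 0 S) \<noteq> 0"
      then show ?thesis using odd[of w' "insert 0 S"] fin by auto
    qed
  qed
  then have up: "u \<in> sfun_part n (\<not> p) V" using uc by (simp add: sfun_part_iff)
  have Du: "sfun_D V u = f"
  proof (intro ext)
    fix w :: complex and T :: "nat set"
    consider "w \<notin> V" | "w \<in> V" "0 \<in> T" | "w \<in> V" "0 \<notin> T" by blast
    then show "sfun_D V u w T = f w T"
    proof cases
      case 1
      then show ?thesis using supp(1) by (auto simp: sfun_D_def sfun_restrict_def)
    next
      case 2
      have "((\<lambda>w. u w (T - {0})) has_field_derivative f w (insert 0 (T - {0}))) (at w)"
        by (rule has_field_derivative_transform_within_open[OF F[OF 2(1), of "T - {0}"] V(1) 2(1)])
          (simp add: u_def sfun_restrict_def)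
      then show ?thesis
        using 2 by (simp add: sfun_D_def sfun_restrict_def DERIV_imp_deriv insert_absorb)
    next
      case 3
      then show ?thesis by (simp add: sfun_D_def sfun_restrict_def u_def)
    qed
  qed
  have "u w T = 0" if Q: "\<And>w T. T - {0} \<in> Q \<Longrightarrow> f w T = 0" and T: "T - {0} \<in> Q" for Q w T
  proof (rule ccontr)
    assume "u w T \<noteq> 0"
    from nz[OF this] show False
      using Q[of "T - {0}" w] Q[of "insert 0 T"] T by (auto simp: insert_Diff_if)
  qed
  then have "\<forall>Q. (\<forall>w T. T - {0} \<in> Q \<longrightarrow> f w T = 0) \<longrightarrow> (\<forall>w T. T - {0} \<in> Q \<longrightarrow> u w T = 0)"
    by blast
  with up Du show thesis by (rule that)
qed

section \<open>Sections of the structure sheaf\<close>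

locale curve =
  fixes X :: "('a, 's) scurve"
  assumes curve: "superconformal_curve X"
begin

abbreviation op :: "'a set \<Rightarrow> bool" where "op \<equiv> openin (tsp X)"

abbreviation sec_mult :: "'s \<Rightarrow> 'a set \<Rightarrow> 's \<Rightarrow> 's" ("_ \<otimes>[_] _" [70, 0, 71] 70) where
  "s \<otimes>[W] t \<equiv> s \<otimes>\<^bsub>sec X W\<^esub> t"

abbreviation sec_add :: "'s \<Rightarrow> 'a set \<Rightarrow> 's \<Rightarrow> 's" ("_ \<oplus>[_] _" [65, 0, 66] 65) where
  "s \<oplus>[W] t \<equiv> s \<oplus>\<^bsub>sec X W\<^esub> t"

abbreviation sec_minus :: "'s \<Rightarrow> 'a set \<Rightarrow> 's \<Rightarrow> 's" ("_ \<ominus>[_] _" [65, 0, 66] 65) where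
  "s \<ominus>[W] t \<equiv> s \<ominus>\<^bsub>sec X W\<^esub> t"

abbreviation sec_uminus :: "'a set \<Rightarrow> 's \<Rightarrow> 's" ("\<ominus>[_] _" [0, 81] 80) where
  "\<ominus>[W] s \<equiv> \<ominus>\<^bsub>sec X W\<^esub> s"

abbreviation sec_zero :: "'a set \<Rightarrow> 's" ("\<zero>[_]") where "\<zero>[W] \<equiv> \<zero>\<^bsub>sec X W\<^esub>"

abbreviation sec_one :: "'a set \<Rightarrow> 's" ("\<one>[_]") where "\<one>[W] \<equiv> \<one>\<^bsub>sec X W\<^esub>"

lemma sheaf: "superspace X"
  using curve by (simp only: superconformal_curve_def)

lemma presheaf: "superalgebra_presheaf X"
  using sheaf by (simp only: superspace_def)

lemma superalg:
  assumes "op U" shows "superalgebra X U"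
  using presheaf assms unfolding superalgebra_presheaf_def by blast

context
  fixes U assumes U: "op U"
begin

lemmas superalg_conjuncts = superalg[OF U, unfolded superalgebra_def]

lemma sec_ring: "ring (sec X U)"
  using superalg_conjuncts[THEN conjunct1] by blast

lemma part_carrier: "s \<in> part X p U \<Longrightarrow> s \<in> carrier (sec X U)"
  using superalg_conjuncts[THEN conjunct2, THEN conjunct1] by blast

lemma part_zero: "\<zero>[U] \<in> part X p U"
  using superalg_conjuncts[THEN conjunct2, THEN conjunct1] by blast

lemma part_minus: "s \<in> part X p U \<Longrightarrow> t \<in> part X p U \<Longrightarrow> s \<ominus>[U] t \<in> part X p U"
  using superalg_conjuncts[THEN conjunct2, THEN conjunct1] by blast

lemma part_mult: "s \<in> part X p U \<Longrightarrow> t \<in> part X q U \<Longrightarrow> s \<otimes>[U] t \<in> part X (p \<noteq> q) U"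
  using superalg_conjuncts[THEN conjunct2, THEN conjunct2, THEN conjunct2, THEN conjunct1] by blast

lemma part_commute: "s \<in> part X p U \<Longrightarrow> t \<in> part X q U \<Longrightarrow> s \<otimes>[U] t = (if p \<and> q then \<ominus>[U] (t \<otimes>[U] s) else t \<otimes>[U] s)"
  using superalg_conjuncts[THEN conjunct2, THEN conjunct2, THEN conjunct2, THEN conjunct1] by metis

lemma part_decompose_ex1: "s \<in> carrier (sec X U) \<Longrightarrow> \<exists>!(t, u). t \<in> part X False U \<and> u \<in> part X True U \<and> s = t \<oplus>[U] u"
  using superalg_conjuncts[THEN conjunct2, THEN conjunct2, THEN conjunct1] by (rule bspec)

lemma cst_hom: "cst X U \<in> ring_hom (Lam X) (sec X U)"
  using superalg_conjuncts[THEN conjunct2, THEN conjunct2, THEN conjunct2, THEN conjunct2, THEN conjunct1] by blast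

lemma cst_part: "a \<in> Lam_part X p \<Longrightarrow> cst X U a \<in> part X p U"
  using superalg_conjuncts[THEN conjunct2, THEN conjunct2, THEN conjunct2, THEN conjunct2, THEN conjunct2] by blast

end

lemma part_uminus:
  assumes "op U" "s \<in> part X p U" shows "\<ominus>[U] s \<in> part X p U"
proof -
  interpret ring "sec X U" using assms(1) by (rule sec_ring)
  show ?thesis
    using part_minus[OF assms(1) part_zero[OF assms(1)] assms(2)] part_carrier[OF assms]
    by (simp only: minus_eq l_zero a_inv_closed zero_closed)
qed

lemma part_add:
  assumes "op U" "s \<in> part X p U" "t \<in> part X p U" shows "s \<oplus>[U] t \<in> part X p U"
proof -
  interpret ring "sec X U" using assms(1) by (rule sec_ring)
  show ?thesis
    using part_minus[OF assms(1,2) part_uminus[OF assms(1,3)]] part_carrier[OF assms(1,2)]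
      part_carrier[OF assms(1,3)]
    by (simp only: minus_eq minus_minus a_inv_closed)
qed

lemma part_mult_even:
  "op U \<Longrightarrow> s \<in> part X False U \<Longrightarrow> t \<in> part X q U \<Longrightarrow> s \<otimes>[U] t \<in> part X q U"
  using part_mult[of U s False t q] by simp

lemma odd_mult_odd:
  "op U \<Longrightarrow> s \<in> part X True U \<Longrightarrow> t \<in> part X True U \<Longrightarrow> s \<otimes>[U] t \<in> part X False U"
  using part_mult[of U s True t True] by simp

lemma part_decompose:
  assumes "op U" "s \<in> carrier (sec X U)"
  obtains t u where "t \<in> part X False U" "u \<in> part X True U" "s = t \<oplus>[U] u"
  using part_decompose_ex1[OF assms] by blast

lemma part_decompose':
  assumes U: "op U" and s: "s \<in> carrier (sec X U)"
  obtains t u where "t \<in> part X p U" "u \<in> part X (\<not> p) U" "s = t \<oplus>[U] u"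
proof -
  interpret ring "sec X U" using U by (rule sec_ring)
  obtain a b where ab: "a \<in> part X False U" "b \<in> part X True U" "s = a \<oplus>[U] b"
    using part_decompose[OF U s] .
  moreover have "s = b \<oplus>[U] a"
    using ab a_comm[OF part_carrier[OF U ab(1)] part_carrier[OF U ab(2)]] by simp
  ultimately show thesis
    by (cases p) (simp_all add: that)
qed

lemma part_disjoint:
  assumes U: "op U" and "s \<in> part X False U" "s \<in> part X True U"
  shows "s = \<zero>[U]"
proof -
  interpret ring "sec X U" using U by (rule sec_ring)
  have "\<exists>!(t, u). t \<in> part X False U \<and> u \<in> part X True U \<and> s = t \<oplus>[U] u"
    by (rule part_decompose_ex1[OF U part_carrier[OF U assms(2)]])
  then obtain x where x: "\<And>y. (case y of (t, u) \<Rightarrow> t \<in> part X False U \<and> u \<in> part X True U \<and>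
      s = t \<oplus>[U] u) \<Longrightarrow> y = x"
    unfolding Ex1_def by blast
  have "(s, \<zero>[U]) = x" "(\<zero>[U], s) = x"
    using part_carrier[OF U assms(2)] part_zero[OF U] assms by (simp_all add: x)
  then show ?thesis by auto
qed

lemma even_commute:
  assumes U: "op U" and "s \<in> part X False U" "t \<in> carrier (sec X U)"
  shows "s \<otimes>[U] t = t \<otimes>[U] s"
proof -
  interpret ring "sec X U" using U by (rule sec_ring)
  obtain a b where "a \<in> part X False U" "b \<in> part X True U" "t = a \<oplus>[U] b"
    using part_decompose[OF U assms(3)] .
  then show ?thesis
    using part_commute[OF U assms(2)] part_carrier[OF U] assms(2) by (simp add: l_distr r_distr)
qed

lemma even_lcommute:
  assumes U: "op U" and "s \<in> part X False U" "t \<in> carrier (sec X U)" "u \<in> carrier (sec X U)"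
  shows "t \<otimes>[U] (s \<otimes>[U] u) = s \<otimes>[U] (t \<otimes>[U] u)"
proof -
  interpret ring "sec X U" using U by (rule sec_ring)
  show ?thesis
    using even_commute[OF U assms(2,3)] part_carrier[OF U assms(2)] assms(3,4)
    by (simp add: m_assoc[symmetric])
qed

lemma cst_closed: "op U \<Longrightarrow> a \<in> carrier (Lam X) \<Longrightarrow> cst X U a \<in> carrier (sec X U)"
  by (rule ring_hom_closed[OF cst_hom])

lemma cst_one: "op U \<Longrightarrow> cst X U (gscalar 1) = \<one>[U]"
  using ring_hom_one[OF cst_hom] by (simp add: grassmann_def)

lemma one_even: "op U \<Longrightarrow> \<one>[U] \<in> part X False U"
  using cst_part[OF _ gscalar_Lam[of 1]] by (simp add: cst_one)

context
  fixes U assumes U: "op U"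
begin

lemma res_id: "s \<in> carrier (sec X U) \<Longrightarrow> res X U U s = s"
  using presheaf U unfolding superalgebra_presheaf_def by blast

context
  fixes V assumes V: "op V" "V \<subseteq> U"
begin

lemma res_hom: "res X U V \<in> ring_hom (sec X U) (sec X V)"
  and res_part: "s \<in> part X p U \<Longrightarrow> res X U V s \<in> part X p V"
  and res_cst: "a \<in> carrier (Lam X) \<Longrightarrow> res X U V (cst X U a) = cst X V a"
  and res_res: "op W \<Longrightarrow> W \<subseteq> V \<Longrightarrow> s \<in> carrier (sec X U) \<Longrightarrow>
     res X V W (res X U V s) = res X U W s"
  using presheaf U V unfolding superalgebra_presheaf_def by blast+

end

end

lemma res_closed:
  "op U \<Longrightarrow> op V \<Longrightarrow> V \<subseteq> U \<Longrightarrow> s \<in> carrier (sec X U) \<Longrightarrow> res X U V s \<in> carrier (sec X V)"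
  by (rule ring_hom_closed[OF res_hom])

lemma res_add:
  "op U \<Longrightarrow> op V \<Longrightarrow> V \<subseteq> U \<Longrightarrow> s \<in> carrier (sec X U) \<Longrightarrow> t \<in> carrier (sec X U) \<Longrightarrow>
     res X U V (s \<oplus>[U] t) = res X U V s \<oplus>[V] res X U V t"
  by (rule ring_hom_add[OF res_hom])

lemma res_mult:
  "op U \<Longrightarrow> op V \<Longrightarrow> V \<subseteq> U \<Longrightarrow> s \<in> carrier (sec X U) \<Longrightarrow> t \<in> carrier (sec X U) \<Longrightarrow>
     res X U V (s \<otimes>[U] t) = res X U V s \<otimes>[V] res X U V t"
  by (rule ring_hom_mult[OF res_hom])

lemma res_one: "op U \<Longrightarrow> op V \<Longrightarrow> V \<subseteq> U \<Longrightarrow> res X U V \<one>[U] = \<one>[V]"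
  by (rule ring_hom_one[OF res_hom])

lemma res_zero: "op U \<Longrightarrow> op V \<Longrightarrow> V \<subseteq> U \<Longrightarrow> res X U V \<zero>[U] = \<zero>[V]"
  by (rule ring_hom_zero[OF res_hom sec_ring sec_ring])

lemma res_uminus:
  assumes "op U" "op V" "V \<subseteq> U" "s \<in> carrier (sec X U)"
  shows "res X U V (\<ominus>[U] s) = \<ominus>[V] res X U V s"
proof -
  interpret U: ring "sec X U" using assms(1) by (rule sec_ring)
  interpret V: ring "sec X V" using assms(2) by (rule sec_ring)
  have "res X U V (\<ominus>[U] s) \<oplus>[V] res X U V s = \<zero>[V]"
    using res_add[OF assms(1-3), of "\<ominus>[U] s" s] assms by (simp add: U.l_neg res_zero)
  then show ?thesis
    using assms by (intro V.minus_equality[symmetric]) (auto intro: res_closed)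
qed

lemma res_minus:
  assumes "op U" "op V" "V \<subseteq> U" "s \<in> carrier (sec X U)" "t \<in> carrier (sec X U)"
  shows "res X U V (s \<ominus>[U] t) = res X U V s \<ominus>[V] res X U V t"
proof -
  interpret U: ring "sec X U" using assms(1) by (rule sec_ring)
  interpret V: ring "sec X V" using assms(2) by (rule sec_ring)
  show ?thesis using assms by (simp add: U.minus_eq V.minus_eq res_add res_uminus)
qed

lemma sheaf_ex1:
  assumes "\<And>U. U \<in> \<U> \<Longrightarrow> op U" "\<And>U. U \<in> \<U> \<Longrightarrow> s U \<in> carrier (sec X U)"
    "\<And>U V. U \<in> \<U> \<Longrightarrow> V \<in> \<U> \<Longrightarrow> res X U (U \<inter> V) (s U) = res X V (U \<inter> V) (s V)"
  shows "\<exists>!t. t \<in> carrier (sec X (\<Union>\<U>)) \<and> (\<forall>U\<in>\<U>. res X (\<Union>\<U>) U t = s U)"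
  by (rule sheaf[unfolded superspace_def, THEN conjunct2, THEN spec, THEN spec, THEN mp])
     (use assms in auto)

lemma sections_eqI:
  assumes U: "op U" and s: "s \<in> carrier (sec X U)" "t \<in> carrier (sec X U)"
    and loc: "\<And>x. x \<in> U \<Longrightarrow> \<exists>V. op V \<and> x \<in> V \<and> V \<subseteq> U \<and> res X U V s = res X U V t"
  shows "s = t"
proof -
  define \<U> where "\<U> = {V. op V \<and> V \<subseteq> U \<and> res X U V s = res X U V t}"
  have un: "\<Union>\<U> = U" using loc by (auto simp: \<U>_def)
  have "\<exists>!r. r \<in> carrier (sec X (\<Union>\<U>)) \<and> (\<forall>V\<in>\<U>. res X (\<Union>\<U>) V r = res X U V s)"
  proof (rule sheaf_ex1)
    fix V W assume "V \<in> \<U>" "W \<in> \<U>"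
    then show "res X V (V \<inter> W) (res X U V s) = res X W (V \<inter> W) (res X U W s)"
      using U s by (auto simp: \<U>_def res_res openin_Int)
  qed (use U s in \<open>auto simp: \<U>_def intro: res_closed\<close>)
  then have ex1: "\<exists>!r. r \<in> carrier (sec X U) \<and> (\<forall>V\<in>\<U>. res X U V r = res X U V s)"
    unfolding un .
  have "(THE r. r \<in> carrier (sec X U) \<and> (\<forall>V\<in>\<U>. res X U V r = res X U V s)) = s"
    by (rule the1_equality[OF ex1]) (simp add: s)
  moreover have "(THE r. r \<in> carrier (sec X U) \<and> (\<forall>V\<in>\<U>. res X U V r = res X U V s)) = t"
    by (rule the1_equality[OF ex1]) (use s in \<open>simp add: \<U>_def\<close>)
  ultimately show "s = t" by (rule trans[OF sym])
qed

text \<open>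
  The covering is indexed, so that several members may have the same underlying open set; this is
  what coverings by coordinate domains need.
\<close>

lemma sections_glue:
  assumes op: "\<And>i. i \<in> I \<Longrightarrow> op (V i)" and U: "U = (\<Union>i\<in>I. V i)"
    and s: "\<And>i. i \<in> I \<Longrightarrow> s i \<in> carrier (sec X (V i))"
    and compat: "\<And>i j. i \<in> I \<Longrightarrow> j \<in> I \<Longrightarrow>
      res X (V i) (V i \<inter> V j) (s i) = res X (V j) (V i \<inter> V j) (s j)"
  obtains t where "t \<in> carrier (sec X U)" "\<And>i. i \<in> I \<Longrightarrow> res X U (V i) t = s i"
proof -
  define pick where "pick W = (SOME i. i \<in> I \<and> V i = W)" for W
  have pick: "pick W \<in> I \<and> V (pick W) = W" if "W \<in> V ` I" for W
    unfolding pick_def by (rule someI_ex[where P = "\<lambda>i. i \<in> I \<and> V i = W"]) (use that in auto)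
  have "\<exists>!t. t \<in> carrier (sec X (\<Union>(V ` I))) \<and> (\<forall>W\<in>V ` I. res X (\<Union>(V ` I)) W t = s (pick W))"
  proof (rule sheaf_ex1)
    fix W assume "W \<in> V ` I"
    then have "pick W \<in> I" "V (pick W) = W" using pick by blast+
    then show "op W" "s (pick W) \<in> carrier (sec X W)" using op[of "pick W"] s[of "pick W"] by auto
  next
    fix W W' assume "W \<in> V ` I" "W' \<in> V ` I"
    then have "pick W \<in> I" "V (pick W) = W" "pick W' \<in> I" "V (pick W') = W'" using pick by blast+
    then show "res X W (W \<inter> W') (s (pick W)) = res X W' (W \<inter> W') (s (pick W'))"
      using compat[of "pick W" "pick W'"] by simp
  qed
  then obtain t where "t \<in> carrier (sec X (\<Union>(V ` I))) \<and>
      (\<forall>W\<in>V ` I. res X (\<Union>(V ` I)) W t = s (pick W))"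
    by (rule ex1E)
  then have t: "t \<in> carrier (sec X U)" "\<And>W. W \<in> V ` I \<Longrightarrow> res X U W t = s (pick W)"
    unfolding U by auto
  have "res X U (V i) t = s i" if i: "i \<in> I" for i
  proof -
    have p: "pick (V i) \<in> I" "V (pick (V i)) = V i" using pick[OF imageI[OF i]] by auto
    have "s (pick (V i)) = s i"
      using compat[OF p(1) i] s[OF p(1)] s[OF i] res_id[OF op[OF i]] by (simp add: p(2))
    then show ?thesis using t(2) i by simp
  qed
  with t(1) that show thesis by blast
qed

text \<open>The component of the other parity vanishes locally, hence globally.\<close>

lemma part_local:
  assumes U: "op U" and s: "s \<in> carrier (sec X U)"
    and loc: "\<And>x. x \<in> U \<Longrightarrow> \<exists>V. op V \<and> x \<in> V \<and> V \<subseteq> U \<and> res X U V s \<in> part X p V"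
  shows "s \<in> part X p U"
proof -
  interpret U: ring "sec X U" using U by (rule sec_ring)
  obtain t u where tu: "t \<in> part X p U" "u \<in> part X (\<not> p) U" "s = t \<oplus>[U] u"
    using part_decompose'[OF U s] .
  have c: "t \<in> carrier (sec X U)" "u \<in> carrier (sec X U)"
    using tu part_carrier[OF U] by auto
  have "u = \<zero>[U]"
  proof (rule sections_eqI[OF U])
    fix x assume "x \<in> U"
    then obtain V where V: "op V" "x \<in> V" "V \<subseteq> U" "res X U V s \<in> part X p V" using loc by blast
    interpret V: ring "sec X V" using V by (intro sec_ring)
    have rt: "res X U V t \<in> part X p V" and ru: "res X U V u \<in> part X (\<not> p) V"
      using tu U V by (auto intro: res_part)
    have "res X U V u = res X U V s \<ominus>[V] res X U V t"
      using c res_closed[OF U V(1,3)]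
      by (simp add: tu(3) res_add[OF U V(1,3)] V.a_comm[of "res X U V t"] V.minus_eq V.a_assoc V.r_neg)
    then have "res X U V u \<in> part X p V" using part_minus[OF V(1,4) rt] by simp
    then have "res X U V u = \<zero>[V]"
      using part_disjoint[OF V(1)] ru by (cases p) auto
    then show "\<exists>V. op V \<and> x \<in> V \<and> V \<subseteq> U \<and> res X U V u = res X U V \<zero>[U]"
      using V U by (auto simp: res_zero)
  qed (use c in auto)
  then show ?thesis using tu c by simp
qed


section \<open>Charts\<close>

abbreviation im :: "('a, 's) chart \<Rightarrow> 'a set \<Rightarrow> complex set" where
  "im c W \<equiv> cbody c ` W"

lemma chart_dom: "is_chart X c \<Longrightarrow> op (cdom c)"
  and chart_image: "is_chart X c \<Longrightarrow> open (im c (cdom c))"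
  and chart_homeo: "is_chart X c \<Longrightarrow>
    homeomorphic_map (subtopology (tsp X) (cdom c)) (top_of_set (im c (cdom c))) (cbody c)"
  unfolding is_chart_def by (elim conjE; simp)+

lemma chart_open:
  assumes "is_chart X c" "op W" "W \<subseteq> cdom c"
  shows "open (im c W)"
proof -
  note h = chart_homeo[OF assms(1)] and o = chart_image[OF assms(1)]
  have "openin (subtopology (tsp X) (cdom c)) W"
    using openin_subtopology_Int[OF assms(2), of "cdom c"] assms(3) by (simp add: Int_absorb2)
  then have "openin (top_of_set (im c (cdom c))) (im c W)"
    using homeomorphic_imp_open_map[OF h] by (auto simp: open_map_def)
  then show ?thesis using o openin_open_eq by blast
qed

lemma chart_inj: "is_chart X c \<Longrightarrow> inj_on (cbody c) (cdom c)"
  using homeomorphic_imp_injective_map[OF chart_homeo] openin_subset[OF chart_dom]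
  by (simp add: Int_absorb1)

lemma chart_continuous:
  assumes "is_chart X c" "open B"
  shows "op {x \<in> cdom c. cbody c x \<in> B}"
proof -
  note h = chart_homeo[OF assms(1)] and o = chart_dom[OF assms(1)]
  have "continuous_map (subtopology (tsp X) (cdom c)) (top_of_set (im c (cdom c))) (cbody c)"
    using h by (rule homeomorphic_imp_continuous_map)
  then have "continuous_map (subtopology (tsp X) (cdom c)) euclidean (cbody c)"
    by (simp add: continuous_map_in_subtopology)
  then have "openin (subtopology (tsp X) (cdom c))
      {x \<in> topspace (subtopology (tsp X) (cdom c)). cbody c x \<in> B}"
    by (rule openin_continuous_map_preimage) (use assms(2) in simp)
  moreover have "topspace (subtopology (tsp X) (cdom c)) = cdom c"
    using openin_subset[OF o] by auto
  ultimately have "openin (subtopology (tsp X) (cdom c)) {x \<in> cdom c. cbody c x \<in> B}"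
    by (simp only:)
  then show ?thesis using o by (rule openin_trans_full)
qed

context
  fixes c W assumes c: "is_chart X c" and W: "op W" "W \<subseteq> cdom c"
begin

lemmas chart_iso = c[unfolded is_chart_def, THEN conjunct2, THEN conjunct2, THEN conjunct2,
  THEN bspec, OF CollectI[where P = "openin (tsp X)", OF W(1)], THEN mp, OF W(2)]

lemma iso_hom: "ciso c W \<in> ring_hom (sec X W) (sfun_ring (ngens X) (im c W))"
  and iso_bij: "bij_betw (ciso c W) (carrier (sec X W)) (carrier (sfun_ring (ngens X) (im c W)))"
  and iso_sfun_part: "s \<in> part X p W \<Longrightarrow> ciso c W s \<in> sfun_part (ngens X) p (im c W)"
  and iso_cst: "a \<in> carrier (Lam X) \<Longrightarrow> ciso c W (cst X W a) = sfun_restrict (im c W) (\<lambda>w. a)"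
  and iso_res: "op V \<Longrightarrow> V \<subseteq> W \<Longrightarrow> s \<in> carrier (sec X W) \<Longrightarrow>
      ciso c V (res X W V s) = sfun_restrict (im c V) (ciso c W s)"
  using chart_iso by blast+

lemma iso_closed: "s \<in> carrier (sec X W) \<Longrightarrow> ciso c W s \<in> carrier (sfun_ring (ngens X) (im c W))"
  using ring_hom_closed[OF iso_hom] .

lemma iso_inj: "s \<in> carrier (sec X W) \<Longrightarrow> t \<in> carrier (sec X W) \<Longrightarrow> ciso c W s = ciso c W t \<Longrightarrow> s = t"
  using iso_bij by (auto simp: bij_betw_def inj_on_def)

lemma iso_add:
  "s \<in> carrier (sec X W) \<Longrightarrow> t \<in> carrier (sec X W) \<Longrightarrow>
     ciso c W (s \<oplus>[W] t) = (\<lambda>w S. ciso c W s w S + ciso c W t w S)"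
  using ring_hom_add[OF iso_hom] by simp

lemma iso_mult:
  "s \<in> carrier (sec X W) \<Longrightarrow> t \<in> carrier (sec X W) \<Longrightarrow>
     ciso c W (s \<otimes>[W] t) = (\<lambda>w. gmult (ciso c W s w) (ciso c W t w))"
  using ring_hom_mult[OF iso_hom] by simp

lemma iso_zero: "ciso c W \<zero>[W] = (\<lambda>w S. 0)"
proof -
  interpret ring "sec X W" using W by (intro sec_ring)
  have "ciso c W \<zero>[W] = (\<lambda>w S. ciso c W \<zero>[W] w S + ciso c W \<zero>[W] w S)"
    using iso_add[of "\<zero>[W]" "\<zero>[W]"] by simp
  then have "ciso c W \<zero>[W] w S = ciso c W \<zero>[W] w S + ciso c W \<zero>[W] w S" for w S
    by meson
  then show ?thesis by (simp add: fun_eq_iff)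
qed

lemma iso_uminus: "s \<in> carrier (sec X W) \<Longrightarrow> ciso c W (\<ominus>[W] s) = (\<lambda>w S. - ciso c W s w S)"
proof -
  assume s: "s \<in> carrier (sec X W)"
  interpret ring "sec X W" using W by (intro sec_ring)
  have "(\<lambda>w S. ciso c W s w S + ciso c W (\<ominus>[W] s) w S) = (\<lambda>w S. 0)"
    using iso_add[of s "\<ominus>[W] s"] s by (simp add: r_neg iso_zero)
  then have "ciso c W s w S + ciso c W (\<ominus>[W] s) w S = 0" for w S by meson
  then show ?thesis by (simp add: fun_eq_iff eq_neg_iff_add_eq_0 add.commute)
qed

lemma iso_minus:
  "s \<in> carrier (sec X W) \<Longrightarrow> t \<in> carrier (sec X W) \<Longrightarrow>
     ciso c W (s \<ominus>[W] t) = (\<lambda>w S. ciso c W s w S - ciso c W t w S)"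
proof -
  interpret ring "sec X W" using W by (intro sec_ring)
  show "s \<in> carrier (sec X W) \<Longrightarrow> t \<in> carrier (sec X W) \<Longrightarrow> ?thesis"
    by (simp add: minus_eq iso_add iso_uminus)
qed

lemma from_closed: "f \<in> carrier (sfun_ring (ngens X) (im c W)) \<Longrightarrow> from_chart X c W f \<in> carrier (sec X W)"
  and iso_from: "f \<in> carrier (sfun_ring (ngens X) (im c W)) \<Longrightarrow> ciso c W (from_chart X c W f) = f"
  unfolding from_chart_def using iso_bij
  by (auto simp: bij_betw_def intro: the_inv_into_into f_the_inv_into_f)

text \<open>
  Charts preserve parities by definition. They also reflect them, because the component of the
  wrong parity is mapped to zero.
\<close>

lemma part_iff_iso:
  assumes s: "s \<in> carrier (sec X W)"
  shows "s \<in> part X p W \<longleftrightarrow> ciso c W s \<in> sfun_part (ngens X) p (im c W)"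
proof
  assume *: "ciso c W s \<in> sfun_part (ngens X) p (im c W)"
  interpret ring "sec X W" using W by (intro sec_ring)
  obtain t u where tu: "t \<in> part X p W" "u \<in> part X (\<not> p) W" "s = t \<oplus>[W] u"
    using part_decompose'[OF W(1) s] .
  have c: "t \<in> carrier (sec X W)" "u \<in> carrier (sec X W)"
    using tu part_carrier[OF W(1)] by auto
  have "ciso c W u w S = 0" for w S
  proof (rule ccontr)
    assume nz: "ciso c W u w S \<noteq> 0"
    then have "odd (card S) = (\<not> p)"
      using iso_sfun_part[OF tu(2)] by (auto simp: sfun_part_iff)
    then have "ciso c W s w S = 0" "ciso c W t w S = 0"
      using * iso_sfun_part[OF tu(1)] by (auto simp: sfun_part_iff)
    then show False using nz iso_add[OF c] tu(3) by simp
  qed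
  then have "u = \<zero>[W]" using c by (intro iso_inj) (auto simp: iso_zero)
  then show "s \<in> part X p W" using tu c by simp
qed (rule iso_sfun_part)

lemma from_part: "f \<in> sfun_part (ngens X) p (im c W) \<Longrightarrow> from_chart X c W f \<in> part X p W"
  by (subst part_iff_iso) (auto simp: from_closed iso_from sfun_part_iff)

lemma zc_part: "zc X c W \<in> part X False W"
  and thetac_part: "thetac X c W \<in> part X True W"
  by (auto simp: zc_def thetac_def intro: from_part sfun_z_part sfun_theta_part)

lemma iso_zc: "ciso c W (zc X c W) = sfun_z (im c W)"
  and iso_thetac: "ciso c W (thetac X c W) = sfun_theta (im c W)"
  using sfun_z_part sfun_theta_part by (auto simp: zc_def thetac_def sfun_part_iff intro!: iso_from)

lemma Dc_closed: "s \<in> carrier (sec X W) \<Longrightarrow> Dc X c W s \<in> carrier (sec X W)"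
  and iso_Dc: "s \<in> carrier (sec X W) \<Longrightarrow> ciso c W (Dc X c W s) = sfun_D (im c W) (ciso c W s)"
  unfolding Dc_def
  by (auto intro!: from_closed iso_from sfun_D_carrier iso_closed chart_open[OF c W])

lemma Dc_part: "s \<in> part X p W \<Longrightarrow> Dc X c W s \<in> part X (\<not> p) W"
  unfolding Dc_def by (intro from_part sfun_D_part chart_open[OF c W] iso_sfun_part)

lemma Dc_add:
  assumes "s \<in> carrier (sec X W)" "t \<in> carrier (sec X W)"
  shows "Dc X c W (s \<oplus>[W] t) = Dc X c W s \<oplus>[W] Dc X c W t"
proof -
  interpret ring "sec X W" using W by (intro sec_ring)
  show ?thesis
    using assms by (intro iso_inj)
      (auto simp: iso_Dc Dc_closed iso_add sfun_D_add[OF chart_open[OF c W] iso_closed iso_closed])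
qed

lemma Dc_mult:
  assumes "s \<in> part X p W" "t \<in> carrier (sec X W)"
  shows "Dc X c W (s \<otimes>[W] t) =
    (if p then (Dc X c W s \<otimes>[W] t) \<ominus>[W] (s \<otimes>[W] Dc X c W t)
     else (Dc X c W s \<otimes>[W] t) \<oplus>[W] (s \<otimes>[W] Dc X c W t))"
proof -
  interpret ring "sec X W" using W by (intro sec_ring)
  have s: "s \<in> carrier (sec X W)" using assms part_carrier[OF W(1)] by auto
  show ?thesis
    using s assms by (intro iso_inj)
      (auto simp: iso_Dc Dc_closed iso_add iso_minus iso_mult iso_closed iso_sfun_part
        sfun_D_mult[OF chart_open[OF c W] iso_sfun_part])
qed

lemma Dc_mult_even:
  "s \<in> part X False W \<Longrightarrow> t \<in> carrier (sec X W) \<Longrightarrow> Dc X c W (s \<otimes>[W] t) =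
     (Dc X c W s \<otimes>[W] t) \<oplus>[W] (s \<otimes>[W] Dc X c W t)"
  using Dc_mult[of s False t] by simp

lemma Dc_mult_odd:
  "s \<in> part X True W \<Longrightarrow> t \<in> carrier (sec X W) \<Longrightarrow> Dc X c W (s \<otimes>[W] t) =
     (Dc X c W s \<otimes>[W] t) \<ominus>[W] (s \<otimes>[W] Dc X c W t)"
  using Dc_mult[of s True t] by simp

lemma Dc_cst: "a \<in> carrier (Lam X) \<Longrightarrow> Dc X c W (cst X W a) = \<zero>[W]"
proof -
  interpret ring "sec X W" using W by (intro sec_ring)
  assume a: "a \<in> carrier (Lam X)"
  then have "a S = 0" if "0 \<in> S" for S using that by (force simp: grassmann_def)
  then show ?thesis
    using a W by (intro iso_inj)
      (auto simp: iso_Dc Dc_closed cst_closed iso_zero iso_cst sfun_D_const[OF chart_open[OF c W]])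
qed

lemma Dc_one: "Dc X c W \<one>[W] = \<zero>[W]"
  using Dc_cst[of "gscalar 1"] gscalar_Lam[of 1] W(1) by (auto simp: cst_one grass_part_def)

lemma Dc_zero: "Dc X c W \<zero>[W] = \<zero>[W]"
proof -
  interpret ring "sec X W" using W by (intro sec_ring)
  show ?thesis
    by (intro iso_inj) (auto simp: iso_Dc Dc_closed iso_zero sfun_D_def sfun_restrict_def fun_eq_iff)
qed

lemma Dc_uminus: "s \<in> carrier (sec X W) \<Longrightarrow> Dc X c W (\<ominus>[W] s) = \<ominus>[W] Dc X c W s"
proof -
  interpret ring "sec X W" using W by (intro sec_ring)
  assume s: "s \<in> carrier (sec X W)"
  have "Dc X c W (\<ominus>[W] s) \<oplus>[W] Dc X c W s = \<zero>[W]"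
    using Dc_add[of "\<ominus>[W] s" s] s by (simp add: l_neg Dc_zero)
  then show ?thesis using s by (intro minus_equality[symmetric]) (auto intro: Dc_closed)
qed

lemma Dc_thetac: "Dc X c W (thetac X c W) = \<one>[W]"
proof -
  interpret ring "sec X W" using W by (intro sec_ring)
  have V: "open (im c W)" by (rule chart_open[OF c W])
  have "S - {0} \<noteq> {0}" for S :: "nat set" by blast
  then have "deriv (\<lambda>u. sfun_theta (im c W) u (S - {0})) w = 0" for S w
    by (simp add: sfun_theta_def sfun_restrict_def)
  moreover have "insert 0 S = {0} \<longleftrightarrow> S = {}" if "0 \<notin> S" for S :: "nat set" using that by auto
  ultimately have "sfun_D (im c W) (sfun_theta (im c W)) = sfun_restrict (im c W) (\<lambda>w. gscalar 1)"
    by (auto simp: sfun_D_def sfun_restrict_def fun_eq_iff gscalar_def sfun_theta_def)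
  then show ?thesis
    using ring_hom_one[OF iso_hom] part_carrier[OF W(1) thetac_part]
    by (intro iso_inj) (auto simp: iso_Dc iso_thetac Dc_closed sfun_one)
qed

lemma Dc_zc: "Dc X c W (zc X c W) = thetac X c W"
proof -
  have V: "open (im c W)" by (rule chart_open[OF c W])
  have der: "deriv (\<lambda>u. sfun_z (im c W) u (S - {0})) w = (if S = {0} then 1 else 0)"
    if "w \<in> im c W" "0 \<in> S" for S w
  proof (cases "S = {0}")
    case True
    have "((\<lambda>u. u) has_field_derivative 1) (at w)" by simp
    then have "((\<lambda>u. sfun_z (im c W) u (S - {0})) has_field_derivative 1) (at w)"
      by (rule has_field_derivative_transform_within_open[OF _ V that(1)])
         (auto simp: sfun_z_def sfun_restrict_def gscalar_def True)
    then show ?thesis using True by (simp add: DERIV_imp_deriv)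
  next
    case False
    then have "S - {0} \<noteq> {}" using that by auto
    then have "sfun_z (im c W) u (S - {0}) = 0" for u
      by (simp only: sfun_z_def sfun_restrict_def gscalar_def if_False if_cancel)
    then show ?thesis using False by simp
  qed
  have z0: "sfun_z (im c W) w (insert 0 S) = 0" for w S
    by (simp add: sfun_z_def sfun_restrict_def gscalar_def)
  have "sfun_D (im c W) (sfun_z (im c W)) w S = sfun_theta (im c W) w S" for w S
  proof (cases "w \<in> im c W \<and> 0 \<in> S")
    case True
    then have "w \<in> im c W" "0 \<in> S" by auto
    then show ?thesis
      by (simp only: sfun_D_def sfun_restrict_def sfun_theta_def der if_True)
  qed (auto simp: sfun_D_def sfun_restrict_def sfun_theta_def z0)
  then have "sfun_D (im c W) (sfun_z (im c W)) = sfun_theta (im c W)"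
    by (intro ext)
  then show ?thesis
    using part_carrier[OF W(1) zc_part] part_carrier[OF W(1) thetac_part]
    by (intro iso_inj) (auto simp: iso_Dc iso_zc Dc_closed iso_thetac)
qed

end

context
  fixes c W V assumes c: "is_chart X c" and W: "op W" "W \<subseteq> cdom c" and V: "op V" "V \<subseteq> W"
begin

lemma Vc: "V \<subseteq> cdom c" using W V by auto

lemma zc_res: "res X W V (zc X c W) = zc X c V"
  using part_carrier[OF W(1) zc_part[OF c W]] part_carrier[OF V(1) zc_part[OF c V(1) Vc]]
    res_closed[OF W(1) V(1) V(2)] V(2)
  by (intro iso_inj[OF c V(1) Vc])
     (auto simp: iso_res[OF c W V] iso_zc[OF c W] iso_zc[OF c V(1) Vc] sfun_z_def sfun_restrict_def fun_eq_iff)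

lemma thetac_res: "res X W V (thetac X c W) = thetac X c V"
  using part_carrier[OF W(1) thetac_part[OF c W]] part_carrier[OF V(1) thetac_part[OF c V(1) Vc]]
    res_closed[OF W(1) V(1) V(2)] V(2)
  by (intro iso_inj[OF c V(1) Vc])
     (auto simp: iso_res[OF c W V] iso_thetac[OF c W] iso_thetac[OF c V(1) Vc] sfun_theta_def sfun_restrict_def fun_eq_iff)

lemma Dc_res:
  assumes s: "s \<in> carrier (sec X W)"
  shows "res X W V (Dc X c W s) = Dc X c V (res X W V s)"
proof (rule iso_inj[OF c V(1) Vc])
  have rs: "res X W V s \<in> carrier (sec X V)" by (rule res_closed[OF W(1) V s])
  have der: "deriv (\<lambda>u. sfun_restrict (im c V) (ciso c W s) u S) w = deriv (\<lambda>u. ciso c W s u S) w"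
    if "w \<in> im c V" for w S
    by (rule deriv_cong_ev)
       (use eventually_nhds_in_open[OF chart_open[OF c V(1) Vc] that] in
         \<open>auto elim!: eventually_mono simp: sfun_restrict_def\<close>)
  show "ciso c V (res X W V (Dc X c W s)) = ciso c V (Dc X c V (res X W V s))"
    using V(2) der unfolding iso_res[OF c W V Dc_closed[OF c W s]] iso_Dc[OF c W s]
      iso_Dc[OF c V(1) Vc rs] iso_res[OF c W V s]
    by (auto simp: sfun_D_def sfun_restrict_def fun_eq_iff)
  show "res X W V (Dc X c W s) \<in> carrier (sec X V)"
    by (rule res_closed[OF W(1) V Dc_closed[OF c W s]])
  show "Dc X c V (res X W V s) \<in> carrier (sec X V)" by (rule Dc_closed[OF c V(1) Vc rs])
qed

end


section \<open>Superconformal changes of coordinates\<close>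

lemma jac_part:
  assumes "is_chart X c" "is_chart X d" "op W" "W \<subseteq> cdom c" "W \<subseteq> cdom d"
  shows "jac X c d W \<in> part X False W"
  unfolding jac_def using Dc_part[OF assms(1,3,4) thetac_part[OF assms(2,3,5)]] by simp

lemma jac_res:
  assumes c: "is_chart X c" "is_chart X d" and W: "op W" "W \<subseteq> cdom c" "W \<subseteq> cdom d" and V: "op V" "V \<subseteq> W"
  shows "res X W V (jac X c d W) = jac X c d V"
  unfolding jac_def Dc_res[OF c(1) W(1,2) V part_carrier[OF W(1) thetac_part[OF c(2) W(1,3)]]]
    thetac_res[OF c(2) W(1,3) V] ..

lemma superconformal_change_on:
  assumes c: "is_chart X c" "is_chart X d" and sc: "superconformal_change X c d"
    and W: "op W" "W \<subseteq> cdom c" "W \<subseteq> cdom d"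
  shows "Dc X c W (zc X d W) = thetac X d W \<otimes>[W] jac X c d W"
proof -
  let ?U = "cdom c \<inter> cdom d"
  have U: "op ?U" "?U \<subseteq> cdom c" "?U \<subseteq> cdom d" and WU: "W \<subseteq> ?U"
    using W c chart_dom by auto
  have "Dc X c ?U (zc X d ?U) = thetac X d ?U \<otimes>[?U] jac X c d ?U"
    using sc by (simp add: superconformal_change_def jac_def Let_def)
  then have "res X ?U W (Dc X c ?U (zc X d ?U)) = res X ?U W (thetac X d ?U \<otimes>[?U] jac X c d ?U)"
    by simp
  then show ?thesis
    unfolding Dc_res[OF c(1) U(1,2) W(1) WU part_carrier[OF U(1) zc_part[OF c(2) U(1,3)]]]
      zc_res[OF c(2) U(1,3) W(1) WU]
      res_mult[OF U(1) W(1) WU part_carrier[OF U(1) thetac_part[OF c(2) U(1,3)]]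
        part_carrier[OF U(1) jac_part[OF c U]]]
      thetac_res[OF c(2) U(1,3) W(1) WU] jac_res[OF c U W(1) WU] .
qed

text \<open>
  \<open>D\<^sub>c - J D\<^sub>d\<close> is a derivation that annihilates the constants and, by the superconformal condition,
  both coordinates of \<open>d\<close>. Writing a section as its value at a point plus a multiple of \<open>z\<^sub>d - w\<^sub>0\<close>
  shows that its image vanishes at that point.
\<close>

lemma chain_rule_change:
  assumes c: "is_chart X c" "is_chart X d" and sc: "superconformal_change X c d"
    and W: "op W" "W \<subseteq> cdom c" "W \<subseteq> cdom d" and s: "s \<in> carrier (sec X W)"
  shows "Dc X c W s = jac X c d W \<otimes>[W] Dc X d W s"
proof -
  interpret R: ring "sec X W" using W(1) by (rule sec_ring)
  let ?J = "jac X c d W" and ?\<theta> = "thetac X d W" and ?z = "zc X d W"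
  let ?n = "ngens X" and ?V = "im d W"
  note J = jac_part[OF c W] and th = thetac_part[OF c(2) W(1,3)] and z = zc_part[OF c(2) W(1,3)]
  have car [simp]: "?J \<in> carrier (sec X W)" "?\<theta> \<in> carrier (sec X W)" "?z \<in> carrier (sec X W)"
    using part_carrier[OF W(1)] J th z by auto
  have Dcar [simp]: "Dc X c W t \<in> carrier (sec X W)" "Dc X d W t \<in> carrier (sec X W)"
    if "t \<in> carrier (sec X W)" for t
    using that Dc_closed[OF c(1) W(1,2)] Dc_closed[OF c(2) W(1,3)] by auto
  let ?\<Delta> = "\<lambda>t. Dc X c W t \<ominus>[W] (?J \<otimes>[W] Dc X d W t)"
  have "ciso d W (?\<Delta> s) w S = 0" for w S
  proof (cases "w \<in> ?V")
    case False
    then show ?thesis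
      using iso_closed[OF c(2) W(1,3), of "?\<Delta> s"] s unfolding sfun_carrier_iff by auto
  next
    case True
    obtain a b h where abh: "a \<in> carrier (Lam X)" "b \<in> carrier (Lam X)"
      "h \<in> carrier (sfun_ring ?n ?V)"
      "ciso d W s = (\<lambda>u S. sfun_restrict ?V (\<lambda>w. a) u S
            + gmult (sfun_theta ?V u) (sfun_restrict ?V (\<lambda>w. b) u) S
            + gmult (\<lambda>T. sfun_z ?V u T + sfun_restrict ?V (\<lambda>u. gscalar (- w)) u T) (h u) S)"
      using sfun_factor[OF chart_open[OF c(2) W(1,3)] iso_closed[OF c(2) W(1,3) s] True] .
    have gs: "gscalar (- w) \<in> Lam_part X False" "gscalar (- w) \<in> carrier (Lam X)"
      using gscalar_Lam by (auto simp: grass_part_def)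
    define t where "t = from_chart X d W h"
    define y where "y = ?z \<oplus>[W] cst X W (gscalar (- w))"
    define A where "A = cst X W a"
    define B where "B = cst X W b"
    have t: "t \<in> carrier (sec X W)" "ciso d W t = h"
      using abh(3) from_closed[OF c(2) W(1,3)] iso_from[OF c(2) W(1,3)] by (auto simp: t_def)
    have yp: "y \<in> part X False W"
      unfolding y_def using z gs W(1) by (intro part_add cst_part)
    have AB: "A \<in> carrier (sec X W)" "B \<in> carrier (sec X W)"
      using abh cst_closed[OF W(1)] by (auto simp: A_def B_def)
    have y: "y \<in> carrier (sec X W)" using part_carrier[OF W(1) yp] .
    have cw: "cst X W (gscalar (- w)) \<in> carrier (sec X W)"
      using cst_closed[OF W(1) gs(2)] .
    have iy: "ciso d W y = (\<lambda>u T. sfun_z ?V u T + sfun_restrict ?V (\<lambda>u. gscalar (- w)) u T)"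
      unfolding y_def iso_add[OF c(2) W(1,3) car(3) cw] iso_zc[OF c(2) W(1,3)]
        iso_cst[OF c(2) W(1,3) gs(2)] ..
    have s_eq: "s = (A \<oplus>[W] (?\<theta> \<otimes>[W] B)) \<oplus>[W] (y \<otimes>[W] t)"
    proof (rule iso_inj[OF c(2) W(1,3) s])
      have "ciso d W A = sfun_restrict ?V (\<lambda>w. a)" "ciso d W B = sfun_restrict ?V (\<lambda>w. b)"
        unfolding A_def B_def using iso_cst[OF c(2) W(1,3)] abh by auto
      then show "ciso d W s = ciso d W ((A \<oplus>[W] (?\<theta> \<otimes>[W] B)) \<oplus>[W] (y \<otimes>[W] t))"
        using AB y t by (simp add: iso_add[OF c(2) W(1,3)] iso_mult[OF c(2) W(1,3)] abh(4)
          iso_thetac[OF c(2) W(1,3)] iy)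
    qed (use AB y t in auto)
    have DA: "Dc X c W A = \<zero>[W]" "Dc X d W A = \<zero>[W]"
      "Dc X c W B = \<zero>[W]" "Dc X d W B = \<zero>[W]"
      unfolding A_def B_def using abh Dc_cst[OF c(1) W(1,2)] Dc_cst[OF c(2) W(1,3)] by auto
    have Dy: "Dc X c W y = ?\<theta> \<otimes>[W] ?J" "Dc X d W y = ?\<theta>"
      unfolding y_def Dc_add[OF c(1) W(1,2) car(3) cw] Dc_add[OF c(2) W(1,3) car(3) cw]
        Dc_cst[OF c(1) W(1,2) gs(2)] Dc_cst[OF c(2) W(1,3) gs(2)]
        superconformal_change_on[OF c sc W] Dc_zc[OF c(2) W(1,3)] by simp_all
    have J\<theta>: "Dc X c W ?\<theta> = ?J" by (simp add: jac_def)
    have Dcs: "Dc X c W s = (?J \<otimes>[W] B) \<oplus>[W]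
        (?\<theta> \<otimes>[W] ?J \<otimes>[W] t \<oplus>[W] y \<otimes>[W] Dc X c W t)"
      unfolding s_eq using AB y t
      by (simp add: Dc_add[OF c(1) W(1,2)] Dc_mult_odd[OF c(1) W(1,2) th] Dc_mult_even[OF c(1) W(1,2) yp]
        DA Dy J\<theta> R.minus_eq)
    have Dds: "Dc X d W s = B \<oplus>[W]
        (?\<theta> \<otimes>[W] t \<oplus>[W] y \<otimes>[W] Dc X d W t)"
      unfolding s_eq using AB y t
      by (simp add: Dc_add[OF c(2) W(1,3)] Dc_mult_odd[OF c(2) W(1,3) th] Dc_mult_even[OF c(2) W(1,3) yp]
        DA Dy Dc_thetac[OF c(2) W(1,3)] R.minus_eq)
    have comm: "?J \<otimes>[W] (?\<theta> \<otimes>[W] t) = ?\<theta> \<otimes>[W] (?J \<otimes>[W] t)"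
      "?J \<otimes>[W] (y \<otimes>[W] Dc X d W t) = y \<otimes>[W] (?J \<otimes>[W] Dc X d W t)"
      using even_lcommute[OF W(1) J] y t by auto
    have "?\<Delta> s = y \<otimes>[W] ?\<Delta> t"
      unfolding Dcs Dds using AB y t
      by (simp add: R.r_distr comm R.minus_eq R.minus_add R.r_minus R.m_assoc R.a_ac R.r_neg1 R.r_neg2 R.r_neg)
    then have "ciso d W (?\<Delta> s) w S = gmult (ciso d W y w) (ciso d W (?\<Delta> t) w) S"
      using y t by (simp add: iso_mult[OF c(2) W(1,3)])
    moreover have "ciso d W y w = (\<lambda>S. 0)"
      using True unfolding iy by (auto simp: sfun_z_def sfun_restrict_def gscalar_def)
    ultimately show ?thesis by simp
  qed
  then have "?\<Delta> s = \<zero>[W]"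
    using s by (intro iso_inj[OF c(2) W(1,3)]) (auto simp: iso_zero[OF c(2) W(1,3)])
  moreover have "Dc X c W s = ?\<Delta> s \<oplus>[W] (?J \<otimes>[W] Dc X d W s)"
    using s by (simp add: R.minus_eq R.a_assoc R.l_neg)
  ultimately show ?thesis using s by simp
qed

lemma coords_chart: "c \<in> coords X \<Longrightarrow> is_chart X c"
  by (simp add: coords_def)

lemma atlas_coords: "atlas X \<subseteq> coords X" "\<Union>(cdom ` atlas X) = topspace (tsp X)"
  using curve unfolding superconformal_curve_def coords_def by blast+

lemma op_dom: "c \<in> coords X \<Longrightarrow> op (cdom c)"
  using coords_chart chart_dom by blast

text \<open>
  The chain rule applied to \<open>\<theta>\<^sub>c\<close> exhibits the inverse of the Jacobian.
\<close>

lemma jac_unit_change: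
  assumes c: "is_chart X c" "is_chart X d" and sc: "superconformal_change X c d"
    and W: "op W" "W \<subseteq> cdom c" "W \<subseteq> cdom d"
  shows "jac X c d W \<otimes>[W] jac X d c W = \<one>[W]"
    and "jac X d c W \<otimes>[W] jac X c d W = \<one>[W]"
proof -
  have "Dc X c W (thetac X c W) = jac X c d W \<otimes>[W] Dc X d W (thetac X c W)"
    using part_carrier[OF W(1) thetac_part[OF c(1) W(1,2)]] by (rule chain_rule_change[OF c sc W])
  then show "jac X c d W \<otimes>[W] jac X d c W = \<one>[W]"
    by (simp add: Dc_thetac[OF c(1) W(1,2)] jac_def)
  then show "jac X d c W \<otimes>[W] jac X c d W = \<one>[W]"
    using even_commute[OF W(1) jac_part[OF c W]] part_carrier[OF W(1) jac_part[OF c(2,1) W(1,3,2)]] by simp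
qed

text \<open>
  Compatibility with the atlas makes any two compatible charts compatible: \<open>D\<^sub>c\<close> is locally a unit
  multiple of \<open>D\<^sub>e\<close> for a chart \<open>e\<close> of the atlas, and the superconformal condition on \<open>d\<close> is
  insensitive to such a multiple.
\<close>

lemma coords_change:
  assumes c: "c \<in> coords X" and d: "d \<in> coords X"
  shows "superconformal_change X c d"
proof -
  let ?U = "cdom c \<inter> cdom d"
  note cc = coords_chart[OF c] and dd = coords_chart[OF d]
  have U: "op ?U" "?U \<subseteq> cdom c" "?U \<subseteq> cdom d" using chart_dom cc dd by auto
  have th: "thetac X d ?U \<in> carrier (sec X ?U)" and z: "zc X d ?U \<in> carrier (sec X ?U)"
    and J: "jac X c d ?U \<in> carrier (sec X ?U)"
    using part_carrier[OF U(1)] thetac_part[OF dd U(1,3)] zc_part[OF dd U(1,3)] jac_part[OF cc dd U] by auto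
  interpret U: ring "sec X ?U" using U(1) by (rule sec_ring)
  have "Dc X c ?U (zc X d ?U) = thetac X d ?U \<otimes>[?U] jac X c d ?U"
  proof (rule sections_eqI[OF U(1)])
    fix x assume x: "x \<in> ?U"
    then have "x \<in> \<Union>(cdom ` atlas X)" using openin_subset[OF U(1)] atlas_coords(2) by auto
    then obtain e where e: "e \<in> atlas X" "x \<in> cdom e" by auto
    have ee: "is_chart X e" using e(1) atlas_coords(1) coords_chart by blast
    have sc: "superconformal_change X e c" "superconformal_change X e d"
      using c d e(1) by (auto simp: coords_def)
    let ?V = "?U \<inter> cdom e"
    have V: "op ?V" "?V \<subseteq> cdom c" "?V \<subseteq> cdom d" "?V \<subseteq> cdom e" "?V \<subseteq> ?U" using U(1) chart_dom[OF ee] by auto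
    interpret V: ring "sec X ?V" using V(1) by (rule sec_ring)
    have thV: "thetac X d ?V \<in> carrier (sec X ?V)" and zV: "zc X d ?V \<in> carrier (sec X ?V)"
      and JV: "jac X e c ?V \<in> carrier (sec X ?V)" "jac X c e ?V \<in> carrier (sec X ?V)" "jac X c d ?V \<in> carrier (sec X ?V)"
      using part_carrier[OF V(1)] thetac_part[OF dd V(1,3)] zc_part[OF dd V(1,3)]
        jac_part[OF ee cc V(1,4,2)] jac_part[OF cc ee V(1,2,4)] jac_part[OF cc dd V(1-3)] by auto
    have Dz: "Dc X c ?V (zc X d ?V) \<in> carrier (sec X ?V)" using Dc_closed[OF cc V(1,2) zV] .
    have "jac X e c ?V \<otimes>[?V] Dc X c ?V (zc X d ?V) = Dc X e ?V (zc X d ?V)"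
      using chain_rule_change[OF ee cc sc(1) V(1,4,2) zV] by simp
    also have "\<dots> = thetac X d ?V \<otimes>[?V] (jac X e c ?V \<otimes>[?V] jac X c d ?V)"
      unfolding superconformal_change_on[OF ee dd sc(2) V(1,4,3)]
      unfolding jac_def chain_rule_change[OF ee cc sc(1) V(1,4,2) thV] ..
    also have "\<dots> = jac X e c ?V \<otimes>[?V] (thetac X d ?V \<otimes>[?V] jac X c d ?V)"
      using even_lcommute[OF V(1) jac_part[OF ee cc V(1,4,2)] thV JV(3)] .
    finally have "jac X c e ?V \<otimes>[?V] (jac X e c ?V \<otimes>[?V] Dc X c ?V (zc X d ?V)) =
      jac X c e ?V \<otimes>[?V] (jac X e c ?V \<otimes>[?V] (thetac X d ?V \<otimes>[?V] jac X c d ?V))"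
      by simp
    then have "Dc X c ?V (zc X d ?V) = thetac X d ?V \<otimes>[?V] jac X c d ?V"
      using JV thV Dz jac_unit_change(2)[OF ee cc sc(1) V(1,4,2)]
      by (simp add: V.m_assoc[symmetric])
    then have "res X ?U ?V (Dc X c ?U (zc X d ?U)) = res X ?U ?V (thetac X d ?U \<otimes>[?U] jac X c d ?U)"
      unfolding Dc_res[OF cc U(1,2) V(1,5) z] zc_res[OF dd U(1,3) V(1,5)] res_mult[OF U(1) V(1,5) th J]
        thetac_res[OF dd U(1,3) V(1,5)] jac_res[OF cc dd U V(1,5)] .
    then show "\<exists>V. op V \<and> x \<in> V \<and> V \<subseteq> ?U \<and> res X ?U V (Dc X c ?U (zc X d ?U)) =
        res X ?U V (thetac X d ?U \<otimes>[?U] jac X c d ?U)"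
      using V x e by blast
  qed (use th J Dc_closed[OF cc U(1,2) z] in auto)
  then show ?thesis
    unfolding superconformal_change_def Let_def jac_def .
qed

text \<open>
  The superconformal condition passes from \<open>c\<close> to the charts of the atlas because their operators \<open>D\<close>
  are multiples of \<open>D\<^sub>c\<close>.
\<close>

lemma coordsI:
  assumes c: "c \<in> coords X" and c': "is_chart X c'" "cdom c' \<subseteq> cdom c"
    and sc: "superconformal_change X c c'"
  shows "c' \<in> coords X"
proof -
  have "superconformal_change X d c'" if d: "d \<in> atlas X" for d
  proof -
    have dC: "d \<in> coords X" using d atlas_coords by auto
    note dd = coords_chart[OF dC] and cc = coords_chart[OF c]
    let ?U = "cdom d \<inter> cdom c'"
    have U: "op ?U" "?U \<subseteq> cdom d" "?U \<subseteq> cdom c'" "?U \<subseteq> cdom c" using chart_dom c' dd by auto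
    interpret U: ring "sec X ?U" using U(1) by (rule sec_ring)
    have th: "thetac X c' ?U \<in> carrier (sec X ?U)" and z: "zc X c' ?U \<in> carrier (sec X ?U)"
      using part_carrier[OF U(1)] thetac_part[OF c'(1) U(1,3)] zc_part[OF c'(1) U(1,3)] by auto
    have J: "jac X c c' ?U \<in> carrier (sec X ?U)" "jac X d c ?U \<in> carrier (sec X ?U)"
      using part_carrier[OF U(1)] jac_part[OF cc c'(1) U(1,4,3)] jac_part[OF dd cc U(1,2,4)] by auto
    note ch = chain_rule_change[OF dd cc coords_change[OF dC c] U(1,2,4)]
    have "Dc X d ?U (zc X c' ?U) =
        jac X d c ?U \<otimes>[?U] (thetac X c' ?U \<otimes>[?U] jac X c c' ?U)"
      using ch[OF z] superconformal_change_on[OF cc c'(1) sc U(1,4,3)] by simp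
    also have "\<dots> = thetac X c' ?U \<otimes>[?U] (jac X d c ?U \<otimes>[?U] jac X c c' ?U)"
      using even_lcommute[OF U(1) jac_part[OF dd cc U(1,2,4)] th J(1)] by simp
    also have "jac X d c ?U \<otimes>[?U] jac X c c' ?U = Dc X d ?U (thetac X c' ?U)"
      using ch[OF th] by (simp add: jac_def)
    finally show ?thesis
      unfolding superconformal_change_def Let_def .
  qed
  then show ?thesis using c' by (simp add: coords_def)
qed

text \<open>
  This is, up to a factor \<open>m\<close> or \<open>- m\<close>, the inhomogeneous term in the transition rules for \<open>\<phi>\<^sub>c\<close> and for the
  order zero term of an operator.
\<close>

definition dlog :: "('a, 's) chart \<Rightarrow> ('a, 's) chart \<Rightarrow> 'a set \<Rightarrow> 's" where
  "dlog c d W = Dc X c W (jac X c d W) \<otimes>[W] inv\<^bsub>sec X W\<^esub> jac X c d W"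

context
  fixes c d W
  assumes c: "c \<in> coords X" and d: "d \<in> coords X" and W: "op W" "W \<subseteq> cdom c" "W \<subseteq> cdom d"
begin

lemma chain_rule:
  "s \<in> carrier (sec X W) \<Longrightarrow> Dc X c W s = jac X c d W \<otimes>[W] Dc X d W s"
  using chain_rule_change[OF coords_chart[OF c] coords_chart[OF d] coords_change[OF c d] W] .

lemma J_even: "jac X c d W \<in> part X False W"
  using jac_part[OF coords_chart[OF c] coords_chart[OF d] W] .

lemma J_closed: "jac X c d W \<in> carrier (sec X W)"
  using part_carrier[OF W(1) J_even] .

lemma J_res: "op V \<Longrightarrow> V \<subseteq> W \<Longrightarrow> res X W V (jac X c d W) = jac X c d V"
  using jac_res[OF coords_chart[OF c] coords_chart[OF d] W] .

lemma J_J: "jac X c d W \<otimes>[W] jac X d c W = \<one>[W]"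
  using jac_unit_change[OF coords_chart[OF c] coords_chart[OF d] coords_change[OF c d] W] by simp

lemma J_cocycle:
  "e \<in> coords X \<Longrightarrow> W \<subseteq> cdom e \<Longrightarrow> jac X c e W = jac X c d W \<otimes>[W] jac X d e W"
  using chain_rule[OF part_carrier[OF W(1) thetac_part[OF coords_chart W(1)]]] by (simp add: jac_def)

end

lemma J_self: "c \<in> coords X \<Longrightarrow> op W \<Longrightarrow> W \<subseteq> cdom c \<Longrightarrow> jac X c c W = \<one>[W]"
  using Dc_thetac coords_chart by (simp add: jac_def)

context
  fixes c d W
  assumes c: "c \<in> coords X" and d: "d \<in> coords X" and W: "op W" "W \<subseteq> cdom c" "W \<subseteq> cdom d"
begin

interpretation R: ring "sec X W" using W(1) by (rule sec_ring)

lemma J_cancel: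
  "s \<in> carrier (sec X W) \<Longrightarrow> jac X c d W \<otimes>[W] (jac X d c W \<otimes>[W] s) = s"
  using J_J[OF c d W] J_closed[OF c d W] J_closed[OF d c W(1,3,2)] by (simp add: R.m_assoc[symmetric])

lemma J_inv: "inv\<^bsub>sec X W\<^esub> jac X c d W = jac X d c W"
  using R.inv_unique'[OF J_closed[OF c d W] J_closed[OF d c W(1,3,2)] J_J[OF c d W] J_J[OF d c W(1,3,2)]]
  by simp

lemma dlog_eq: "dlog c d W = Dc X c W (jac X c d W) \<otimes>[W] jac X d c W"
  by (simp add: dlog_def J_inv)

lemma dlog_odd: "dlog c d W \<in> part X True W"
  unfolding dlog_eq
  using part_mult[OF W(1) Dc_part[OF coords_chart[OF c] W(1,2) J_even[OF c d W]] J_even[OF d c W(1,3,2)]]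
  by simp

lemma dlog_closed: "dlog c d W \<in> carrier (sec X W)"
  using part_carrier[OF W(1) dlog_odd] .

lemma D_J: "Dc X c W (jac X c d W) = jac X c d W \<otimes>[W] dlog c d W"
proof -
  note DJ = Dc_closed[OF coords_chart[OF c] W(1,2) J_closed[OF c d W]]
  have "jac X c d W \<otimes>[W] dlog c d W =
      Dc X c W (jac X c d W) \<otimes>[W] (jac X c d W \<otimes>[W] jac X d c W)"
    unfolding dlog_eq using DJ J_closed[OF c d W] J_closed[OF d c W(1,3,2)]
    by (simp add: even_lcommute[OF W(1) J_even[OF c d W]])
  then show ?thesis using DJ by (simp add: J_J[OF c d W])
qed

end

lemma dlog_res:
  assumes c: "c \<in> coords X" and d: "d \<in> coords X" and W: "op W" "W \<subseteq> cdom c" "W \<subseteq> cdom d"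
    and V: "op V" "V \<subseteq> W"
  shows "res X W V (dlog c d W) = dlog c d V"
proof -
  have V': "V \<subseteq> cdom c" "V \<subseteq> cdom d" using V W by auto
  note J = J_closed[OF c d W] and J' = J_closed[OF d c W(1,3,2)]
  show ?thesis
    unfolding dlog_eq[OF c d W] dlog_eq[OF c d V(1) V']
      res_mult[OF W(1) V Dc_closed[OF coords_chart[OF c] W(1,2) J] J']
      Dc_res[OF coords_chart[OF c] W(1,2) V J] J_res[OF c d W V] J_res[OF d c W(1,3,2) V] ..
qed

text \<open>
  By the Leibniz rule and the chain rule, \<open>D\<^sub>c\<close> of \<open>J\<^sub>c\<^sub>e = J\<^sub>c\<^sub>d J\<^sub>d\<^sub>e\<close> is \<open>(D\<^sub>c J\<^sub>c\<^sub>d) J\<^sub>d\<^sub>e + J\<^sub>c\<^sub>d J\<^sub>c\<^sub>d (D\<^sub>d J\<^sub>d\<^sub>e)\<close>;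
  it remains to divide by \<open>J\<^sub>c\<^sub>d J\<^sub>d\<^sub>e\<close>.
\<close>

lemma dlog_cocycle:
  assumes c: "c \<in> coords X" and d: "d \<in> coords X" and e: "e \<in> coords X"
    and W: "op W" "W \<subseteq> cdom c" "W \<subseteq> cdom d" "W \<subseteq> cdom e"
  shows "dlog c e W = dlog c d W \<oplus>[W] (jac X c d W \<otimes>[W] dlog d e W)"
proof -
  interpret R: ring "sec X W" using W(1) by (rule sec_ring)
  note [simp] = J_closed[OF c d W(1,2,3)] J_closed[OF d c W(1,3,2)] J_closed[OF d e W(1,3,4)]
    J_closed[OF e d W(1,4,3)] J_closed[OF c e W(1,2,4)]
  let ?E = "Dc X d W (jac X d e W)" and ?F = "Dc X c W (jac X c d W)"
  have [simp]: "?E \<in> carrier (sec X W)" "?F \<in> carrier (sec X W)"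
    using Dc_closed[OF coords_chart[OF d] W(1,3)] Dc_closed[OF coords_chart[OF c] W(1,2)] by auto
  have D: "Dc X c W (jac X c e W) = ?F \<otimes>[W] jac X d e W \<oplus>[W]
      jac X c d W \<otimes>[W] (jac X c d W \<otimes>[W] ?E)"
    unfolding J_cocycle[OF c d W(1,2,3) e W(4)]
    by (simp add: Dc_mult_even[OF coords_chart[OF c] W(1,2) J_even[OF c d W(1,2,3)]]
      chain_rule[OF c d W(1,2,3), of "jac X d e W"])
  have comm: "?E \<otimes>[W] (jac X e d W \<otimes>[W] jac X d c W) =
      jac X d c W \<otimes>[W] (?E \<otimes>[W] jac X e d W)"
    using even_commute[OF W(1) J_even[OF d c W(1,3,2)], of "?E \<otimes>[W] jac X e d W"]
    by (simp add: R.m_assoc)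
  show ?thesis
    unfolding dlog_eq[OF c e W(1,2,4)] dlog_eq[OF c d W(1,2,3)] dlog_eq[OF d e W(1,3,4)] D
      J_cocycle[OF e d W(1,4,3) c W(2)]
    by (simp add: R.l_distr R.m_assoc J_cancel[OF d e W(1,3,4)] comm J_cancel[OF c d W(1,2,3)])
qed

lemma dlog_self: "c \<in> coords X \<Longrightarrow> op W \<Longrightarrow> W \<subseteq> cdom c \<Longrightarrow> dlog c c W = \<zero>[W]"
proof -
  assume c: "c \<in> coords X" and W: "op W" "W \<subseteq> cdom c"
  interpret R: ring "sec X W" using W(1) by (rule sec_ring)
  show ?thesis
    using dlog_eq[OF c c W W(2)] by (simp add: J_self[OF c W] Dc_one[OF coords_chart[OF c] W])
qed

lemma dlog_inverse:
  assumes c: "c \<in> coords X" and d: "d \<in> coords X" and W: "op W" "W \<subseteq> cdom c" "W \<subseteq> cdom d"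
  shows "jac X c d W \<otimes>[W] dlog d c W = \<ominus>[W] dlog c d W"
proof -
  interpret R: ring "sec X W" using W(1) by (rule sec_ring)
  note [simp] = J_closed[OF c d W] dlog_closed[OF c d W] dlog_closed[OF d c W(1,3,2)]
  have "dlog c d W \<oplus>[W] (jac X c d W \<otimes>[W] dlog d c W) = \<zero>[W]"
    using dlog_cocycle[OF c d c W W(2)] dlog_self[OF c W(1,2)] by simp
  then show ?thesis
    using R.minus_equality[of "jac X c d W \<otimes>[W] dlog d c W" "dlog c d W"] by (simp add: R.a_comm)
qed


section \<open>Connections\<close>

text \<open>
  The local data that operators, splittings and affine structures have in common: \<open>g\<^sub>c\<close> is the order
  zero term of an operator, \<open>- g\<^sub>c\<close> is the value of the functional \<open>\<sigma>(1)\<close> at \<open>\<phi>\<^sub>c\<close>, and the charts of the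
  affine structure are those with \<open>g\<^sub>c = 0\<close>.
\<close>

definition connections :: "complex \<Rightarrow> (('a, 's) chart \<Rightarrow> 's) set" where
  "connections m = {g \<in> (\<Pi>\<^sub>E c\<in>coords X. part X True (cdom c)).
     \<forall>c\<in>coords X. \<forall>d\<in>coords X. let W = cdom c \<inter> cdom d in
       res X (cdom c) W (g c) =
       (jac X c d W \<otimes>[W] res X (cdom d) W (g d)) \<oplus>[W] (cst X W (gscalar m) \<otimes>[W] dlog c d W)}"

lemma scal_even: "op W \<Longrightarrow> cst X W (gscalar k) \<in> part X False W"
  by (rule cst_part) (auto simp: gscalar_Lam)

lemma scal_closed: "op W \<Longrightarrow> cst X W (gscalar k) \<in> carrier (sec X W)"
  using part_carrier scal_even by blast

lemma scal_res: "op U \<Longrightarrow> op V \<Longrightarrow> V \<subseteq> U \<Longrightarrow> res X U V (cst X U (gscalar k)) = cst X V (gscalar k)"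
  by (rule res_cst) (use gscalar_Lam in \<open>auto simp: grass_part_def\<close>)

lemma coords_cover: "x \<in> topspace (tsp X) \<Longrightarrow> \<exists>c\<in>coords X. x \<in> cdom c"
  using atlas_coords by blast

lemma coords_cover_op: "op V \<Longrightarrow> V = (\<Union>c\<in>coords X. V \<inter> cdom c)"
  using coords_cover openin_subset by blast

lemma op_Int_dom: "op U \<Longrightarrow> c \<in> coords X \<Longrightarrow> op (U \<inter> cdom c)"
  using op_dom by blast

lemma D_closed: "c \<in> coords X \<Longrightarrow> op W \<Longrightarrow> W \<subseteq> cdom c \<Longrightarrow> s \<in> carrier (sec X W) \<Longrightarrow>
    Dc X c W s \<in> carrier (sec X W)"
  using Dc_closed coords_chart by blast

lemma conn_odd: "g \<in> connections m \<Longrightarrow> c \<in> coords X \<Longrightarrow> g c \<in> part X True (cdom c)"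
  by (auto simp: connections_def)

context
  fixes m g c assumes g: "g \<in> connections m" and c: "c \<in> coords X"
begin

lemma conn_closed: "g c \<in> carrier (sec X (cdom c))"
  using part_carrier[OF op_dom[OF c] conn_odd[OF g c]] .

context
  fixes W assumes W: "op W" "W \<subseteq> cdom c"
begin

lemma conn_res_odd: "res X (cdom c) W (g c) \<in> part X True W"
  using res_part[OF op_dom[OF c] W conn_odd[OF g c]] .

lemma conn_res_closed: "res X (cdom c) W (g c) \<in> carrier (sec X W)"
  using part_carrier[OF W(1) conn_res_odd] .

lemma conn_change:
  assumes d: "d \<in> coords X" "W \<subseteq> cdom d"
  shows "res X (cdom c) W (g c) =
    (jac X c d W \<otimes>[W] res X (cdom d) W (g d)) \<oplus>[W] (cst X W (gscalar m) \<otimes>[W] dlog c d W)"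
proof -
  let ?U = "cdom c \<inter> cdom d"
  have U: "op ?U" "?U \<subseteq> cdom c" "?U \<subseteq> cdom d" and WU: "W \<subseteq> ?U"
    using op_Int_dom[OF op_dom[OF c] d(1)] W d by auto
  interpret U: ring "sec X ?U" using U(1) by (rule sec_ring)
  have gd: "g d \<in> carrier (sec X (cdom d))" using part_carrier[OF op_dom[OF d(1)] conn_odd[OF g d(1)]] .
  have rd: "res X (cdom d) ?U (g d) \<in> carrier (sec X ?U)" using res_closed[OF op_dom[OF d(1)] U(1,3) gd] .
  have "res X (cdom c) ?U (g c) =
       (jac X c d ?U \<otimes>[?U] res X (cdom d) ?U (g d)) \<oplus>[?U] (cst X ?U (gscalar m) \<otimes>[?U] dlog c d ?U)"
    using g c d(1) by (auto simp: connections_def Let_def)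
  then have "res X ?U W (res X (cdom c) ?U (g c)) = res X ?U W
       ((jac X c d ?U \<otimes>[?U] res X (cdom d) ?U (g d)) \<oplus>[?U] (cst X ?U (gscalar m) \<otimes>[?U] dlog c d ?U))"
    by simp
  then show ?thesis
    using J_closed[OF c d(1) U] dlog_closed[OF c d(1) U] scal_closed[OF U(1)] rd
    by (simp add: res_add[OF U(1) W(1) WU] res_mult[OF U(1) W(1) WU] res_res[OF op_dom[OF c] U(1,2) W(1) WU conn_closed]
       res_res[OF op_dom[OF d(1)] U(1,3) W(1) WU gd] J_res[OF c d(1) U W(1) WU] dlog_res[OF c d(1) U W(1) WU]
       scal_res[OF U(1) W(1) WU])
qed

end

end

section \<open>Connections and differential operators\<close>

lemma local_op_closed:
  assumes c: "c \<in> coords X" and W: "op W" "W \<subseteq> cdom c"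
    and g: "g \<in> carrier (sec X W)" and f: "f \<in> carrier (sec X W)"
  shows "local_op X m c W g f \<in> carrier (sec X W)"
proof -
  interpret R: ring "sec X W" using W(1) by (rule sec_ring)
  show ?thesis
    using g f D_closed[OF c W f] scal_closed[OF W(1)] by (simp add: local_op_def)
qed

lemma local_op_res:
  assumes c: "c \<in> coords X" and W: "op W" "W \<subseteq> cdom c" and V: "op V" "V \<subseteq> W"
    and g: "g \<in> carrier (sec X W)" and f: "f \<in> carrier (sec X W)"
  shows "res X W V (local_op X m c W g f) = local_op X m c V (res X W V g) (res X W V f)"
proof -
  interpret R: ring "sec X W" using W(1) by (rule sec_ring)
  show ?thesis
    using g f D_closed[OF c W f] scal_closed[OF W(1)]
    by (simp add: local_op_def res_add[OF W(1) V] res_mult[OF W(1) V] res_uminus[OF W(1) V]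
       Dc_res[OF coords_chart[OF c] W V] scal_res[OF W(1) V])
qed

lemma local_op_one:
  assumes c: "c \<in> coords X" and W: "op W" "W \<subseteq> cdom c" and g: "g \<in> carrier (sec X W)"
  shows "local_op X m c W g \<one>[W] = g"
proof -
  interpret R: ring "sec X W" using W(1) by (rule sec_ring)
  show ?thesis
    using g scal_closed[OF W(1)] by (simp add: local_op_def Dc_one[OF coords_chart[OF c] W])
qed

text \<open>
  The inhomogeneous term \<open>m D\<^sub>c J / J\<close> in the change of \<open>g\<close> compensates the derivative of the Jacobian
  by which the coefficient of a section of \<open>Ber\<close> changes.
\<close>

lemma local_op_change:
  assumes c: "c \<in> coords X" and d: "d \<in> coords X" and W: "op W" "W \<subseteq> cdom c" "W \<subseteq> cdom d"
    and g: "g \<in> carrier (sec X W)" and f: "f \<in> carrier (sec X W)"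
  shows "local_op X m c W ((jac X c d W \<otimes>[W] g) \<oplus>[W] (cst X W (gscalar m) \<otimes>[W] dlog c d W))
           (f \<otimes>[W] jac X c d W) = local_op X m d W g f \<otimes>[W] (jac X c d W [^]\<^bsub>sec X W\<^esub> (2::nat))"
proof -
  interpret R: ring "sec X W" using W(1) by (rule sec_ring)
  let ?J = "jac X c d W" and ?k = "cst X W (gscalar m)" and ?l = "dlog c d W" and ?D = "Dc X d W f"
  note J = J_even[OF c d W]
  note [simp] = J_closed[OF c d W] scal_closed[OF W(1)] dlog_closed[OF c d W] D_closed[OF d W(1,3) f] g f
  have sq: "?J [^]\<^bsub>sec X W\<^esub> (2::nat) = ?J \<otimes>[W] ?J"
    by (simp add: numeral_2_eq_2)
  have JJ: "?J \<otimes>[W] ?J \<in> part X False W" using part_mult_even[OF W(1) J J] .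
  have fJ: "f \<otimes>[W] ?J = ?J \<otimes>[W] f" using even_commute[OF W(1) J f] by simp
  have D: "Dc X c W (?J \<otimes>[W] f) = (?J \<otimes>[W] (?l \<otimes>[W] f)) \<oplus>[W] (?J \<otimes>[W] (?J \<otimes>[W] ?D))"
    by (simp add: Dc_mult_even[OF coords_chart[OF c] W(1,2) J f] D_J[OF c d W] chain_rule[OF c d W f] R.m_assoc)
  have comm: "g \<otimes>[W] (?J \<otimes>[W] f) = ?J \<otimes>[W] (g \<otimes>[W] f)" "?l \<otimes>[W] (?J \<otimes>[W] f) = ?J \<otimes>[W] (?l \<otimes>[W] f)"
    "?k \<otimes>[W] (?J \<otimes>[W] (?l \<otimes>[W] f)) = ?J \<otimes>[W] (?k \<otimes>[W] (?l \<otimes>[W] f))"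
    "?k \<otimes>[W] (?J \<otimes>[W] (?J \<otimes>[W] ?D)) = ?J \<otimes>[W] (?J \<otimes>[W] (?k \<otimes>[W] ?D))"
    using even_lcommute[OF W(1) J, of g f] even_lcommute[OF W(1) J, of ?l f]
      even_lcommute[OF W(1) J, of ?k "?l \<otimes>[W] f"] even_lcommute[OF W(1) J, of ?k "?J \<otimes>[W] ?D"]
      even_lcommute[OF W(1) J, of ?k ?D] by simp_all
  have "local_op X m c W ((?J \<otimes>[W] g) \<oplus>[W] (?k \<otimes>[W] ?l)) (f \<otimes>[W] ?J) =
      (\<ominus>[W] (?J \<otimes>[W] (?J \<otimes>[W] (?k \<otimes>[W] ?D)))) \<oplus>[W] (?J \<otimes>[W] (?J \<otimes>[W] (g \<otimes>[W] f)))"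
    unfolding local_op_def fJ D
    by (simp add: R.r_distr R.l_distr R.m_assoc comm R.minus_add R.a_ac R.r_neg1 R.r_neg2 R.r_neg)
  also have "\<dots> = (?J \<otimes>[W] ?J) \<otimes>[W] local_op X m d W g f"
    unfolding local_op_def by (simp add: R.r_distr R.m_assoc R.r_minus)
  also have "\<dots> = local_op X m d W g f \<otimes>[W] (?J \<otimes>[W] ?J)"
    using even_commute[OF W(1) JJ local_op_closed[OF d W(1,3) g f]] .
  finally show ?thesis unfolding sq .
qed

lemma berD:
  assumes "s \<in> ber X k U" "c \<in> coords X"
  shows "s c \<in> carrier (sec X (U \<inter> cdom c))"
    and "d \<in> coords X \<Longrightarrow> res X (U \<inter> cdom c) (U \<inter> cdom c \<inter> cdom d) (s c) =
      res X (U \<inter> cdom d) (U \<inter> cdom c \<inter> cdom d) (s d) \<otimes>[U \<inter> cdom c \<inter> cdom d]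
        (jac X c d (U \<inter> cdom c \<inter> cdom d) [^]\<^bsub>sec X (U \<inter> cdom c \<inter> cdom d)\<^esub> k)"
  using assms by (auto simp: ber_def Let_def)

lemma berI:
  assumes "\<And>c. c \<in> coords X \<Longrightarrow> s c \<in> carrier (sec X (U \<inter> cdom c))" "s \<in> extensional (coords X)"
    and "\<And>c d. c \<in> coords X \<Longrightarrow> d \<in> coords X \<Longrightarrow> res X (U \<inter> cdom c) (U \<inter> cdom c \<inter> cdom d) (s c) =
      res X (U \<inter> cdom d) (U \<inter> cdom c \<inter> cdom d) (s d) \<otimes>[U \<inter> cdom c \<inter> cdom d]
        (jac X c d (U \<inter> cdom c \<inter> cdom d) [^]\<^bsub>sec X (U \<inter> cdom c \<inter> cdom d)\<^esub> k)"
  shows "s \<in> ber X k U"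
  using assms by (auto simp: ber_def Let_def PiE_iff)

lemma ber_res_ber:
  assumes U: "op U" and V: "op V" "V \<subseteq> U" and s: "s \<in> ber X k U"
  shows "ber_res X U V s \<in> ber X k V"
proof (rule berI)
  fix c assume c: "c \<in> coords X"
  show "ber_res X U V s c \<in> carrier (sec X (V \<inter> cdom c))"
    using c V U by (auto simp: ber_res_def op_Int_dom intro!: res_closed berD(1)[OF s])
next
  fix c d assume c: "c \<in> coords X" and d: "d \<in> coords X"
  let ?W = "U \<inter> cdom c \<inter> cdom d" and ?W' = "V \<inter> cdom c \<inter> cdom d"
  have W: "op ?W" "?W \<subseteq> U \<inter> cdom c" "?W \<subseteq> U \<inter> cdom d" "?W \<subseteq> cdom c" "?W \<subseteq> cdom d"
    and W': "op ?W'" "?W' \<subseteq> V \<inter> cdom c" "?W' \<subseteq> V \<inter> cdom d" "?W' \<subseteq> ?W"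
    and o: "op (U \<inter> cdom c)" "op (U \<inter> cdom d)" "op (V \<inter> cdom c)" "op (V \<inter> cdom d)"
      "V \<inter> cdom c \<subseteq> U \<inter> cdom c" "V \<inter> cdom d \<subseteq> U \<inter> cdom d"
    using U V c d by (auto simp: op_Int_dom)
  interpret R: ring "sec X ?W" using W(1) by (rule sec_ring)
  interpret R': ring "sec X ?W'" using W'(1) by (rule sec_ring)
  have pow: "res X ?W ?W' (jac X c d ?W [^]\<^bsub>sec X ?W\<^esub> k) = jac X c d ?W' [^]\<^bsub>sec X ?W'\<^esub> k"
  proof (induction k)
    case (Suc k)
    then show ?case
      using J_closed[OF c d W(1,4,5)] by (simp add: res_mult[OF W(1) W'(1,4)] J_res[OF c d W(1,4,5) W'(1,4)])
  qed (simp add: res_one[OF W(1) W'(1,4)])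
  have "res X ?W ?W' (res X (U \<inter> cdom c) ?W (s c)) = res X ?W ?W' (res X (U \<inter> cdom d) ?W (s d) \<otimes>[?W]
      (jac X c d ?W [^]\<^bsub>sec X ?W\<^esub> k))"
    using berD(2)[OF s c d] by simp
  then have "res X (U \<inter> cdom c) ?W' (s c) = res X (U \<inter> cdom d) ?W' (s d) \<otimes>[?W']
      (jac X c d ?W' [^]\<^bsub>sec X ?W'\<^esub> k)"
    using J_closed[OF c d W(1,4,5)] berD(1)[OF s d] res_closed[OF o(2) W(1,3)]
    by (simp add: res_mult[OF W(1) W'(1,4)] pow res_res[OF o(1) W(1,2) W'(1,4) berD(1)[OF s c]]
       res_res[OF o(2) W(1,3) W'(1,4) berD(1)[OF s d]])
  then show "res X (V \<inter> cdom c) ?W' (ber_res X U V s c) = res X (V \<inter> cdom d) ?W' (ber_res X U V s d) \<otimes>[?W']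
      (jac X c d ?W' [^]\<^bsub>sec X ?W'\<^esub> k)"
    using c d by (simp add: ber_res_def res_res[OF o(1,3,5) W'(1,2) berD(1)[OF s c]]
       res_res[OF o(2,4,6) W'(1,3) berD(1)[OF s d]])
qed (simp add: ber_res_def)

text \<open>The generator \<open>[dz\<^sub>c d\<theta>\<^sub>c]\<close> over an open subset of the domain of \<open>c\<close>.\<close>

definition ber_gen :: "('a, 's) chart \<Rightarrow> 'a set \<Rightarrow> ('a, 's) chart \<Rightarrow> 's" where
  "ber_gen c U = (\<lambda>d\<in>coords X. jac X d c (U \<inter> cdom d))"

lemma ber_gen:
  assumes c: "c \<in> coords X" and U: "op U" "U \<subseteq> cdom c"
  shows "ber_gen c U \<in> ber X 1 U" "ber_gen c U c = \<one>[U]"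
proof -
  show "ber_gen c U c = \<one>[U]"
    using c U J_self[OF c U] by (simp add: ber_gen_def Int_absorb2)
  show "ber_gen c U \<in> ber X 1 U"
  proof (rule berI)
    fix d assume d: "d \<in> coords X"
    then show "ber_gen c U d \<in> carrier (sec X (U \<inter> cdom d))"
      using J_closed[OF d c op_Int_dom[OF U(1) d]] U by (auto simp: ber_gen_def)
  next
    fix d e assume d: "d \<in> coords X" and e: "e \<in> coords X"
    let ?W = "U \<inter> cdom d \<inter> cdom e"
    have W: "op ?W" "?W \<subseteq> U \<inter> cdom d" "?W \<subseteq> U \<inter> cdom e" "?W \<subseteq> cdom d" "?W \<subseteq> cdom e" "?W \<subseteq> cdom c"
      and o: "op (U \<inter> cdom d)" "op (U \<inter> cdom e)" "U \<inter> cdom d \<subseteq> cdom d" "U \<inter> cdom e \<subseteq> cdom e"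
      "U \<inter> cdom d \<subseteq> cdom c" "U \<inter> cdom e \<subseteq> cdom c"
      using U c d e by (auto simp: op_Int_dom)
    interpret R: ring "sec X ?W" using W(1) by (rule sec_ring)
    show "res X (U \<inter> cdom d) ?W (ber_gen c U d) = res X (U \<inter> cdom e) ?W (ber_gen c U e) \<otimes>[?W]
        (jac X d e ?W [^]\<^bsub>sec X ?W\<^esub> (1::nat))"
      using d e J_closed[OF d e W(1,4,5)] J_closed[OF e c W(1,5,6)]
      by (simp add: ber_gen_def J_res[OF d c o(1,3,5) W(1,2)] J_res[OF e c o(2,4,6) W(1,3)]
        J_cocycle[OF d e W(1,4,5) c W(6)] even_commute[OF W(1) J_even[OF d e W(1,4,5)]])
  qed (simp add: ber_gen_def)
qed

definition conn_op ::
  "complex \<Rightarrow> (('a, 's) chart \<Rightarrow> 's) \<Rightarrow> 'a set \<Rightarrow> (('a, 's) chart \<Rightarrow> 's) \<Rightarrow> ('a, 's) chart \<Rightarrow> 's" where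
  "conn_op m g = (\<lambda>U\<in>opens X. \<lambda>s\<in>ber X 1 U. \<lambda>c\<in>coords X.
     local_op X m c (U \<inter> cdom c) (res X (cdom c) (U \<inter> cdom c) (g c)) (s c))"

lemma conn_op_ber:
  assumes g: "g \<in> connections m" and U: "op U" and s: "s \<in> ber X 1 U"
  shows "conn_op m g U s \<in> ber X 2 U"
proof (rule berI)
  fix c assume c: "c \<in> coords X"
  then show "conn_op m g U s c \<in> carrier (sec X (U \<inter> cdom c))"
    using U s local_op_closed[OF c op_Int_dom[OF U c] _ conn_res_closed[OF g c op_Int_dom[OF U c]] berD(1)[OF s c]]
    by (auto simp: conn_op_def)
next
  fix c d assume c: "c \<in> coords X" and d: "d \<in> coords X"
  let ?W = "U \<inter> cdom c \<inter> cdom d"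
  have W: "op ?W" "?W \<subseteq> U \<inter> cdom c" "?W \<subseteq> U \<inter> cdom d" "?W \<subseteq> cdom c" "?W \<subseteq> cdom d"
    and o: "op (U \<inter> cdom c)" "op (U \<inter> cdom d)" "U \<inter> cdom c \<subseteq> cdom c" "U \<inter> cdom d \<subseteq> cdom d"
    using U c d by (auto simp: op_Int_dom)
  interpret R: ring "sec X ?W" using W(1) by (rule sec_ring)
  have rs: "res X (U \<inter> cdom d) ?W (s d) \<in> carrier (sec X ?W)"
    using res_closed[OF o(2) W(1,3) berD(1)[OF s d]] .
  have sc: "res X (U \<inter> cdom c) ?W (s c) = res X (U \<inter> cdom d) ?W (s d) \<otimes>[?W] jac X c d ?W"
    using berD(2)[OF s c d] J_closed[OF c d W(1,4,5)] by simp
  show "res X (U \<inter> cdom c) ?W (conn_op m g U s c) = res X (U \<inter> cdom d) ?W (conn_op m g U s d) \<otimes>[?W]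
        (jac X c d ?W [^]\<^bsub>sec X ?W\<^esub> (2::nat))"
    using U s c d
    by (simp add: conn_op_def local_op_res[OF c o(1,3) W(1,2) conn_res_closed[OF g c o(1,3)] berD(1)[OF s c]]
      local_op_res[OF d o(2,4) W(1,3) conn_res_closed[OF g d o(2,4)] berD(1)[OF s d]]
      res_res[OF op_dom[OF c] o(1,3) W(1,2) conn_closed[OF g c]]
      res_res[OF op_dom[OF d] o(2,4) W(1,3) conn_closed[OF g d]]
      conn_change[OF g c W(1,4) d W(5)] sc local_op_change[OF c d W(1,4,5) conn_res_closed[OF g d W(1,5)] rs])
qed (use U s in \<open>simp add: conn_op_def\<close>)

lemma conn_op_local_form:
  "c \<in> coords X \<Longrightarrow> has_local_form X m (conn_op m g) c (g c)"
  by (simp add: has_local_form_def conn_op_def)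

lemma conn_op_ber_ops:
  assumes g: "g \<in> connections m" shows "conn_op m g \<in> ber_ops X m"
proof -
  have "conn_op m g V (ber_res X U V s) = ber_res X U V (conn_op m g U s)"
    if U: "op U" and V: "op V" "V \<subseteq> U" and s: "s \<in> ber X 1 U" for U V s
  proof
    fix c
    show "conn_op m g V (ber_res X U V s) c = ber_res X U V (conn_op m g U s) c"
    proof (cases "c \<in> coords X")
      case c: True
      have o: "op (U \<inter> cdom c)" "U \<inter> cdom c \<subseteq> cdom c" "op (V \<inter> cdom c)" "V \<inter> cdom c \<subseteq> U \<inter> cdom c"
        using U V c by (auto simp: op_Int_dom)
      show ?thesis
        using c U V s ber_res_ber[OF U V s]
        by (simp add: conn_op_def ber_res_def local_op_res[OF c o conn_res_closed[OF g c o(1,2)] berD(1)[OF s c]]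
          res_res[OF op_dom[OF c] o conn_closed[OF g c]])
    qed (use U V s ber_res_ber[OF U V s] in \<open>simp add: conn_op_def ber_res_def\<close>)
  qed
  moreover have "conn_op m g \<in> (\<Pi>\<^sub>E U\<in>opens X. ber X 1 U \<rightarrow>\<^sub>E ber X 2 U)"
    using conn_op_ber[OF g] by (auto simp: conn_op_def PiE_iff extensional_def)
  moreover have "\<exists>h\<in>part X True (cdom c). has_local_form X m (conn_op m g) c h" if "c \<in> coords X" for c
    using conn_op_local_form[OF that] conn_odd[OF g that] by blast
  ultimately show ?thesis by (auto simp: ber_ops_def)
qed

text \<open>
  In the coordinates \<open>c\<close> the generator has the coefficient \<open>1\<close>, which \<open>D\<^sub>c\<close> kills, so that only the order
  zero term of the operator is seen.
\<close>

lemma has_local_form_gen: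
  assumes c: "c \<in> coords X" and h: "h \<in> carrier (sec X (cdom c))" "has_local_form X m \<D> c h"
    and U: "op U" "U \<subseteq> cdom c"
  shows "\<D> U (ber_gen c U) c = res X (cdom c) U h"
proof -
  have "U \<inter> cdom c = U" using U by auto
  then have "\<D> U (ber_gen c U) c = local_op X m c U (res X (cdom c) U h) \<one>[U]"
    using h(2) U ber_gen[OF c U] by (simp add: has_local_form_def)
  then show ?thesis using local_op_one[OF c U res_closed[OF op_dom[OF c] U h(1)]] by simp
qed

lemma has_local_form_unique:
  assumes c: "c \<in> coords X" and h: "h \<in> carrier (sec X (cdom c))" "has_local_form X m \<D> c h"
    and h': "h' \<in> carrier (sec X (cdom c))" "has_local_form X m \<D> c h'"
  shows "h = h'"
  using has_local_form_gen[OF c h op_dom[OF c] order_refl] has_local_form_gen[OF c h' op_dom[OF c] order_refl]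
    res_id[OF op_dom[OF c]] h h' by simp

text \<open>
  The law results from comparing, on an overlap, the two local expressions for the image of the
  generator \<open>[dz\<^sub>c d\<theta>\<^sub>c]\<close>, whose coefficient in the coordinates \<open>d\<close> is the Jacobian from \<open>d\<close> to \<open>c\<close>.
\<close>

lemma local_forms_connection:
  assumes \<D>: "\<D> \<in> ber_ops X m" and g: "g \<in> (\<Pi>\<^sub>E c\<in>coords X. part X True (cdom c))"
    and form: "\<And>c. c \<in> coords X \<Longrightarrow> has_local_form X m \<D> c (g c)"
  shows "g \<in> connections m"
proof -
  have "res X (cdom c) W (g c) =
       (jac X c d W \<otimes>[W] res X (cdom d) W (g d)) \<oplus>[W] (cst X W (gscalar m) \<otimes>[W] dlog c d W)"
    if c: "c \<in> coords X" and d: "d \<in> coords X" and W_def: "W = cdom c \<inter> cdom d" for c d W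
  proof -
    have W: "op W" "W \<subseteq> cdom c" "W \<subseteq> cdom d"
      using W_def op_Int_dom[OF op_dom[OF c] d] by auto
    have Wc: "W \<inter> cdom c = W" "W \<inter> cdom d = W" "W \<inter> cdom c \<inter> cdom d = W" using W by auto
    interpret R: ring "sec X W" using W(1) by (rule sec_ring)
    have gc: "g c \<in> carrier (sec X (cdom c))" "g d \<in> carrier (sec X (cdom d))"
      using g c d part_carrier[OF op_dom] by (auto simp: PiE_iff)
    let ?J = "jac X c d W" and ?J' = "jac X d c W" and ?k = "cst X W (gscalar m)" and ?l = "dlog c d W"
      and ?l' = "dlog d c W"
    let ?h = "res X (cdom d) W (g d)"
    note [simp] = J_closed[OF c d W] J_closed[OF d c W(1,3,2)] dlog_closed[OF c d W] dlog_closed[OF d c W(1,3,2)]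
      scal_closed[OF W(1)] res_closed[OF op_dom[OF d] W(1,3) gc(2)]
    have gen: "ber_gen c W \<in> ber X 1 W" using ber_gen[OF c W(1,2)] by simp
    then have "\<D> W (ber_gen c W) \<in> ber X 2 W"
      using \<D> W by (auto simp: ber_ops_def PiE_iff)
    note ch = berD(2)[OF this c d, unfolded Wc] and cl = berD(1)[OF this c, unfolded Wc] berD(1)[OF this d, unfolded Wc]
    have "\<D> W (ber_gen c W) d = local_op X m d W ?h ?J'"
      using form[OF d] gen W(1) d Wc by (simp add: has_local_form_def ber_gen_def)
    also have "\<dots> = ?J' \<otimes>[W] (?h \<oplus>[W] (\<ominus>[W] (?k \<otimes>[W] ?l')))"
      by (simp add: local_op_def D_J[OF d c W(1,3,2)] even_lcommute[OF W(1) J_even[OF d c W(1,3,2)], of ?k ?l']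
        even_commute[OF W(1) J_even[OF d c W(1,3,2)], of ?h, symmetric] R.r_distr R.r_minus R.a_comm)
    finally have "res X (cdom c) W (g c) = (?J' \<otimes>[W] (?h \<oplus>[W] (\<ominus>[W] (?k \<otimes>[W] ?l')))) \<otimes>[W] (?J \<otimes>[W] ?J)"
      using ch cl W(1) has_local_form_gen[OF c gc(1) form[OF c] W(1,2)]
      by (simp add: res_id numeral_2_eq_2)
    also have "\<dots> = ?J \<otimes>[W] (?h \<oplus>[W] (\<ominus>[W] (?k \<otimes>[W] ?l')))"
      by (simp add: R.m_assoc J_cancel[OF c d W]
        even_commute[OF W(1) part_mult_even[OF W(1) J_even[OF c d W] J_even[OF c d W]], symmetric])
    also have "\<dots> = (?J \<otimes>[W] ?h) \<oplus>[W] (?k \<otimes>[W] ?l)"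
      by (simp add: R.r_distr R.r_minus even_lcommute[OF W(1) scal_even[OF W(1)], of ?J ?l'] dlog_inverse[OF c d W])
    finally show ?thesis .
  qed
  then show ?thesis using g by (auto simp: connections_def Let_def)
qed

lemma bij_conn_op: "bij_betw (conn_op m) (connections m) (ber_ops X m)"
proof (rule bij_betw_imageI)
  show "inj_on (conn_op m) (connections m)"
  proof (rule inj_onI)
    fix g g' assume g: "g \<in> connections m" "g' \<in> connections m" and eq: "conn_op m g = conn_op m g'"
    have "g c = g' c" if c: "c \<in> coords X" for c
      using conn_op_local_form[OF c, of m g] conn_op_local_form[OF c, of m g'] conn_closed[OF g(1) c]
        conn_closed[OF g(2) c] has_local_form_unique[OF c, of "g c" m "conn_op m g" "g' c"] eq by simp
    then show "g = g'" using g by (intro PiE_ext[of g "coords X" _ g']) (auto simp: connections_def)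
  qed
  show "conn_op m ` connections m = ber_ops X m"
  proof
    show "conn_op m ` connections m \<subseteq> ber_ops X m" using conn_op_ber_ops by auto
    show "ber_ops X m \<subseteq> conn_op m ` connections m"
    proof
      fix \<D> assume \<D>: "\<D> \<in> ber_ops X m"
      then have "\<forall>c\<in>coords X. \<exists>g. g \<in> part X True (cdom c) \<and> has_local_form X m \<D> c g"
        by (auto simp: ber_ops_def)
      then obtain g0 where g0: "\<And>c. c \<in> coords X \<Longrightarrow> g0 c \<in> part X True (cdom c) \<and> has_local_form X m \<D> c (g0 c)"
        by metis
      define g where "g = restrict g0 (coords X)"
      have g: "g \<in> connections m"
        using g0 by (intro local_forms_connection[OF \<D>]) (auto simp: g_def)
      have form: "has_local_form X m \<D> c (g c)" if "c \<in> coords X" for c using g0 that by (simp add: g_def)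
      have "\<D> U s c = conn_op m g U s c" if "op U" "s \<in> ber X 1 U" for U s c
      proof (cases "c \<in> coords X")
        case True
        then show ?thesis using form[OF True] that by (simp add: has_local_form_def conn_op_def)
      next
        case False
        have "\<D> U s \<in> ber X 2 U" using \<D> that by (auto simp: ber_ops_def PiE_iff)
        then show ?thesis
          using False that conn_op_ber[OF g that] by (auto simp: ber_def PiE_iff extensional_def)
      qed
      then have "\<D> U = conn_op m g U" if "op U" for U
        using \<D> conn_op_ber_ops[OF g] that
        by (intro PiE_ext[of "\<D> U" "ber X 1 U" "\<lambda>_. ber X 2 U" "conn_op m g U"]) (auto simp: ber_ops_def PiE_iff)
      then have "\<D> = conn_op m g"
        using \<D> conn_op_ber_ops[OF g]
        by (intro PiE_ext[of \<D> "opens X" "\<lambda>U. ber X 1 U \<rightarrow>\<^sub>E ber X 2 U" "conn_op m g"]) (auto simp: ber_ops_def)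
      then show "\<D> \<in> conn_op m ` connections m" using g by blast
    qed
  qed
qed


section \<open>Connections and splittings\<close>

lemma sections_eq_coords:
  assumes V: "op V" and s: "s \<in> carrier (sec X V)" "t \<in> carrier (sec X V)"
    and eq: "\<And>c. c \<in> coords X \<Longrightarrow> res X V (V \<inter> cdom c) s = res X V (V \<inter> cdom c) t"
  shows "s = t"
proof (rule sections_eqI[OF V s])
  fix x assume "x \<in> V"
  then obtain c where "c \<in> coords X" "x \<in> cdom c" using coords_cover_op[OF V] by blast
  then show "\<exists>W. op W \<and> x \<in> W \<and> W \<subseteq> V \<and> res X V W s = res X V W t"
    using \<open>x \<in> V\<close> eq op_Int_dom[OF V] by (intro exI[of _ "V \<inter> cdom c"]) auto
qed

lemma part_coords:
  assumes V: "op V" and s: "s \<in> carrier (sec X V)"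
    and p: "\<And>c. c \<in> coords X \<Longrightarrow> res X V (V \<inter> cdom c) s \<in> part X p (V \<inter> cdom c)"
  shows "s \<in> part X p V"
proof (rule part_local[OF V s])
  fix x assume "x \<in> V"
  then obtain c where "c \<in> coords X" "x \<in> cdom c" using coords_cover_op[OF V] by blast
  then show "\<exists>W. op W \<and> x \<in> W \<and> W \<subseteq> V \<and> res X V W s \<in> part X p W"
    using \<open>x \<in> V\<close> p op_Int_dom[OF V] by (intro exI[of _ "V \<inter> cdom c"]) auto
qed

lemma bunD:
  assumes b: "b \<in> bun X m V" and c: "c \<in> coords X"
  shows "fst (b c) \<in> carrier (sec X (V \<inter> cdom c))" "snd (b c) \<in> carrier (sec X (V \<inter> cdom c))"
    and "d \<in> coords X \<Longrightarrow> W = V \<inter> cdom c \<inter> cdom d \<Longrightarrow>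
      res X (V \<inter> cdom d) W (snd (b d)) = jac X c d W \<otimes>[W] res X (V \<inter> cdom c) W (snd (b c))"
    and "d \<in> coords X \<Longrightarrow> W = V \<inter> cdom c \<inter> cdom d \<Longrightarrow>
      res X (V \<inter> cdom d) W (fst (b d)) = res X (V \<inter> cdom c) W (fst (b c)) \<ominus>[W]
        (cst X W (gscalar m) \<otimes>[W] dlog c d W \<otimes>[W] res X (V \<inter> cdom c) W (snd (b c)))"
proof -
  have "b c \<in> carrier (sec X (V \<inter> cdom c)) \<times> carrier (sec X (V \<inter> cdom c))"
    using b c by (auto simp: bun_def PiE_iff)
  then show "fst (b c) \<in> carrier (sec X (V \<inter> cdom c))" "snd (b c) \<in> carrier (sec X (V \<inter> cdom c))"
    by auto
  assume "d \<in> coords X" "W = V \<inter> cdom c \<inter> cdom d"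
  then show "res X (V \<inter> cdom d) W (snd (b d)) = jac X c d W \<otimes>[W] res X (V \<inter> cdom c) W (snd (b c))"
    "res X (V \<inter> cdom d) W (fst (b d)) = res X (V \<inter> cdom c) W (fst (b c)) \<ominus>[W]
        (cst X W (gscalar m) \<otimes>[W] dlog c d W \<otimes>[W] res X (V \<inter> cdom c) W (snd (b c)))"
    using b c unfolding bun_def Let_def dlog_def by blast+
qed

lemma bunI:
  assumes "\<And>c. c \<in> coords X \<Longrightarrow> fst (b c) \<in> carrier (sec X (V \<inter> cdom c))"
    "\<And>c. c \<in> coords X \<Longrightarrow> snd (b c) \<in> carrier (sec X (V \<inter> cdom c))"
    "b \<in> extensional (coords X)"
    and "\<And>c d W. c \<in> coords X \<Longrightarrow> d \<in> coords X \<Longrightarrow> W = V \<inter> cdom c \<inter> cdom d \<Longrightarrow>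
      res X (V \<inter> cdom d) W (snd (b d)) = jac X c d W \<otimes>[W] res X (V \<inter> cdom c) W (snd (b c))"
    and "\<And>c d W. c \<in> coords X \<Longrightarrow> d \<in> coords X \<Longrightarrow> W = V \<inter> cdom c \<inter> cdom d \<Longrightarrow>
      res X (V \<inter> cdom d) W (fst (b d)) = res X (V \<inter> cdom c) W (fst (b c)) \<ominus>[W]
        (cst X W (gscalar m) \<otimes>[W] dlog c d W \<otimes>[W] res X (V \<inter> cdom c) W (snd (b c)))"
  shows "b \<in> bun X m V"
proof -
  have "b c \<in> carrier (sec X (V \<inter> cdom c)) \<times> carrier (sec X (V \<inter> cdom c))" if "c \<in> coords X" for c
    using assms(1,2)[OF that] by (simp add: mem_Times_iff)
  then have "b \<in> (\<Pi>\<^sub>E c\<in>coords X. carrier (sec X (V \<inter> cdom c)) \<times> carrier (sec X (V \<inter> cdom c)))"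
    using assms(3) by (simp add: PiE_iff)
  then show ?thesis
    unfolding bun_def Let_def dlog_def[symmetric]
    by (intro CollectI conjI ballI assms(4) assms(5) refl)
qed

lemma doms:
  assumes "op V" "c \<in> coords X"
  shows "op (V \<inter> cdom c)" "V \<inter> cdom c \<subseteq> cdom c" "V \<inter> cdom c \<subseteq> V"
  using assms by (auto simp: op_Int_dom)

lemma doms2:
  assumes "op V" "c \<in> coords X" "d \<in> coords X" "W = V \<inter> cdom c \<inter> cdom d"
  shows "op W" "W \<subseteq> V \<inter> cdom c" "W \<subseteq> V \<inter> cdom d" "W \<subseteq> cdom c" "W \<subseteq> cdom d" "W \<subseteq> V"
  using assms by (auto simp: op_Int_dom)

lemma bun_res_bun:
  assumes U: "op U" and V: "op V" "V \<subseteq> U" and b: "b \<in> bun X m U"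
  shows "bun_res X U V b \<in> bun X m V"
proof -
  have dom: "V \<inter> cdom c \<subseteq> U \<inter> cdom c" for c using V by auto
  have app: "bun_res X U V b c = (res X (U \<inter> cdom c) (V \<inter> cdom c) (fst (b c)), res X (U \<inter> cdom c) (V \<inter> cdom c) (snd (b c)))"
    if "c \<in> coords X" for c using that by (cases "b c") (simp add: bun_res_def)
  show ?thesis
  proof (rule bunI)
    fix c d W assume c: "c \<in> coords X" and d: "d \<in> coords X" and W_def: "W = V \<inter> cdom c \<inter> cdom d"
    define W' where "W' = U \<inter> cdom c \<inter> cdom d"
    note W = doms2[OF V(1) c d W_def] and W' = doms2[OF U c d W'_def]
    have WW: "W \<subseteq> W'" using V by (auto simp: W_def W'_def)
    interpret R: ring "sec X W" using W(1) by (rule sec_ring)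
    interpret R': ring "sec X W'" using W'(1) by (rule sec_ring)
    note cl = bunD(1,2)[OF b c] bunD(1,2)[OF b d]
    note oc = doms[OF U c] and od = doms[OF U d] and vc = doms[OF V(1) c] and vd = doms[OF V(1) d]
    note [simp] = res_closed[OF oc(1) W'(1,2) cl(1)] res_closed[OF oc(1) W'(1,2) cl(2)]
      J_closed[OF c d W'(1,4,5)] dlog_closed[OF c d W'(1,4,5)] scal_closed[OF W'(1)]
    note rr = res_res[OF oc(1) W'(1,2) W(1) WW] res_res[OF od(1) W'(1,3) W(1) WW]
      res_res[OF oc(1) vc(1) dom W(1,2)] res_res[OF od(1) vd(1) dom W(1,3)]
    have "res X W' W (res X (U \<inter> cdom d) W' (snd (b d))) =
        res X W' W (jac X c d W' \<otimes>[W'] res X (U \<inter> cdom c) W' (snd (b c)))"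
      using bunD(3)[OF b c d W'_def] by simp
    then show "res X (V \<inter> cdom d) W (snd (bun_res X U V b d)) =
        jac X c d W \<otimes>[W] res X (V \<inter> cdom c) W (snd (bun_res X U V b c))"
      using c d cl by (simp add: app res_mult[OF W'(1) W(1) WW] J_res[OF c d W'(1,4,5) W(1) WW] rr)
    have "res X W' W (res X (U \<inter> cdom d) W' (fst (b d))) =
        res X W' W (res X (U \<inter> cdom c) W' (fst (b c)) \<ominus>[W']
        (cst X W' (gscalar m) \<otimes>[W'] dlog c d W' \<otimes>[W'] res X (U \<inter> cdom c) W' (snd (b c))))"
      using bunD(4)[OF b c d W'_def] by simp
    then show "res X (V \<inter> cdom d) W (fst (bun_res X U V b d)) = res X (V \<inter> cdom c) W (fst (bun_res X U V b c)) \<ominus>[W]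
        (cst X W (gscalar m) \<otimes>[W] dlog c d W \<otimes>[W] res X (V \<inter> cdom c) W (snd (bun_res X U V b c)))"
      using c d cl by (simp add: app res_minus[OF W'(1) W(1) WW] res_mult[OF W'(1) W(1) WW]
          dlog_res[OF c d W'(1,4,5) W(1) WW] scal_res[OF W'(1) W(1) WW] rr)
  next
    fix c assume c: "c \<in> coords X"
    show "fst (bun_res X U V b c) \<in> carrier (sec X (V \<inter> cdom c))"
      "snd (bun_res X U V b c) \<in> carrier (sec X (V \<inter> cdom c))"
      using c bunD(1,2)[OF b c] res_closed[OF doms(1)[OF U c] doms(1)[OF V(1) c] dom] by (simp_all add: app)
  qed (simp add: bun_res_def)
qed

lemma bun_add_bun:
  assumes V: "op V" and b: "b \<in> bun X m V" "b' \<in> bun X m V"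
  shows "bun_add X V b b' \<in> bun X m V"
proof (rule bunI)
  fix c d W assume c: "c \<in> coords X" and d: "d \<in> coords X" and W_def: "W = V \<inter> cdom c \<inter> cdom d"
  note W = doms2[OF V c d W_def]
  interpret R: ring "sec X W" using W(1) by (rule sec_ring)
  note oc = doms[OF V c] and od = doms[OF V d]
  note cl = bunD(1,2)[OF b(1) c] bunD(1,2)[OF b(1) d] bunD(1,2)[OF b(2) c] bunD(1,2)[OF b(2) d]
  note [simp] = cl J_closed[OF c d W(1,4,5)] dlog_closed[OF c d W(1,4,5)] scal_closed[OF W(1)]
    res_closed[OF oc(1) W(1,2)] res_closed[OF od(1) W(1,3)]
  show "res X (V \<inter> cdom d) W (snd (bun_add X V b b' d)) = jac X c d W \<otimes>[W] res X (V \<inter> cdom c) W (snd (bun_add X V b b' c))"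
    using c d by (simp add: bun_add_def res_add[OF oc(1) W(1,2)] res_add[OF od(1) W(1,3)]
      bunD(3)[OF b(1) c d W_def] bunD(3)[OF b(2) c d W_def] R.r_distr)
  show "res X (V \<inter> cdom d) W (fst (bun_add X V b b' d)) = res X (V \<inter> cdom c) W (fst (bun_add X V b b' c)) \<ominus>[W]
        (cst X W (gscalar m) \<otimes>[W] dlog c d W \<otimes>[W] res X (V \<inter> cdom c) W (snd (bun_add X V b b' c)))"
    using c d by (simp add: bun_add_def res_add[OF oc(1) W(1,2)] res_add[OF od(1) W(1,3)]
      bunD(4)[OF b(1) c d W_def] bunD(4)[OF b(2) c d W_def] R.r_distr R.minus_eq R.minus_add R.a_ac)
next
  fix c assume c: "c \<in> coords X"
  interpret R: ring "sec X (V \<inter> cdom c)" using doms(1)[OF V c] by (rule sec_ring)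
  show "fst (bun_add X V b b' c) \<in> carrier (sec X (V \<inter> cdom c))"
      "snd (bun_add X V b b' c) \<in> carrier (sec X (V \<inter> cdom c))"
    using c bunD(1,2)[OF b(1) c] bunD(1,2)[OF b(2) c] by (simp_all add: bun_add_def)
qed (simp add: bun_add_def)

lemma bun_mult_bun:
  assumes V: "op V" and b: "b \<in> bun X m V" and f: "f \<in> carrier (sec X V)"
  shows "bun_mult X V b f \<in> bun X m V"
proof (rule bunI)
  fix c d W assume c: "c \<in> coords X" and d: "d \<in> coords X" and W_def: "W = V \<inter> cdom c \<inter> cdom d"
  note W = doms2[OF V c d W_def]
  interpret R: ring "sec X W" using W(1) by (rule sec_ring)
  note oc = doms[OF V c] and od = doms[OF V d]
  note cl = bunD(1,2)[OF b c] bunD(1,2)[OF b d]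
  note [simp] = cl J_closed[OF c d W(1,4,5)] dlog_closed[OF c d W(1,4,5)] scal_closed[OF W(1)]
    res_closed[OF oc(1) W(1,2)] res_closed[OF od(1) W(1,3)] res_closed[OF V oc(1,3) f] res_closed[OF V od(1,3) f]
    res_closed[OF V W(1,6) f] res_res[OF V oc(1,3) W(1,2) f] res_res[OF V od(1,3) W(1,3) f]
  show "res X (V \<inter> cdom d) W (snd (bun_mult X V b f d)) = jac X c d W \<otimes>[W] res X (V \<inter> cdom c) W (snd (bun_mult X V b f c))"
    using c d by (simp add: bun_mult_def res_mult[OF oc(1) W(1,2)] res_mult[OF od(1) W(1,3)]
      bunD(3)[OF b c d W_def] R.m_assoc)
  show "res X (V \<inter> cdom d) W (fst (bun_mult X V b f d)) = res X (V \<inter> cdom c) W (fst (bun_mult X V b f c)) \<ominus>[W]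
        (cst X W (gscalar m) \<otimes>[W] dlog c d W \<otimes>[W] res X (V \<inter> cdom c) W (snd (bun_mult X V b f c)))"
    using c d by (simp add: bun_mult_def res_mult[OF oc(1) W(1,2)] res_mult[OF od(1) W(1,3)]
      bunD(4)[OF b c d W_def] R.m_assoc R.l_distr R.minus_eq R.l_minus)
next
  fix c assume c: "c \<in> coords X"
  interpret R: ring "sec X (V \<inter> cdom c)" using doms(1)[OF V c] by (rule sec_ring)
  show "fst (bun_mult X V b f c) \<in> carrier (sec X (V \<inter> cdom c))"
      "snd (bun_mult X V b f c) \<in> carrier (sec X (V \<inter> cdom c))"
    using c bunD(1,2)[OF b c] res_closed[OF V doms(1,3)[OF V c] f] by (simp_all add: bun_mult_def)
qed (simp add: bun_mult_def)

lemma vac_bun: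
  assumes V: "op V" shows "vac X V \<in> bun X m V"
proof (rule bunI)
  fix c d W assume c: "c \<in> coords X" and d: "d \<in> coords X" and W_def: "W = V \<inter> cdom c \<inter> cdom d"
  note W = doms2[OF V c d W_def]
  interpret R: ring "sec X W" using W(1) by (rule sec_ring)
  note oc = doms[OF V c] and od = doms[OF V d]
  note [simp] = J_closed[OF c d W(1,4,5)] dlog_closed[OF c d W(1,4,5)] scal_closed[OF W(1)]
    res_one[OF oc(1) W(1,2)] res_one[OF od(1) W(1,3)] res_zero[OF oc(1) W(1,2)] res_zero[OF od(1) W(1,3)]
  show "res X (V \<inter> cdom d) W (snd (vac X V d)) = jac X c d W \<otimes>[W] res X (V \<inter> cdom c) W (snd (vac X V c))"
    "res X (V \<inter> cdom d) W (fst (vac X V d)) = res X (V \<inter> cdom c) W (fst (vac X V c)) \<ominus>[W]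
        (cst X W (gscalar m) \<otimes>[W] dlog c d W \<otimes>[W] res X (V \<inter> cdom c) W (snd (vac X V c)))"
    using c d by (simp_all add: vac_def R.minus_eq)
next
  fix c assume c: "c \<in> coords X"
  interpret R: ring "sec X (V \<inter> cdom c)" using doms(1)[OF V c] by (rule sec_ring)
  show "fst (vac X V c) \<in> carrier (sec X (V \<inter> cdom c))" "snd (vac X V c) \<in> carrier (sec X (V \<inter> cdom c))"
    using c by (simp_all add: vac_def)
qed (simp add: vac_def)

text \<open>
  The section \<open>\<phi>\<^sub>c\<close> over an open subset of the domain of \<open>c\<close>. Its coefficients in the coordinates \<open>d\<close> are
  read off from the transition rule.
\<close>

definition phi :: "complex \<Rightarrow> ('a, 's) chart \<Rightarrow> 'a set \<Rightarrow> ('a, 's) chart \<Rightarrow> 's \<times> 's" where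
  "phi m c U = (\<lambda>d\<in>coords X.
     (\<ominus>[U \<inter> cdom d] (cst X (U \<inter> cdom d) (gscalar m) \<otimes>[U \<inter> cdom d] dlog c d (U \<inter> cdom d)),
      jac X c d (U \<inter> cdom d)))"

context
  fixes m :: complex and c U assumes c: "c \<in> coords X" and U: "op U" "U \<subseteq> cdom c"
begin

lemma phi_self: "phi m c U c = (\<zero>[U], \<one>[U])"
proof -
  interpret R: ring "sec X U" using U(1) by (rule sec_ring)
  show ?thesis
    using c U scal_closed[OF U(1)] J_self[OF c U] dlog_self[OF c U] by (simp add: phi_def Int_absorb2)
qed

lemma phi_bun: "phi m c U \<in> bun X m U"
proof (rule bunI)
  fix d e W assume d: "d \<in> coords X" and e: "e \<in> coords X" and W_def: "W = U \<inter> cdom d \<inter> cdom e"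
  note W = doms2[OF U(1) d e W_def]
  have Wc: "W \<subseteq> cdom c" using W(6) U(2) by auto
  interpret R: ring "sec X W" using W(1) by (rule sec_ring)
  note od = doms[OF U(1) d] and oe = doms[OF U(1) e]
  have odc: "U \<inter> cdom d \<subseteq> cdom c" "U \<inter> cdom e \<subseteq> cdom c" using U by auto
  interpret Rd: ring "sec X (U \<inter> cdom d)" using od(1) by (rule sec_ring)
  interpret Re: ring "sec X (U \<inter> cdom e)" using oe(1) by (rule sec_ring)
  note [simp] = J_closed[OF d e W(1,4,5)] dlog_closed[OF d e W(1,4,5)] scal_closed[OF W(1)]
    J_closed[OF c d W(1) Wc W(4)] dlog_closed[OF c d W(1) Wc W(4)]
    dlog_closed[OF c d od(1) odc(1) od(2)] dlog_closed[OF c e oe(1) odc(2) oe(2)]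
    scal_closed[OF od(1)] scal_closed[OF oe(1)]
    J_res[OF c d od(1) odc(1) od(2) W(1,2)] J_res[OF c e oe(1) odc(2) oe(2) W(1,3)]
    dlog_res[OF c d od(1) odc(1) od(2) W(1,2)] dlog_res[OF c e oe(1) odc(2) oe(2) W(1,3)]
    scal_res[OF od(1) W(1,2)] scal_res[OF oe(1) W(1,3)]
    res_mult[OF od(1) W(1,2)] res_mult[OF oe(1) W(1,3)] res_uminus[OF od(1) W(1,2)] res_uminus[OF oe(1) W(1,3)]
  note comm = even_commute[OF W(1) J_even[OF c d W(1) Wc W(4)]]
  show "res X (U \<inter> cdom e) W (snd (phi m c U e)) = jac X d e W \<otimes>[W] res X (U \<inter> cdom d) W (snd (phi m c U d))"
    using d e comm[of "jac X d e W"] J_cocycle[OF c d W(1) Wc W(4) e W(5)] by (simp add: phi_def)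
  show "res X (U \<inter> cdom e) W (fst (phi m c U e)) = res X (U \<inter> cdom d) W (fst (phi m c U d)) \<ominus>[W]
        (cst X W (gscalar m) \<otimes>[W] dlog d e W \<otimes>[W] res X (U \<inter> cdom d) W (snd (phi m c U d)))"
    using d e comm[of "dlog d e W"] dlog_cocycle[OF c d e W(1) Wc W(4,5)]
    by (simp add: phi_def R.r_distr R.m_assoc R.minus_add R.minus_eq)
next
  fix d assume d: "d \<in> coords X"
  note od = doms[OF U(1) d]
  have odc: "U \<inter> cdom d \<subseteq> cdom c" using U by auto
  interpret R: ring "sec X (U \<inter> cdom d)" using od(1) by (rule sec_ring)
  show "fst (phi m c U d) \<in> carrier (sec X (U \<inter> cdom d))" "snd (phi m c U d) \<in> carrier (sec X (U \<inter> cdom d))"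
    using d J_closed[OF c d od(1) odc od(2)] dlog_closed[OF c d od(1) odc od(2)] scal_closed[OF od(1)]
    by (simp_all add: phi_def)
qed (simp add: phi_def)

lemma phi_odd: "phi m c U \<in> bun_part X m True U"
proof -
  have "fst (phi m c U d) \<in> part X True (U \<inter> cdom d) \<and> snd (phi m c U d) \<in> part X False (U \<inter> cdom d)"
    if d: "d \<in> coords X" for d
  proof -
    note od = doms[OF U(1) d]
    have odc: "U \<inter> cdom d \<subseteq> cdom c" using U by auto
    show ?thesis
      using d J_even[OF c d od(1) odc od(2)]
        part_uminus[OF od(1) part_mult_even[OF od(1) scal_even[OF od(1)] dlog_odd[OF c d od(1) odc od(2)]]]
      by (simp add: phi_def)
  qed
  then show ?thesis using phi_bun by (simp add: bun_part_def)
qed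

text \<open>This reduces a linear functional on the bundle to its values at \<open>|0\<rangle>\<close> and at \<open>\<phi>\<^sub>c\<close>.\<close>

lemma bun_expand:
  assumes b: "b \<in> bun X m U"
  shows "b = bun_add X U (bun_mult X U (vac X U) (fst (b c))) (bun_mult X U (phi m c U) (snd (b c)))"
    (is "b = ?b'")
proof
  fix d
  have Uc: "U \<inter> cdom c = U" using U by auto
  note bc = bunD(1,2)[OF b c, unfolded Uc]
  show "b d = ?b' d"
  proof (cases "d \<in> coords X")
    case d: True
    define W where "W = U \<inter> cdom d"
    note W = doms[OF U(1) d, folded W_def]
    have W_eq: "W = U \<inter> cdom c \<inter> cdom d" using Uc by (auto simp: W_def)
    have Wc: "W \<subseteq> cdom c" using W(3) U by auto
    interpret R: ring "sec X W" using W(1) by (rule sec_ring)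
    note bd = bunD(1,2)[OF b d, folded W_def]
    note [simp] = bc bd J_closed[OF c d W(1) Wc W(2)] dlog_closed[OF c d W(1) Wc W(2)] scal_closed[OF W(1)]
      res_closed[OF U(1) W(1,3)]
    have "snd (b d) = jac X c d W \<otimes>[W] res X U W (snd (b c))"
      "fst (b d) = res X U W (fst (b c)) \<ominus>[W] (cst X W (gscalar m) \<otimes>[W] dlog c d W \<otimes>[W] res X U W (snd (b c)))"
      using bunD(3,4)[OF b c d W_eq] by (simp_all add: Uc W_def[symmetric] res_id[OF W(1)])
    then have "b d = (res X U W (fst (b c)) \<ominus>[W] (cst X W (gscalar m) \<otimes>[W] dlog c d W \<otimes>[W] res X U W (snd (b c))),
        jac X c d W \<otimes>[W] res X U W (snd (b c)))"
      by (metis prod.collapse)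
    then show ?thesis
      using d by (simp add: bun_add_def bun_mult_def phi_def vac_def W_def[symmetric] R.l_minus R.minus_eq)
  next
    case False
    then show ?thesis using b by (auto simp: bun_def PiE_iff extensional_def bun_add_def)
  qed
qed

end

text \<open>
  The functional that a connection defines on the bundle is \<open>|0\<rangle>\<^sub>c p + \<phi>\<^sub>c q \<mapsto> p - g\<^sub>c q\<close> in the
  coordinates \<open>c\<close>. The law for \<open>g\<close> says exactly that these local expressions agree.
\<close>

definition conn_val ::
  "(('a, 's) chart \<Rightarrow> 's) \<Rightarrow> 'a set \<Rightarrow> (('a, 's) chart \<Rightarrow> 's \<times> 's) \<Rightarrow> ('a, 's) chart \<Rightarrow> 's" where
  "conn_val g V b c = fst (b c) \<ominus>[V \<inter> cdom c] (res X (cdom c) (V \<inter> cdom c) (g c) \<otimes>[V \<inter> cdom c] snd (b c))"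

definition conn_pair ::
  "(('a, 's) chart \<Rightarrow> 's) \<Rightarrow> 'a set \<Rightarrow> (('a, 's) chart \<Rightarrow> 's \<times> 's) \<Rightarrow> 's" where
  "conn_pair g V b = (THE t. t \<in> carrier (sec X V) \<and>
     (\<forall>c\<in>coords X. res X V (V \<inter> cdom c) t = conn_val g V b c))"

context
  fixes m g assumes g: "g \<in> connections m"
begin

lemma conn_val_closed:
  assumes V: "op V" and b: "b \<in> bun X m V" and c: "c \<in> coords X"
  shows "conn_val g V b c \<in> carrier (sec X (V \<inter> cdom c))"
proof -
  interpret R: ring "sec X (V \<inter> cdom c)" using doms(1)[OF V c] by (rule sec_ring)
  show ?thesis
    using bunD(1,2)[OF b c] conn_res_closed[OF g c doms(1,2)[OF V c]] by (simp add: conn_val_def)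
qed

lemma conn_val_compatible:
  assumes V: "op V" and b: "b \<in> bun X m V" and c: "c \<in> coords X" and d: "d \<in> coords X"
    and W_def: "W = V \<inter> cdom c \<inter> cdom d"
  shows "res X (V \<inter> cdom c) W (conn_val g V b c) = res X (V \<inter> cdom d) W (conn_val g V b d)"
proof -
  note W = doms2[OF V c d W_def]
  interpret R: ring "sec X W" using W(1) by (rule sec_ring)
  note oc = doms[OF V c] and od = doms[OF V d]
  interpret Rc: ring "sec X (V \<inter> cdom c)" using oc(1) by (rule sec_ring)
  interpret Rd: ring "sec X (V \<inter> cdom d)" using od(1) by (rule sec_ring)
  note cl = bunD(1,2)[OF b c] bunD(1,2)[OF b d]
  note [simp] = cl J_closed[OF c d W(1,4,5)] dlog_closed[OF c d W(1,4,5)] scal_closed[OF W(1)]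
    res_closed[OF oc(1) W(1,2)] res_closed[OF od(1) W(1,3)]
    conn_res_closed[OF g c oc(1,2)] conn_res_closed[OF g d od(1,2)]
    conn_res_closed[OF g c W(1,4)] conn_res_closed[OF g d W(1,5)]
    res_minus[OF oc(1) W(1,2)] res_minus[OF od(1) W(1,3)] res_mult[OF oc(1) W(1,2)] res_mult[OF od(1) W(1,3)]
    res_res[OF op_dom[OF c] oc(1,2) W(1,2) conn_closed[OF g c]] res_res[OF op_dom[OF d] od(1,2) W(1,3) conn_closed[OF g d]]
  let ?p = "res X (V \<inter> cdom c) W (fst (b c))" and ?q = "res X (V \<inter> cdom c) W (snd (b c))"
  let ?J = "jac X c d W" and ?h = "res X (cdom d) W (g d)"
  have "?h \<otimes>[W] (?J \<otimes>[W] ?q) = ?J \<otimes>[W] (?h \<otimes>[W] ?q)"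
    using even_lcommute[OF W(1) J_even[OF c d W(1,4,5)]] by simp
  then show ?thesis
    by (simp add: conn_val_def bunD(3)[OF b c d W_def] bunD(4)[OF b c d W_def] conn_change[OF g c W(1,4) d W(5)]
      R.l_distr R.minus_eq R.minus_add R.m_assoc R.a_ac)
qed

lemma conn_pair_ex1:
  assumes V: "op V" and b: "b \<in> bun X m V"
  shows "\<exists>!t. t \<in> carrier (sec X V) \<and> (\<forall>c\<in>coords X. res X V (V \<inter> cdom c) t = conn_val g V b c)"
proof (rule ex_ex1I)
  obtain t where "t \<in> carrier (sec X V)" "\<And>c. c \<in> coords X \<Longrightarrow> res X V (V \<inter> cdom c) t = conn_val g V b c"
  proof (rule sections_glue[of "coords X" "\<lambda>c. V \<inter> cdom c" V "conn_val g V b"])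
    fix c d assume "c \<in> coords X" "d \<in> coords X"
    moreover have "V \<inter> cdom c \<inter> (V \<inter> cdom d) = V \<inter> cdom c \<inter> cdom d" by auto
    ultimately show "res X (V \<inter> cdom c) (V \<inter> cdom c \<inter> (V \<inter> cdom d)) (conn_val g V b c) =
        res X (V \<inter> cdom d) (V \<inter> cdom c \<inter> (V \<inter> cdom d)) (conn_val g V b d)"
      using conn_val_compatible[OF V b] by simp
  next
    show "V = (\<Union>c\<in>coords X. V \<inter> cdom c)" by (rule coords_cover_op[OF V])
  qed (use V b in \<open>simp_all add: op_Int_dom conn_val_closed\<close>)
  then show "\<exists>t. t \<in> carrier (sec X V) \<and> (\<forall>c\<in>coords X. res X V (V \<inter> cdom c) t = conn_val g V b c)" by blast
next
  fix s t assume "s \<in> carrier (sec X V) \<and> (\<forall>c\<in>coords X. res X V (V \<inter> cdom c) s = conn_val g V b c)"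
    "t \<in> carrier (sec X V) \<and> (\<forall>c\<in>coords X. res X V (V \<inter> cdom c) t = conn_val g V b c)"
  then show "s = t" by - (rule sections_eq_coords[OF V], simp_all)
qed

lemma conn_pair:
  assumes V: "op V" and b: "b \<in> bun X m V"
  shows "conn_pair g V b \<in> carrier (sec X V)"
    "c \<in> coords X \<Longrightarrow> res X V (V \<inter> cdom c) (conn_pair g V b) = conn_val g V b c"
  using theI'[OF conn_pair_ex1[OF V b], folded conn_pair_def] by auto

lemma conn_pair_eqI:
  assumes V: "op V" and b: "b \<in> bun X m V" and t: "t \<in> carrier (sec X V)"
    "\<And>c. c \<in> coords X \<Longrightarrow> res X V (V \<inter> cdom c) t = conn_val g V b c"
  shows "conn_pair g V b = t"
  unfolding conn_pair_def by (rule the1_equality[OF conn_pair_ex1[OF V b]]) (use t in auto)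

lemma conn_pair_dom:
  assumes c: "c \<in> coords X" and V: "op V" "V \<subseteq> cdom c" and b: "b \<in> bun X m V"
  shows "conn_pair g V b = fst (b c) \<ominus>[V] (res X (cdom c) V (g c) \<otimes>[V] snd (b c))"
  using conn_pair(2)[OF V(1) b c] conn_pair(1)[OF V(1) b] V(2) res_id[OF V(1)]
  by (simp add: conn_val_def Int_absorb2)

lemma conn_pair_res:
  assumes U: "op U" and V: "op V" "V \<subseteq> U" and b: "b \<in> bun X m U"
  shows "conn_pair g V (bun_res X U V b) = res X U V (conn_pair g U b)"
proof (rule conn_pair_eqI[OF V(1) bun_res_bun[OF U V b]])
  note t = conn_pair(1)[OF U b]
  show "res X U V (conn_pair g U b) \<in> carrier (sec X V)" using res_closed[OF U V t] .
  fix c assume c: "c \<in> coords X"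
  note oc = doms[OF U c] and vc = doms[OF V(1) c]
  have sub: "V \<inter> cdom c \<subseteq> U \<inter> cdom c" using V by auto
  interpret R: ring "sec X (U \<inter> cdom c)" using oc(1) by (rule sec_ring)
  have "res X V (V \<inter> cdom c) (res X U V (conn_pair g U b)) =
      res X (U \<inter> cdom c) (V \<inter> cdom c) (res X U (U \<inter> cdom c) (conn_pair g U b))"
    by (simp add: res_res[OF U V vc(1,3) t] res_res[OF U oc(1,3) vc(1) sub t])
  also have "\<dots> = res X (U \<inter> cdom c) (V \<inter> cdom c) (conn_val g U b c)"
    by (simp add: conn_pair(2)[OF U b c])
  also have "\<dots> = conn_val g V (bun_res X U V b) c"
    using c bunD(1,2)[OF b c] conn_res_closed[OF g c oc(1,2)]
    by (cases "b c") (simp add: conn_val_def bun_res_def res_minus[OF oc(1) vc(1) sub] res_mult[OF oc(1) vc(1) sub]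
      res_res[OF op_dom[OF c] oc(1,2) vc(1) sub conn_closed[OF g c]])
  finally show "res X V (V \<inter> cdom c) (res X U V (conn_pair g U b)) = conn_val g V (bun_res X U V b) c" .
qed

lemma conn_pair_add:
  assumes V: "op V" and b: "b \<in> bun X m V" "b' \<in> bun X m V"
  shows "conn_pair g V (bun_add X V b b') = conn_pair g V b \<oplus>[V] conn_pair g V b'"
proof (rule conn_pair_eqI[OF V bun_add_bun[OF V b]])
  interpret V: ring "sec X V" using V by (rule sec_ring)
  note t = conn_pair(1)[OF V b(1)] conn_pair(1)[OF V b(2)]
  show "conn_pair g V b \<oplus>[V] conn_pair g V b' \<in> carrier (sec X V)" using t by simp
  fix c assume c: "c \<in> coords X"
  note oc = doms[OF V c]
  interpret R: ring "sec X (V \<inter> cdom c)" using oc(1) by (rule sec_ring)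
  show "res X V (V \<inter> cdom c) (conn_pair g V b \<oplus>[V] conn_pair g V b') = conn_val g V (bun_add X V b b') c"
    using c bunD(1,2)[OF b(1) c] bunD(1,2)[OF b(2) c] conn_res_closed[OF g c oc(1,2)]
    by (simp add: res_add[OF V oc(1,3) t] conn_pair(2)[OF V b(1) c] conn_pair(2)[OF V b(2) c] conn_val_def
      bun_add_def R.r_distr R.minus_eq R.minus_add R.a_ac)
qed

lemma conn_pair_mult:
  assumes V: "op V" and b: "b \<in> bun X m V" and f: "f \<in> carrier (sec X V)"
  shows "conn_pair g V (bun_mult X V b f) = conn_pair g V b \<otimes>[V] f"
proof (rule conn_pair_eqI[OF V bun_mult_bun[OF V b f]])
  interpret V: ring "sec X V" using V by (rule sec_ring)
  note t = conn_pair(1)[OF V b]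
  show "conn_pair g V b \<otimes>[V] f \<in> carrier (sec X V)" using t f by simp
  fix c assume c: "c \<in> coords X"
  note oc = doms[OF V c]
  interpret R: ring "sec X (V \<inter> cdom c)" using oc(1) by (rule sec_ring)
  show "res X V (V \<inter> cdom c) (conn_pair g V b \<otimes>[V] f) = conn_val g V (bun_mult X V b f) c"
    using c bunD(1,2)[OF b c] conn_res_closed[OF g c oc(1,2)] res_closed[OF V oc(1,3) f]
    by (simp add: res_mult[OF V oc(1,3) t f] conn_pair(2)[OF V b c] conn_val_def
      bun_mult_def R.l_distr R.minus_eq R.l_minus R.m_assoc)
qed

lemma conn_pair_vac:
  assumes V: "op V" shows "conn_pair g V (vac X V) = \<one>[V]"
proof (rule conn_pair_eqI[OF V vac_bun[OF V]])
  interpret V: ring "sec X V" using V by (rule sec_ring)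
  show "\<one>[V] \<in> carrier (sec X V)" by simp
  fix c assume c: "c \<in> coords X"
  note oc = doms[OF V c]
  interpret R: ring "sec X (V \<inter> cdom c)" using oc(1) by (rule sec_ring)
  show "res X V (V \<inter> cdom c) \<one>[V] = conn_val g V (vac X V) c"
    using c conn_res_closed[OF g c oc(1,2)] by (simp add: res_one[OF V oc(1,3)] conn_val_def vac_def R.minus_eq)
qed

lemma conn_pair_part:
  assumes V: "op V" and b: "b \<in> bun_part X m p V"
  shows "conn_pair g V b \<in> part X p V"
proof -
  have b': "b \<in> bun X m V" using b by (simp add: bun_part_def)
  show ?thesis
  proof (rule part_coords[OF V conn_pair(1)[OF V b']])
    fix c assume c: "c \<in> coords X"
    note oc = doms[OF V c]
    have "fst (b c) \<in> part X p (V \<inter> cdom c)" "snd (b c) \<in> part X (\<not> p) (V \<inter> cdom c)"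
      using b c by (auto simp: bun_part_def)
    then show "res X V (V \<inter> cdom c) (conn_pair g V b) \<in> part X p (V \<inter> cdom c)"
      using part_mult[OF oc(1) conn_res_odd[OF g c oc(1,2)], of "snd (b c)" "\<not> p"]
      unfolding conn_pair(2)[OF V b' c] conn_val_def by (intro part_minus[OF oc(1)]) auto
  qed
qed

end

definition conn_split ::
  "complex \<Rightarrow> (('a, 's) chart \<Rightarrow> 's) \<Rightarrow> 'a set \<Rightarrow> 's \<Rightarrow> 'a set \<Rightarrow> (('a, 's) chart \<Rightarrow> 's \<times> 's) \<Rightarrow> 's" where
  "conn_split m g = (\<lambda>U\<in>opens X. \<lambda>f\<in>carrier (sec X U). \<lambda>V\<in>{V \<in> opens X. V \<subseteq> U}. \<lambda>b\<in>bun X m V.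
     res X U V f \<otimes>[V] conn_pair g V b)"

lemma conn_split_apply:
  "op U \<Longrightarrow> f \<in> carrier (sec X U) \<Longrightarrow> op V \<Longrightarrow> V \<subseteq> U \<Longrightarrow> b \<in> bun X m V \<Longrightarrow>
     conn_split m g U f V b = res X U V f \<otimes>[V] conn_pair g V b"
  by (simp add: conn_split_def)

lemma conn_split_dual:
  assumes g: "g \<in> connections m" and U: "op U" and f: "f \<in> carrier (sec X U)"
  shows "conn_split m g U f \<in> dual X m U"
proof -
  have "conn_split m g U f V b \<in> carrier (sec X V) \<and>
      (\<forall>W\<in>opens X. W \<subseteq> V \<longrightarrow> conn_split m g U f W (bun_res X V W b) = res X V W (conn_split m g U f V b)) \<and>
      (\<forall>b'\<in>bun X m V. conn_split m g U f V (bun_add X V b b') = conn_split m g U f V b \<oplus>[V] conn_split m g U f V b') \<and>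
      (\<forall>h\<in>carrier (sec X V). conn_split m g U f V (bun_mult X V b h) = conn_split m g U f V b \<otimes>[V] h)"
    if V: "op V" "V \<subseteq> U" and b: "b \<in> bun X m V" for V b
  proof (intro conjI ballI impI)
    interpret V: ring "sec X V" using V(1) by (rule sec_ring)
    note fV = res_closed[OF U V f] and t = conn_pair(1)[OF g V(1)]
    show "conn_split m g U f V b \<in> carrier (sec X V)"
      using fV t[OF b] by (simp add: conn_split_apply[OF U f V b])
    show "conn_split m g U f V (bun_add X V b b') = conn_split m g U f V b \<oplus>[V] conn_split m g U f V b'"
      if b': "b' \<in> bun X m V" for b'
      using fV t[OF b] t[OF b'] by (simp add: conn_split_apply[OF U f V] b b' bun_add_bun[OF V(1) b b']
        conn_pair_add[OF g V(1) b b'] V.r_distr)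
    show "conn_split m g U f V (bun_mult X V b h) = conn_split m g U f V b \<otimes>[V] h"
      if h: "h \<in> carrier (sec X V)" for h
      using fV t[OF b] h by (simp add: conn_split_apply[OF U f V] b bun_mult_bun[OF V(1) b h]
        conn_pair_mult[OF g V(1) b h] V.m_assoc)
    fix W assume W: "W \<in> opens X" "W \<subseteq> V"
    then have W': "op W" "W \<subseteq> V" "W \<subseteq> U" using V by auto
    show "conn_split m g U f W (bun_res X V W b) = res X V W (conn_split m g U f V b)"
      using fV t[OF b] by (simp add: conn_split_apply[OF U f V b] conn_split_apply[OF U f W'(1,3) bun_res_bun[OF V(1) W'(1,2) b]]
        conn_pair_res[OF g V(1) W'(1,2) b] res_mult[OF V(1) W'(1,2)] res_res[OF U V W'(1,2) f])
  qed
  moreover have "conn_split m g U f \<in> extensional {V \<in> opens X. V \<subseteq> U}"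
    "\<And>V. op V \<Longrightarrow> V \<subseteq> U \<Longrightarrow> conn_split m g U f V \<in> extensional (bun X m V)"
    using U f by (simp_all add: conn_split_def)
  ultimately show ?thesis unfolding dual_def PiE_iff mem_Collect_eq by blast
qed

lemma conn_split_splitting:
  assumes g: "g \<in> connections m" shows "conn_split m g \<in> splittings X m"
proof -
  have "conn_split m g V (res X U V f) = dual_res X m V (conn_split m g U f)"
    if U: "op U" and V: "op V" "V \<subseteq> U" and f: "f \<in> carrier (sec X U)" for U V f
  proof (intro ext)
    fix W b
    show "conn_split m g V (res X U V f) W b = dual_res X m V (conn_split m g U f) W b"
    proof (cases "op W \<and> W \<subseteq> V")
      case W: True
      then have W': "W \<subseteq> U" using V by auto
      then show ?thesis
        using W U V f res_closed[OF U V f]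
        by (cases "b \<in> bun X m W") (simp_all add: conn_split_def dual_res_def res_res[OF U V _ _ f])
    next
      case False
      then show ?thesis using V res_closed[OF U V f] by (auto simp: conn_split_def dual_res_def restrict_def)
    qed
  qed
  moreover have "conn_split m g U (f \<oplus>[U] h) = dual_add X m U (conn_split m g U f) (conn_split m g U h) \<and>
      conn_split m g U (f \<otimes>[U] h) = dual_mult X m U f (conn_split m g U h)"
    if U: "op U" and f: "f \<in> carrier (sec X U)" and h: "h \<in> carrier (sec X U)" for U f h
  proof -
    interpret U: ring "sec X U" using U by (rule sec_ring)
    have *: "res X U V (f \<oplus>[U] h) \<otimes>[V] conn_pair g V b =
        (res X U V f \<otimes>[V] conn_pair g V b) \<oplus>[V] (res X U V h \<otimes>[V] conn_pair g V b)"
      "res X U V (f \<otimes>[U] h) \<otimes>[V] conn_pair g V b = res X U V f \<otimes>[V] (res X U V h \<otimes>[V] conn_pair g V b)"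
      if V: "op V" "V \<subseteq> U" and b: "b \<in> bun X m V" for V b
    proof -
      interpret V: ring "sec X V" using V(1) by (rule sec_ring)
      show "res X U V (f \<oplus>[U] h) \<otimes>[V] conn_pair g V b =
        (res X U V f \<otimes>[V] conn_pair g V b) \<oplus>[V] (res X U V h \<otimes>[V] conn_pair g V b)"
      "res X U V (f \<otimes>[U] h) \<otimes>[V] conn_pair g V b = res X U V f \<otimes>[V] (res X U V h \<otimes>[V] conn_pair g V b)"
        using conn_pair(1)[OF g V(1) b] res_closed[OF U V f] res_closed[OF U V h]
        by (simp_all add: res_add[OF U V f h] res_mult[OF U V f h] V.l_distr V.m_assoc)
    qed
    show ?thesis
      using U f h by (auto simp: conn_split_def dual_add_def dual_mult_def * intro!: restrict_ext)
  qed
  moreover have "conn_split m g U f \<in> dual_part X m p U" if U: "op U" and f: "f \<in> part X p U" for U f p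
  proof -
    have fc: "f \<in> carrier (sec X U)" using part_carrier[OF U f] .
    have "conn_split m g U f V b \<in> part X (p \<noteq> q) V"
      if V: "op V" "V \<subseteq> U" and b: "b \<in> bun_part X m q V" for V b q
    proof -
      have "b \<in> bun X m V" using b by (simp add: bun_part_def)
      then show ?thesis
        using part_mult[OF V(1) res_part[OF U V f] conn_pair_part[OF g V(1) b]]
        by (simp add: conn_split_apply[OF U fc V])
    qed
    then show ?thesis using conn_split_dual[OF g U fc] by (auto simp: dual_part_def)
  qed
  moreover have "conn_split m g U f U (vac X U) = f" if U: "op U" and f: "f \<in> carrier (sec X U)" for U f
  proof -
    interpret U: ring "sec X U" using U by (rule sec_ring)
    show ?thesis
      using conn_split_apply[OF U f U order_refl vac_bun[OF U]] f
      by (simp add: res_id[OF U f] conn_pair_vac[OF g U])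
  qed
  moreover have "conn_split m g \<in> (\<Pi>\<^sub>E U\<in>opens X. carrier (sec X U) \<rightarrow>\<^sub>E dual X m U)"
    using conn_split_dual[OF g] by (auto simp: PiE_iff conn_split_def)
  ultimately show ?thesis by (simp add: splittings_def)
qed

text \<open>
  A splitting is determined by the functionals \<open>\<sigma>(1)\<close>, and these by their values on the \<open>\<phi>\<^sub>c\<close>, which
  therefore are, up to sign, the only possible connection.
\<close>

lemma splitting_connection:
  assumes \<sigma>: "\<sigma> \<in> splittings X m"
  obtains g where "g \<in> connections m" "\<sigma> = conn_split m g"
proof -
  define \<omega> where "\<omega> V b = \<sigma> V \<one>[V] V b" for V b
  have sres: "\<sigma> V (res X U V f) = dual_res X m V (\<sigma> U f)"
    if "op U" "op V" "V \<subseteq> U" "f \<in> carrier (sec X U)" for U V f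
    using \<sigma> that by (auto simp: splittings_def)
  have smult: "\<sigma> U (f \<otimes>[U] h) = dual_mult X m U f (\<sigma> U h)"
    if "op U" "f \<in> carrier (sec X U)" "h \<in> carrier (sec X U)" for U f h
    using \<sigma> that by (auto simp: splittings_def)
  have sdual: "\<sigma> U f \<in> dual X m U" if "op U" "f \<in> carrier (sec X U)" for U f
    using \<sigma> that by (auto simp: splittings_def PiE_iff)
  have one: "\<one>[U] \<in> carrier (sec X U)" if "op U" for U
    using that part_carrier one_even by blast
  have \<omega>_closed: "\<omega> V b \<in> carrier (sec X V)" if "op V" "b \<in> bun X m V" for V b
    using sdual[OF that(1) one[OF that(1)]] that unfolding \<omega>_def by (auto simp: dual_def PiE_iff)
  have \<sigma>_eq: "\<sigma> U f V b = res X U V f \<otimes>[V] \<omega> V b"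
    if U: "op U" and f: "f \<in> carrier (sec X U)" and V: "op V" "V \<subseteq> U" and b: "b \<in> bun X m V" for U f V b
  proof -
    interpret U: ring "sec X U" using U by (rule sec_ring)
    have "\<sigma> U f = dual_mult X m U f (\<sigma> U \<one>[U])"
      using smult[OF U f one[OF U]] f by simp
    then have "\<sigma> U f V b = res X U V f \<otimes>[V] \<sigma> U \<one>[U] V b"
      using V b by (simp add: dual_mult_def)
    moreover have "\<sigma> V \<one>[V] V b = \<sigma> U \<one>[U] V b"
      using sres[OF U V one[OF U]] V by (simp add: res_one[OF U V] dual_res_def)
    ultimately show ?thesis by (simp add: \<omega>_def)
  qed
  have \<omega>_res: "\<omega> W (bun_res X V W b) = res X V W (\<omega> V b)"
    if V: "op V" and W: "op W" "W \<subseteq> V" and b: "b \<in> bun X m V" for V W b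
  proof -
    interpret W: ring "sec X W" using W(1) by (rule sec_ring)
    have "\<sigma> V \<one>[V] W (bun_res X V W b) = res X V W (\<sigma> V \<one>[V] V b)"
      using sdual[OF V one[OF V]] V W b by (auto simp: dual_def)
    then show ?thesis
      using \<sigma>_eq[OF V one[OF V] W bun_res_bun[OF V W b]] \<omega>_closed[OF W(1) bun_res_bun[OF V W b]]
      by (simp add: res_one[OF V W] \<omega>_def)
  qed
  have \<omega>_add: "\<omega> V (bun_add X V b b') = \<omega> V b \<oplus>[V] \<omega> V b'"
    if V: "op V" and b: "b \<in> bun X m V" "b' \<in> bun X m V" for V b b'
    using sdual[OF V one[OF V]] V b unfolding \<omega>_def dual_def by auto
  have \<omega>_mult: "\<omega> V (bun_mult X V b f) = \<omega> V b \<otimes>[V] f"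
    if V: "op V" and b: "b \<in> bun X m V" and f: "f \<in> carrier (sec X V)" for V b f
    using sdual[OF V one[OF V]] V b f unfolding \<omega>_def dual_def by auto
  have \<omega>_vac: "\<omega> V (vac X V) = \<one>[V]" if "op V" for V
    using \<sigma> that one[OF that] unfolding \<omega>_def by (auto simp: splittings_def)
  have \<omega>_expand: "\<omega> V b = fst (b c) \<oplus>[V] (\<omega> V (phi m c V) \<otimes>[V] snd (b c))"
    if c: "c \<in> coords X" and V: "op V" "V \<subseteq> cdom c" and b: "b \<in> bun X m V" for c V b
  proof -
    interpret V: ring "sec X V" using V(1) by (rule sec_ring)
    have bc: "fst (b c) \<in> carrier (sec X V)" "snd (b c) \<in> carrier (sec X V)"
      using bunD(1,2)[OF b c] V by (simp_all add: Int_absorb2)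
    have "\<omega> V b = \<omega> V (bun_add X V (bun_mult X V (vac X V) (fst (b c))) (bun_mult X V (phi m c V) (snd (b c))))"
      using bun_expand[OF c V b] by simp
    also have "\<dots> = fst (b c) \<oplus>[V] (\<omega> V (phi m c V) \<otimes>[V] snd (b c))"
      using bc bun_mult_bun[OF V(1) vac_bun[OF V(1)] bc(1)] bun_mult_bun[OF V(1) phi_bun[OF c V] bc(2)]
      by (simp add: \<omega>_add[OF V(1)] \<omega>_mult[OF V(1)] vac_bun[OF V(1)] phi_bun[OF c V] \<omega>_vac[OF V(1)])
    finally show ?thesis .
  qed
  have phi_res: "bun_res X (cdom c) V (phi m c (cdom c)) = phi m c V"
    if c: "c \<in> coords X" and V: "op V" "V \<subseteq> cdom c" for c V
  proof
    fix d
    show "bun_res X (cdom c) V (phi m c (cdom c)) d = phi m c V d"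
    proof (cases "d \<in> coords X")
      case d: True
      note o = doms[OF op_dom[OF c] d] and v = doms[OF V(1) d]
      have sub: "V \<inter> cdom d \<subseteq> cdom c \<inter> cdom d" using V by auto
      interpret R: ring "sec X (cdom c \<inter> cdom d)" using o(1) by (rule sec_ring)
      show ?thesis
        using d dlog_closed[OF c d o(1,3,2)] scal_closed[OF o(1)]
        by (simp add: bun_res_def phi_def res_uminus[OF o(1) v(1) sub] res_mult[OF o(1) v(1) sub]
          scal_res[OF o(1) v(1) sub] dlog_res[OF c d o(1,3,2) v(1) sub] J_res[OF c d o(1,3,2) v(1) sub])
    qed (simp add: bun_res_def phi_def)
  qed
  define g where "g = (\<lambda>c\<in>coords X. \<ominus>[cdom c] \<omega> (cdom c) (phi m c (cdom c)))"
  have g_res: "res X (cdom c) V (g c) = \<ominus>[V] \<omega> V (phi m c V)"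
    if c: "c \<in> coords X" and V: "op V" "V \<subseteq> cdom c" for c V
    using c \<omega>_res[OF op_dom[OF c] V phi_bun[OF c op_dom[OF c] order_refl]]
      \<omega>_closed[OF op_dom[OF c] phi_bun[OF c op_dom[OF c] order_refl]]
    by (simp add: g_def res_uminus[OF op_dom[OF c] V] phi_res[OF c V])
  have g_odd: "g c \<in> part X True (cdom c)" if c: "c \<in> coords X" for c
  proof -
    have "\<sigma> (cdom c) \<one>[cdom c] \<in> dual_part X m False (cdom c)"
      using \<sigma> op_dom[OF c] one_even[OF op_dom[OF c]] by (auto simp: splittings_def)
    then have "\<omega> (cdom c) (phi m c (cdom c)) \<in> part X True (cdom c)"
      using phi_odd[OF c op_dom[OF c] order_refl] op_dom[OF c] unfolding \<omega>_def dual_part_def by fastforce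
    then show ?thesis using c part_uminus[OF op_dom[OF c]] by (simp add: g_def)
  qed
  have "res X (cdom c) W (g c) = (jac X c d W \<otimes>[W] res X (cdom d) W (g d)) \<oplus>[W] (cst X W (gscalar m) \<otimes>[W] dlog c d W)"
    if c: "c \<in> coords X" and d: "d \<in> coords X" and W_def: "W = cdom c \<inter> cdom d" for c d W
  proof -
    have W: "op W" "W \<subseteq> cdom c" "W \<subseteq> cdom d"
      using W_def op_Int_dom[OF op_dom[OF c] d] by auto
    interpret R: ring "sec X W" using W(1) by (rule sec_ring)
    note [simp] = \<omega>_closed[OF W(1) phi_bun[OF d W(1,3)]] J_closed[OF c d W] dlog_closed[OF c d W] scal_closed[OF W(1)]
    have Wd: "W \<inter> cdom d = W" using W by auto
    have "\<omega> W (phi m c W) = (\<ominus>[W] (cst X W (gscalar m) \<otimes>[W] dlog c d W)) \<oplus>[W] (\<omega> W (phi m d W) \<otimes>[W] jac X c d W)"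
      using \<omega>_expand[OF d W(1,3) phi_bun[OF c W(1,2)]] d by (simp add: phi_def[of m c] Wd)
    then show ?thesis
      using even_commute[OF W(1) J_even[OF c d W], of "\<omega> W (phi m d W)"]
      by (simp add: g_res[OF c W(1,2)] g_res[OF d W(1,3)] R.minus_add R.r_minus R.a_comm)
  qed
  then have g: "g \<in> connections m"
    using g_odd by (auto simp: connections_def Let_def g_def)
  have \<omega>_pair: "conn_pair g V b = \<omega> V b" if V: "op V" and b: "b \<in> bun X m V" for V b
  proof (rule conn_pair_eqI[OF g V b \<omega>_closed[OF V b]])
    fix c assume c: "c \<in> coords X"
    note oc = doms[OF V c]
    interpret R: ring "sec X (V \<inter> cdom c)" using oc(1) by (rule sec_ring)
    note rb = bun_res_bun[OF V oc(1,3) b]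
    have app: "fst (bun_res X V (V \<inter> cdom c) b c) = fst (b c)" "snd (bun_res X V (V \<inter> cdom c) b c) = snd (b c)"
      using c bunD(1,2)[OF b c] by (cases "b c"; simp add: bun_res_def Int_assoc res_id[OF oc(1)])+
    have "res X V (V \<inter> cdom c) (\<omega> V b) = \<omega> (V \<inter> cdom c) (bun_res X V (V \<inter> cdom c) b)"
      using \<omega>_res[OF V oc(1,3) b] by simp
    also have "\<dots> = conn_val g V b c"
      unfolding \<omega>_expand[OF c oc(1,2) rb] app conn_val_def g_res[OF c oc(1,2)]
      using bunD(1,2)[OF b c] \<omega>_closed[OF oc(1) phi_bun[OF c oc(1,2)]]
      by (simp add: R.minus_eq R.l_minus)
    finally show "res X V (V \<inter> cdom c) (\<omega> V b) = conn_val g V b c" .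
  qed
  have "\<sigma> U f V b = conn_split m g U f V b"
    if U: "op U" and f: "f \<in> carrier (sec X U)" and V: "op V" "V \<subseteq> U" and b: "b \<in> bun X m V" for U f V b
    using \<sigma>_eq[OF that] conn_split_apply[OF that] \<omega>_pair[OF V(1) b] by simp
  then have "\<sigma> U f V = conn_split m g U f V"
    if U: "op U" and f: "f \<in> carrier (sec X U)" and V: "op V" "V \<subseteq> U" for U f V
    using that sdual[OF U f] conn_split_dual[OF g U f]
    by (intro PiE_ext[of _ "bun X m V" "\<lambda>_. carrier (sec X V)"]) (auto simp: dual_def PiE_iff)
  then have "\<sigma> U f = conn_split m g U f" if U: "op U" and f: "f \<in> carrier (sec X U)" for U f
    using that sdual[OF U f] conn_split_dual[OF g U f]
    by (intro PiE_ext[of _ "{V \<in> opens X. V \<subseteq> U}" "\<lambda>V. bun X m V \<rightarrow>\<^sub>E carrier (sec X V)"]) (auto simp: dual_def)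
  then have "\<sigma> U = conn_split m g U" if U: "op U" for U
    using that \<sigma> conn_split_splitting[OF g]
    by (intro PiE_ext[of _ "carrier (sec X U)" "\<lambda>_. dual X m U"]) (auto simp: splittings_def PiE_iff)
  then have "\<sigma> = conn_split m g"
    using \<sigma> conn_split_splitting[OF g]
    by (intro PiE_ext[of _ "opens X" "\<lambda>U. carrier (sec X U) \<rightarrow>\<^sub>E dual X m U"]) (auto simp: splittings_def)
  with g that show thesis by blast
qed

lemma conn_split_trivial:
  assumes g: "g \<in> connections m" and c: "c \<in> coords X"
  shows "split_trivial X m (conn_split m g) c \<longleftrightarrow> g c = \<zero>[cdom c]"
proof
  assume g0: "g c = \<zero>[cdom c]"
  show "split_trivial X m (conn_split m g) c"
    unfolding split_trivial_def
  proof (intro ballI impI)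
    fix U b assume U: "U \<in> opens X" "U \<subseteq> cdom c" and b: "b \<in> bun X m U"
    have U': "op U" using U by simp
    interpret U: ring "sec X U" using U' by (rule sec_ring)
    show "conn_split m g U \<one>[U] U b = fst (b c)"
      using conn_split_apply[OF U' U.one_closed U' order_refl b] conn_pair(1)[OF g U' b]
        conn_pair_dom[OF g c U' U(2) b] bunD(1,2)[OF b c] U(2)
      by (simp add: res_id[OF U'] g0 res_zero[OF op_dom[OF c] U' U(2)] U.minus_eq Int_absorb2)
  qed
next
  assume triv: "split_trivial X m (conn_split m g) c"
  let ?U = "cdom c"
  note U = op_dom[OF c]
  interpret U: ring "sec X ?U" using U by (rule sec_ring)
  note phi = phi_bun[OF c U order_refl]
  have "conn_split m g ?U \<one>[?U] ?U (phi m c ?U) = fst (phi m c ?U c)"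
    using triv U phi by (auto simp: split_trivial_def)
  then have "\<ominus>[?U] g c = \<zero>[?U]"
    using conn_split_apply[OF U U.one_closed U order_refl phi] conn_pair(1)[OF g U phi]
      conn_pair_dom[OF g c U order_refl phi] conn_closed[OF g c]
    by (simp add: res_id[OF U] phi_self[OF c U order_refl] U.minus_eq)
  then show "g c = \<zero>[?U]" using conn_closed[OF g c] U.minus_minus U.minus_zero by metis
qed

lemma bij_conn_split: "bij_betw (conn_split m) (connections m) (splittings X m)"
proof (rule bij_betw_imageI)
  show "inj_on (conn_split m) (connections m)"
  proof (rule inj_onI)
    fix g g' assume g: "g \<in> connections m" "g' \<in> connections m" and eq: "conn_split m g = conn_split m g'"
    have "g c = g' c" if c: "c \<in> coords X" for c
    proof -
      let ?U = "cdom c"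
      note U = op_dom[OF c]
      interpret U: ring "sec X ?U" using U by (rule sec_ring)
      note phi = phi_bun[OF c U order_refl]
      have "conn_split m h ?U \<one>[?U] ?U (phi m c ?U) = \<ominus>[?U] h c" if h: "h \<in> connections m" for h
        using conn_split_apply[OF U U.one_closed U order_refl phi] conn_pair(1)[OF h U phi]
          conn_pair_dom[OF h c U order_refl phi] conn_closed[OF h c]
        by (simp add: res_id[OF U] phi_self[OF c U order_refl] U.minus_eq)
      then have "\<ominus>[?U] g c = \<ominus>[?U] g' c" using g eq by metis
      then show ?thesis using conn_closed[OF g(1) c] conn_closed[OF g(2) c] U.minus_minus by metis
    qed
    then show "g = g'" using g by (intro PiE_ext[of g "coords X" _ g']) (auto simp: connections_def)
  qed
  show "conn_split m ` connections m = splittings X m"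
    using conn_split_splitting splitting_connection by blast
qed

section \<open>New charts from old ones\<close>

lemma zc_eqI:
  assumes "is_chart X c" "op W" "W \<subseteq> cdom c" "t \<in> carrier (sec X W)" "ciso c W t = sfun_z (im c W)"
  shows "zc X c W = t"
  using assms iso_inj[OF assms(1-3) _ assms(4)] iso_zc[OF assms(1-3)]
    part_carrier[OF assms(2) zc_part[OF assms(1-3)]] by simp

lemma thetac_eqI:
  assumes "is_chart X c" "op W" "W \<subseteq> cdom c" "t \<in> carrier (sec X W)" "ciso c W t = sfun_theta (im c W)"
  shows "thetac X c W = t"
  using assms iso_inj[OF assms(1-3) _ assms(4)] iso_thetac[OF assms(1-3)]
    part_carrier[OF assms(2) thetac_part[OF assms(1-3)]] by simp

lemma is_chartI:
  assumes "op (cdom c)" "open (im c (cdom c))"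
    "homeomorphic_map (subtopology (tsp X) (cdom c)) (top_of_set (im c (cdom c))) (cbody c)"
    "\<And>W. op W \<Longrightarrow> W \<subseteq> cdom c \<Longrightarrow> ciso c W \<in> ring_hom (sec X W) (sfun_ring (ngens X) (im c W))"
    "\<And>W. op W \<Longrightarrow> W \<subseteq> cdom c \<Longrightarrow>
       bij_betw (ciso c W) (carrier (sec X W)) (carrier (sfun_ring (ngens X) (im c W)))"
    "\<And>W p s. op W \<Longrightarrow> W \<subseteq> cdom c \<Longrightarrow> s \<in> part X p W \<Longrightarrow> ciso c W s \<in> sfun_part (ngens X) p (im c W)"
    "\<And>W a. op W \<Longrightarrow> W \<subseteq> cdom c \<Longrightarrow> a \<in> carrier (Lam X) \<Longrightarrow>
       ciso c W (cst X W a) = sfun_restrict (im c W) (\<lambda>w. a)"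
    "\<And>W W' s. op W \<Longrightarrow> W \<subseteq> cdom c \<Longrightarrow> op W' \<Longrightarrow> W' \<subseteq> W \<Longrightarrow> s \<in> carrier (sec X W) \<Longrightarrow>
       ciso c W' (res X W W' s) = sfun_restrict (im c W') (ciso c W s)"
  shows "is_chart X c"
  unfolding is_chart_def by (intro conjI ballI impI allI) (simp_all add: assms)

lemma restrict_chart:
  assumes c: "c \<in> coords X" and U: "op U" "U \<subseteq> cdom c"
  defines "c' \<equiv> c\<lparr>cdom := U\<rparr>"
  shows "c' \<in> coords X" "g \<in> connections m \<Longrightarrow> g c' = res X (cdom c) U (g c)"
proof -
  note cc = coords_chart[OF c]
  have top: "topspace (subtopology (tsp X) (cdom c)) \<inter> U = U"
    using openin_subset[OF U(1)] U(2) by auto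
  have "homeomorphic_map (subtopology (subtopology (tsp X) (cdom c)) U)
      (subtopology (top_of_set (im c (cdom c))) (im c U)) (cbody c)"
    by (rule homeomorphic_map_subtopologies[OF chart_homeo[OF cc]], unfold top) (use U(2) in auto)
  then have hom: "homeomorphic_map (subtopology (tsp X) U) (top_of_set (im c U)) (cbody c)"
    using U(2) by (simp add: subtopology_subtopology Int_absorb1 image_mono)
  have ch: "is_chart X c'"
  proof (rule is_chartI)
    fix W assume "op W" "W \<subseteq> cdom c'"
    then have W: "op W" "W \<subseteq> cdom c" using U by (auto simp: c'_def)
    show "ciso c' W \<in> ring_hom (sec X W) (sfun_ring (ngens X) (im c' W))"
      "bij_betw (ciso c' W) (carrier (sec X W)) (carrier (sfun_ring (ngens X) (im c' W)))"
      using iso_hom[OF cc W] iso_bij[OF cc W] by (simp_all add: c'_def)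
    show "s \<in> part X p W \<Longrightarrow> ciso c' W s \<in> sfun_part (ngens X) p (im c' W)" for p s
      using iso_sfun_part[OF cc W] by (simp add: c'_def)
    show "a \<in> carrier (Lam X) \<Longrightarrow> ciso c' W (cst X W a) = sfun_restrict (im c' W) (\<lambda>w. a)" for a
      using iso_cst[OF cc W] by (simp add: c'_def)
    show "op W' \<Longrightarrow> W' \<subseteq> W \<Longrightarrow> s \<in> carrier (sec X W) \<Longrightarrow>
       ciso c' W' (res X W W' s) = sfun_restrict (im c' W') (ciso c' W s)" for W' s
      using iso_res[OF cc W] by (simp add: c'_def)
  qed (use U hom chart_open[OF cc U] in \<open>simp_all add: c'_def\<close>)
  have th: "thetac X c' W = thetac X c W" "zc X c' W = zc X c W" for W
    by (simp_all add: thetac_def zc_def from_chart_def c'_def)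
  interpret R: ring "sec X U" using U(1) by (rule sec_ring)
  have "cdom c \<inter> cdom c' = U" using U by (auto simp: c'_def)
  then have "superconformal_change X c c'"
    using part_carrier[OF U(1) thetac_part[OF cc U]]
    by (simp add: superconformal_change_def Let_def th Dc_zc[OF cc U] Dc_thetac[OF cc U])
  then show c': "c' \<in> coords X"
    using U by (intro coordsI[OF c ch]) (auto simp: c'_def)
  have dom': "cdom c' = U" and U': "U \<subseteq> cdom c'" by (simp_all add: c'_def)
  have J: "jac X c c' U = \<one>[U]" by (simp add: jac_def th Dc_thetac[OF cc U])
  have "dlog c c' U = \<zero>[U]"
    using D_J[OF c c' U U'] dlog_closed[OF c c' U U'] by (simp add: J Dc_one[OF cc U])
  then show "g c' = res X (cdom c) U (g c)" if g: "g \<in> connections m"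
    using conn_change[OF g c U c' U'] conn_res_closed[OF g c' U(1) U'] conn_closed[OF g c'] scal_closed[OF U(1), of m]
      res_id[OF U(1), of "g c'"]
    by (simp add: J dom')
qed

text \<open>
  Changes of coordinates that leave the body of a chart alone are given by automorphisms of the
  structure sheaf over its domain.
\<close>

lemma automorphism_chart:
  assumes c: "is_chart X c"
    and hom: "\<And>W. op W \<Longrightarrow> W \<subseteq> cdom c \<Longrightarrow> \<alpha> W \<in> ring_hom (sec X W) (sec X W)"
    and bij: "\<And>W. op W \<Longrightarrow> W \<subseteq> cdom c \<Longrightarrow> bij_betw (\<alpha> W) (carrier (sec X W)) (carrier (sec X W))"
    and par: "\<And>W p s. op W \<Longrightarrow> W \<subseteq> cdom c \<Longrightarrow> s \<in> part X p W \<Longrightarrow> \<alpha> W s \<in> part X p W"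
    and cst: "\<And>W a. op W \<Longrightarrow> W \<subseteq> cdom c \<Longrightarrow> a \<in> carrier (Lam X) \<Longrightarrow> \<alpha> W (cst X W a) = cst X W a"
    and nat: "\<And>W W' s. op W \<Longrightarrow> W \<subseteq> cdom c \<Longrightarrow> op W' \<Longrightarrow> W' \<subseteq> W \<Longrightarrow> s \<in> carrier (sec X W) \<Longrightarrow>
       \<alpha> W' (res X W W' s) = res X W W' (\<alpha> W s)"
  defines "c' \<equiv> c\<lparr>ciso := \<lambda>W s. ciso c W (\<alpha> W s)\<rparr>"
  shows "is_chart X c'"
proof (rule is_chartI)
  fix W assume "op W" "W \<subseteq> cdom c'"
  then have W: "op W" "W \<subseteq> cdom c" by (auto simp: c'_def)
  have eq: "ciso c' W = ciso c W \<circ> \<alpha> W" by (auto simp: c'_def)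
  show "ciso c' W \<in> ring_hom (sec X W) (sfun_ring (ngens X) (im c' W))"
    unfolding eq using ring_hom_trans[OF hom[OF W] iso_hom[OF c W]] by (simp add: c'_def)
  show "bij_betw (ciso c' W) (carrier (sec X W)) (carrier (sfun_ring (ngens X) (im c' W)))"
    unfolding eq using bij_betw_trans[OF bij[OF W] iso_bij[OF c W]] by (simp add: c'_def)
  show "s \<in> part X p W \<Longrightarrow> ciso c' W s \<in> sfun_part (ngens X) p (im c' W)" for p s
    using iso_sfun_part[OF c W par[OF W]] by (simp add: c'_def)
  show "a \<in> carrier (Lam X) \<Longrightarrow> ciso c' W (cst X W a) = sfun_restrict (im c' W) (\<lambda>w. a)" for a
    using iso_cst[OF c W] cst[OF W] by (simp add: c'_def)
  show "op W' \<Longrightarrow> W' \<subseteq> W \<Longrightarrow> s \<in> carrier (sec X W) \<Longrightarrow>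
       ciso c' W' (res X W W' s) = sfun_restrict (im c' W') (ciso c' W s)" for W' s
    using iso_res[OF c W] nat[OF W] ring_hom_closed[OF hom[OF W]] by (simp add: c'_def)
qed (use chart_dom[OF c] chart_image[OF c] chart_homeo[OF c] in \<open>simp_all add: c'_def\<close>)

text \<open>
  The change of coordinates \<open>z' = f(z)\<close>, \<open>\<theta>' = a(z) \<theta>\<close>: a superfunction in \<open>(z, \<theta>)\<close> is written in
  \<open>(z', \<theta>')\<close> by composing its coefficients with the inverse \<open>h\<close> of \<open>f\<close>, and dividing those that
  belong to \<open>\<theta>\<close> by \<open>a\<close>.
\<close>

definition body_sfun ::
  "complex set \<Rightarrow> (complex \<Rightarrow> complex) \<Rightarrow> (complex \<Rightarrow> complex) \<Rightarrow> (complex \<Rightarrow> complex) \<Rightarrow>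
   (complex \<Rightarrow> grass) \<Rightarrow> complex \<Rightarrow> grass" where
  "body_sfun V f h a s = sfun_restrict (f ` V) (\<lambda>w S. s (h w) S * (if 0 \<in> S then inverse (a (h w)) else 1))"

definition body_chart ::
  "('a, 's) chart \<Rightarrow> (complex \<Rightarrow> complex) \<Rightarrow> (complex \<Rightarrow> complex) \<Rightarrow> (complex \<Rightarrow> complex) \<Rightarrow> ('a, 's) chart" where
  "body_chart c f h a = \<lparr>cdom = cdom c, cbody = f \<circ> cbody c,
     ciso = \<lambda>W s. body_sfun (im c W) f h a (ciso c W s)\<rparr>"

lemma body_sfun_carrier:
  assumes "h holomorphic_on f ` V" "\<And>w. w \<in> V \<Longrightarrow> h (f w) = w"
    "a holomorphic_on V" "\<And>w. w \<in> V \<Longrightarrow> a w \<noteq> 0" "s \<in> carrier (sfun_ring n V)"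
  shows "body_sfun V f h a s \<in> carrier (sfun_ring n (f ` V))"
  unfolding body_sfun_def
proof (rule sfun_restrict_carrier)
  fix w S assume "s (h w) S * (if 0 \<in> S then inverse (a (h w)) else 1) \<noteq> 0"
  then show "S \<subseteq> {..n}" using assms(5) by (auto simp: sfun_carrier_iff)
next
  fix S
  have im: "h ` f ` V \<subseteq> V" using assms(2) by auto
  have "(\<lambda>w. s w S) holomorphic_on V" using assms(5) by (auto simp: sfun_carrier_iff)
  then have "((\<lambda>w. s w S) \<circ> h) holomorphic_on f ` V" "(a \<circ> h) holomorphic_on f ` V"
    using assms(1,3) im by (auto intro: holomorphic_on_compose_gen)
  then show "(\<lambda>w. s (h w) S * (if 0 \<in> S then inverse (a (h w)) else 1)) holomorphic_on f ` V"
    using assms(2,4) by (cases "0 \<in> S") (auto simp: o_def intro!: holomorphic_intros)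
qed

lemma body_sfun_mult:
  "body_sfun V f h a (\<lambda>w. gmult (s w) (t w)) = (\<lambda>w. gmult (body_sfun V f h a s w) (body_sfun V f h a t w))"
proof (intro ext)
  fix w S
  show "body_sfun V f h a (\<lambda>w. gmult (s w) (t w)) w S = gmult (body_sfun V f h a s w) (body_sfun V f h a t w) S"
  proof (cases "w \<in> f ` V")
    case True
    then show ?thesis
      by (auto simp: body_sfun_def sfun_restrict_def gmult_eq sum_distrib_right intro!: sum.cong)
  qed (simp add: body_sfun_def sfun_restrict_def)
qed

lemma body_sfun_bij:
  assumes V: "open V" and f: "f holomorphic_on V" and h: "h holomorphic_on f ` V" "\<And>w. w \<in> V \<Longrightarrow> h (f w) = w"
    and a: "a holomorphic_on V" "\<And>w. w \<in> V \<Longrightarrow> a w \<noteq> 0"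
  shows "bij_betw (body_sfun V f h a) (carrier (sfun_ring n V)) (carrier (sfun_ring n (f ` V)))"
proof (rule bij_betw_byWitness[where f' = "\<lambda>t. sfun_restrict V (\<lambda>w S. t (f w) S * (if 0 \<in> S then a w else 1))"])
  show "\<forall>s\<in>carrier (sfun_ring n V).
      sfun_restrict V (\<lambda>w S. body_sfun V f h a s (f w) S * (if 0 \<in> S then a w else 1)) = s"
    using h(2) a(2) by (auto simp: body_sfun_def sfun_restrict_def fun_eq_iff sfun_outside)
  show "\<forall>t\<in>carrier (sfun_ring n (f ` V)).
      body_sfun V f h a (sfun_restrict V (\<lambda>w S. t (f w) S * (if 0 \<in> S then a w else 1))) = t"
    using h(2) a(2) by (auto simp: body_sfun_def sfun_restrict_def fun_eq_iff sfun_outside)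
  show "body_sfun V f h a ` carrier (sfun_ring n V) \<subseteq> carrier (sfun_ring n (f ` V))"
    using body_sfun_carrier[OF h a] by auto
  show "(\<lambda>t. sfun_restrict V (\<lambda>w S. t (f w) S * (if 0 \<in> S then a w else 1))) ` carrier (sfun_ring n (f ` V))
      \<subseteq> carrier (sfun_ring n V)"
  proof (intro image_subsetI sfun_restrict_carrier)
    fix t w S assume "t \<in> carrier (sfun_ring n (f ` V))" "t (f w) S * (if 0 \<in> S then a w else 1) \<noteq> 0"
    then show "S \<subseteq> {..n}" by (auto simp: sfun_carrier_iff)
  next
    fix t S assume "t \<in> carrier (sfun_ring n (f ` V))"
    then have "(\<lambda>w. t w S) holomorphic_on f ` V" by (auto simp: sfun_carrier_iff)
    then have "((\<lambda>w. t w S) \<circ> f) holomorphic_on V" using f by (auto intro: holomorphic_on_compose)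
    then show "(\<lambda>w. t (f w) S * (if 0 \<in> S then a w else 1)) holomorphic_on V"
      using a by (cases "0 \<in> S") (auto simp: o_def intro!: holomorphic_intros)
  qed
qed

lemma body_chart:
  assumes c: "is_chart X c" and f: "f holomorphic_on im c (cdom c)" "inj_on f (im c (cdom c))"
    and h: "h holomorphic_on f ` im c (cdom c)" "\<And>w. w \<in> im c (cdom c) \<Longrightarrow> h (f w) = w"
    and a: "a holomorphic_on im c (cdom c)" "\<And>w. w \<in> im c (cdom c) \<Longrightarrow> a w \<noteq> 0"
  shows "is_chart X (body_chart c f h a)"
proof (rule is_chartI)
  let ?c = "body_chart c f h a" and ?V = "im c (cdom c)"
  have simps: "cdom ?c = cdom c" "cbody ?c = f \<circ> cbody c" "ciso ?c W s = body_sfun (im c W) f h a (ciso c W s)"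
    "im ?c W = f ` im c W" for W s
    by (auto simp: body_chart_def)
  note V = chart_image[OF c]
  have fV: "open (f ` ?V)" using open_mapping_thm3[OF f(1) V f(2)] by simp
  then show "open (im ?c (cdom ?c))" by (simp add: simps(1,3,4))
  show "op (cdom ?c)" using chart_dom[OF c] by (simp add: simps(1,3,4))
  have cont: "continuous_on ?V f" "continuous_on (f ` ?V) h"
    using f h by (auto intro: holomorphic_on_imp_continuous_on)
  have "homeomorphic_maps (top_of_set ?V) (top_of_set (f ` ?V)) f h"
    using cont h(2) by (auto simp: homeomorphic_maps_def)
  then have "homeomorphic_map (top_of_set ?V) (top_of_set (f ` ?V)) f"
    by (rule homeomorphic_maps_imp_map)
  then show "homeomorphic_map (subtopology (tsp X) (cdom ?c)) (top_of_set (im ?c (cdom ?c))) (cbody ?c)"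
    using homeomorphic_map_compose[OF chart_homeo[OF c]] by (simp add: simps(1) simps(4)) (simp add: simps(2))
  fix W assume "op W" "W \<subseteq> cdom ?c"
  then have W: "op W" "W \<subseteq> cdom c" by (simp_all add: simps(1,3,4))
  have sub: "im c W \<subseteq> ?V" using W by auto
  have hW: "h holomorphic_on f ` im c W" "\<And>w. w \<in> im c W \<Longrightarrow> h (f w) = w"
    and aW: "a holomorphic_on im c W" "\<And>w. w \<in> im c W \<Longrightarrow> a w \<noteq> 0" and fW: "f holomorphic_on im c W"
    using h a f(1) holomorphic_on_subset[OF _ sub] holomorphic_on_subset[OF h(1) image_mono[OF sub]] sub by auto
  have eq: "ciso ?c W = body_sfun (im c W) f h a \<circ> ciso c W" by (intro ext) (simp add: simps(3))
  note bb = body_sfun_bij[OF chart_open[OF c W] fW hW aW]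
  show "bij_betw (ciso ?c W) (carrier (sec X W)) (carrier (sfun_ring (ngens X) (im ?c W)))"
    unfolding eq using bij_betw_trans[OF iso_bij[OF c W] bb] by (simp add: simps(1,3,4))
  have cstW: "body_sfun (im c W) f h a (sfun_restrict (im c W) (\<lambda>w. b)) = sfun_restrict (f ` im c W) (\<lambda>w. b)"
    if "\<And>S. 0 \<in> S \<Longrightarrow> b S = 0" for b
    using that hW(2) by (auto simp: body_sfun_def sfun_restrict_def fun_eq_iff)
  show "ciso ?c W \<in> ring_hom (sec X W) (sfun_ring (ngens X) (im ?c W))"
  proof (rule ring_hom_memI)
    fix s t assume s: "s \<in> carrier (sec X W)" and t: "t \<in> carrier (sec X W)"
    show "ciso ?c W (s \<otimes>[W] t) = ciso ?c W s \<otimes>\<^bsub>sfun_ring (ngens X) (im ?c W)\<^esub> ciso ?c W t"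
      by (simp add: simps(1,3,4) iso_mult[OF c W s t] body_sfun_mult)
    show "ciso ?c W (s \<oplus>[W] t) = ciso ?c W s \<oplus>\<^bsub>sfun_ring (ngens X) (im ?c W)\<^esub> ciso ?c W t"
      by (auto simp add: simps(1,3,4) iso_add[OF c W s t] body_sfun_def sfun_restrict_def fun_eq_iff algebra_simps)
  next
    fix s assume s: "s \<in> carrier (sec X W)"
    show "ciso ?c W s \<in> carrier (sfun_ring (ngens X) (im ?c W))"
      using body_sfun_carrier[OF hW aW iso_closed[OF c W s]] by (simp add: simps(1,3,4))
  next
    show "ciso ?c W \<one>[W] = \<one>\<^bsub>sfun_ring (ngens X) (im ?c W)\<^esub>"
    proof -
      have "body_sfun (im c W) f h a (sfun_restrict (im c W) (\<lambda>w. gscalar 1)) =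
          sfun_restrict (f ` im c W) (\<lambda>w. gscalar 1)"
        by (rule cstW) (auto simp: gscalar_def)
      then show ?thesis
        using ring_hom_one[OF iso_hom[OF c W]] by (simp add: simps(3,4) sfun_one)
    qed
  qed
  show "ciso ?c W s \<in> sfun_part (ngens X) p (im ?c W)" if s: "s \<in> part X p W" for p s
    using body_sfun_carrier[OF hW aW iso_closed[OF c W part_carrier[OF W(1) s]]] iso_sfun_part[OF c W s]
    by (auto simp: simps(1,3,4) sfun_part_iff body_sfun_def sfun_restrict_def split: if_splits)
  show "ciso ?c W (cst X W b) = sfun_restrict (im ?c W) (\<lambda>w. b)" if b: "b \<in> carrier (Lam X)" for b
  proof -
    have "b S = 0" if "0 \<in> S" for S using that b by (force simp: grassmann_def)
    then show ?thesis by (simp add: simps(1,3,4) iso_cst[OF c W b] cstW)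
  qed
  fix W' s assume W': "op W'" "W' \<subseteq> W" and s: "s \<in> carrier (sec X W)"
  then have "im c W' \<subseteq> im c W" by auto
  then show "ciso ?c W' (res X W W' s) = sfun_restrict (im ?c W') (ciso ?c W s)"
    using hW(2) by (auto simp: simps(1,3,4) iso_res[OF c W W' s] body_sfun_def sfun_restrict_def fun_eq_iff)
qed

section \<open>Killing the body of a connection\<close>

context
  fixes c f h a
  assumes c: "c \<in> coords X" and f: "f holomorphic_on im c (cdom c)" "inj_on f (im c (cdom c))"
    and h: "h holomorphic_on f ` im c (cdom c)" "\<And>w. w \<in> im c (cdom c) \<Longrightarrow> h (f w) = w"
    and a: "a holomorphic_on im c (cdom c)" "\<And>w. w \<in> im c (cdom c) \<Longrightarrow> a w \<noteq> 0"
    and fa: "\<And>w. w \<in> im c (cdom c) \<Longrightarrow> deriv f w = a w * a w"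
begin

lemma body_chart_simps: "cdom (body_chart c f h a) = cdom c" "im (body_chart c f h a) (cdom c) = f ` im c (cdom c)"
  "ciso (body_chart c f h a) (cdom c) s = body_sfun (im c (cdom c)) f h a (ciso c (cdom c) s)"
  by (auto simp: body_chart_def)

lemma body_chart_jac:
  "body_chart c f h a \<in> coords X"
  "ciso c (cdom c) (jac X c (body_chart c f h a) (cdom c)) = sfun_restrict (im c (cdom c)) (\<lambda>w. gscalar (a w))"
proof -
  let ?U = "cdom c" and ?V = "im c (cdom c)" and ?c = "body_chart c f h a"
  note cc = coords_chart[OF c]
  note cc' = body_chart[OF cc f h a]
  note U = op_dom[OF c]
  have U': "?U \<subseteq> cdom ?c" by (simp add: body_chart_simps)
  have V: "open ?V" using chart_image[OF cc] .
  let ?F = "sfun_restrict ?V (\<lambda>w. gscalar (f w))" and ?P = "sfun_restrict ?V (\<lambda>w S. if S = {0} then a w else 0)"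
  have F: "?F \<in> carrier (sfun_ring (ngens X) ?V)" and P: "?P \<in> carrier (sfun_ring (ngens X) ?V)"
    using sfun_scalar_part(1)[OF f(1)] sfun_scalar_part(2)[OF a(1)] by (auto simp: sfun_part_iff)
  define z where "z = from_chart X c ?U ?F"
  define t where "t = from_chart X c ?U ?P"
  have z: "z \<in> carrier (sec X ?U)" "ciso c ?U z = ?F" and t: "t \<in> carrier (sec X ?U)" "ciso c ?U t = ?P"
    using from_closed[OF cc U order_refl] iso_from[OF cc U order_refl] F P by (auto simp: z_def t_def)
  have "ciso ?c ?U z = sfun_z (im ?c ?U)" "ciso ?c ?U t = sfun_theta (im ?c ?U)"
    unfolding body_chart_simps z t using h(2) a(2)
    by (auto simp: body_sfun_def sfun_restrict_def sfun_z_def sfun_theta_def gscalar_def fun_eq_iff)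
  then have zc: "zc X ?c ?U = z" and th: "thetac X ?c ?U = t"
    using zc_eqI[OF cc' U U' z(1)] thetac_eqI[OF cc' U U' t(1)] by auto
  have Dt: "ciso c ?U (Dc X c ?U t) = sfun_restrict ?V (\<lambda>w. gscalar (a w))"
    by (simp add: iso_Dc[OF cc U order_refl t(1)] t(2) sfun_D_theta_scalar)
  then show "ciso c ?U (jac X c ?c ?U) = sfun_restrict ?V (\<lambda>w. gscalar (a w))"
    by (simp add: jac_def th)
  interpret R: ring "sec X ?U" using U by (rule sec_ring)
  note Dcl = Dc_closed[OF cc U order_refl]
  have "Dc X c ?U z = t \<otimes>[?U] Dc X c ?U t"
  proof (rule iso_inj[OF cc U order_refl])
    show "ciso c ?U (Dc X c ?U z) = ciso c ?U (t \<otimes>[?U] Dc X c ?U t)"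
      unfolding iso_mult[OF cc U order_refl t(1) Dcl[OF t(1)]] iso_Dc[OF cc U order_refl z(1)] Dt z(2) t(2)
        sfun_D_scalar[OF V f(1)]
    proof (intro ext)
      fix w :: complex and S :: "nat set"
      have "S - {0} = {} \<longleftrightarrow> S = {0}" if "0 \<in> S" using that by auto
      then show "sfun_restrict ?V (\<lambda>w S. if S = {0} then deriv f w else 0) w S =
          gmult (?P w) (sfun_restrict ?V (\<lambda>w. gscalar (a w)) w) S"
        using fa by (cases "finite S") (auto simp: sfun_restrict_def gmult_theta_left gmult_infinite gscalar_def)
    qed
  qed (use z t Dcl in auto)
  then have "superconformal_change X c ?c"
    by (simp add: superconformal_change_def Let_def body_chart_simps zc th)
  then show "body_chart c f h a \<in> coords X"
    using coordsI[OF c cc'] by (simp add: body_chart_simps)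
qed

text \<open>
  The law for \<open>g\<close> multiplied by \<open>J = a\<close>, so that it does not contain \<open>1 / J\<close>, at the coefficient of \<open>\<theta>\<close>.
\<close>

lemma body_chart_connection:
  assumes g: "g \<in> connections m" and w: "w \<in> (im c (cdom c))"
  shows "a w * ciso c (cdom c) (g c) w {0} = a w * a w * ciso c (cdom c) (g (body_chart c f h a)) w {0} + m * deriv a w"
proof -
  let ?U = "cdom c" and ?V = "im c (cdom c)" and ?c = "body_chart c f h a"
  note cc = coords_chart[OF c] and c' = body_chart_jac(1)
  note U = op_dom[OF c]
  have U': "?U \<subseteq> cdom ?c" by (simp add: body_chart_simps)
  have V: "open ?V" using chart_image[OF cc] .
  interpret R: ring "sec X ?U" using U by (rule sec_ring)
  let ?J = "jac X c ?c ?U" and ?k = "cst X ?U (gscalar m)" and ?l = "dlog c ?c ?U"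
  have gc: "g c \<in> carrier (sec X ?U)" "g ?c \<in> carrier (sec X ?U)"
    using conn_closed[OF g c] conn_closed[OF g c'] by (simp_all add: body_chart_simps)
  note [simp] = gc J_closed[OF c c' U order_refl U'] dlog_closed[OF c c' U order_refl U'] scal_closed[OF U]
    D_closed[OF c U order_refl]
  have "g c = (?J \<otimes>[?U] g ?c) \<oplus>[?U] (?k \<otimes>[?U] ?l)"
    using conn_change[OF g c U order_refl c' U'] by (simp add: res_id[OF U] body_chart_simps)
  then have "?J \<otimes>[?U] g c = ?J \<otimes>[?U] ((?J \<otimes>[?U] g ?c) \<oplus>[?U] (?k \<otimes>[?U] ?l))"
    by simp
  also have "\<dots> = (?J \<otimes>[?U] (?J \<otimes>[?U] g ?c)) \<oplus>[?U] (?k \<otimes>[?U] Dc X c ?U ?J)"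
    using even_lcommute[OF U scal_even[OF U, of m], of ?J ?l]
    by (simp add: R.r_distr D_J[OF c c' U order_refl U'])
  finally have "ciso c ?U (?J \<otimes>[?U] g c) w {0} = ciso c ?U ((?J \<otimes>[?U] (?J \<otimes>[?U] g ?c)) \<oplus>[?U] (?k \<otimes>[?U] Dc X c ?U ?J)) w {0}"
    by simp
  then show ?thesis
    using w gscalar_Lam[of m] by (simp add: iso_mult[OF cc U order_refl] iso_add[OF cc U order_refl] body_chart_jac(2)
      iso_Dc[OF cc U order_refl] sfun_D_scalar[OF V a(1)] iso_cst[OF cc U order_refl] grass_part_def)
      (simp add: sfun_restrict_def gmult_scalar_left)
qed

end

text \<open>
  Sections whose coefficients vanish at all monomials \<open>e\<^sub>T\<close> and \<open>\<theta> e\<^sub>T\<close>, \<open>T \<in> Q\<close>. For \<open>Q\<close> closed under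
  subsets they form an ideal that is stable under \<open>D\<close>.
\<close>

definition van :: "('a, 's) chart \<Rightarrow> nat set set \<Rightarrow> 'a set \<Rightarrow> 's set" where
  "van c Q W = {s \<in> carrier (sec X W). \<forall>w T. T - {0} \<in> Q \<longrightarrow> ciso c W s w T = 0}"

text \<open>
  As \<open>g\<close> is odd, its only coefficient without nilpotent constants is that of \<open>\<theta>\<close>. It is killed by the
  change \<open>z' = f(z)\<close>, \<open>\<theta>' = a(z) \<theta>\<close> where \<open>m a' / a\<close> is this coefficient and \<open>f' = a\<^sup>2\<close>. The domain has to be
  shrunk twice: to a disc on which \<open>f\<close> is injective, and then to the preimage of a disc in its image,
  where superfunctions of the new coordinates have primitives again.
\<close>

lemma body_step:
  assumes m: "m \<noteq> 0" and g: "g \<in> connections m" and x: "x \<in> topspace (tsp X)"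
  obtains c where "c \<in> coords X" "x \<in> cdom c" "has_primitives (im c (cdom c))" "g c \<in> van c {{}} (cdom c)"
proof -
  obtain c where c: "c \<in> coords X" "x \<in> cdom c" using coords_cover[OF x] by blast
  note cc = coords_chart[OF c(1)] and U = op_dom[OF c(1)]
  let ?w = "cbody c x"
  have V: "open (im c (cdom c))" "?w \<in> im c (cdom c)" using chart_image[OF cc] c(2) by auto
  then obtain r where r: "r > 0" "ball ?w r \<subseteq> im c (cdom c)" using open_contains_ball by blast
  define \<gamma> where "\<gamma> u = ciso c (cdom c) (g c) u {0} / m" for u
  have "\<gamma> holomorphic_on ball ?w r"
    using holomorphic_on_subset[OF _ r(2)] iso_closed[OF cc U order_refl conn_closed[OF g c(1)]] m
    unfolding \<gamma>_def sfun_carrier_iff by (intro holomorphic_intros) auto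
  then obtain \<Gamma> where \<Gamma>: "\<And>u. u \<in> ball ?w r \<Longrightarrow> (\<Gamma> has_field_derivative \<gamma> u) (at u)"
    using has_primitives_ball[of ?w r] unfolding has_primitives_def by blast
  \<comment> \<open>\<open>a\<close> solves \<open>m a' / a = g\<^sub>1\<close>, where \<open>g = g\<^sub>0 + \<theta> g\<^sub>1\<close> modulo nilpotent constants.\<close>
  define a where "a u = exp (\<Gamma> u)" for u
  have da: "(a has_field_derivative a u * \<gamma> u) (at u)" if "u \<in> ball ?w r" for u
    unfolding a_def using \<Gamma>[OF that] by (auto intro!: derivative_eq_intros)
  have "a holomorphic_on ball ?w r"
    unfolding holomorphic_on_open[OF open_ball] using da by blast
  then have a_hol: "a holomorphic_on ball ?w r" "\<And>u. a u \<noteq> 0"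
    by (simp_all add: a_def)
  obtain f where f: "\<And>u. u \<in> ball ?w r \<Longrightarrow> (f has_field_derivative a u * a u) (at u)"
    using has_primitives_ball[of ?w r] a_hol(1) unfolding has_primitives_def
    by (metis holomorphic_on_mult)
  have f_hol: "f holomorphic_on ball ?w r" unfolding holomorphic_on_open[OF open_ball] using f by blast
  have "deriv f ?w \<noteq> 0" using DERIV_imp_deriv[OF f[of ?w]] r(1) a_hol(2) by simp
  then obtain r' where r': "r' > 0" "ball ?w r' \<subseteq> ball ?w r" "inj_on f (ball ?w r')"
    using has_complex_derivative_locally_injective[OF f_hol _ open_ball, of ?w] r(1) by auto
  define B where "B = ball ?w r'"
  have B: "open B" "?w \<in> B" "B \<subseteq> ball ?w r" using r' by (auto simp: B_def)
  have fB: "f holomorphic_on B" "inj_on f B" using holomorphic_on_subset[OF f_hol B(3)] r'(3) by (auto simp: B_def)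
  obtain h where h: "h holomorphic_on f ` B" "\<And>u. u \<in> B \<Longrightarrow> h (f u) = u"
    using holomorphic_has_inverse[OF fB(1) B(1) fB(2)] by metis
  have aB: "a holomorphic_on B" using holomorphic_on_subset[OF a_hol(1) B(3)] .
  define U1 where "U1 = {y \<in> cdom c. cbody c y \<in> B}"
  have U1: "op U1" "U1 \<subseteq> cdom c" using chart_continuous[OF cc B(1)] by (auto simp: U1_def)
  define c1 where "c1 = c\<lparr>cdom := U1\<rparr>"
  have c1: "c1 \<in> coords X" and gc1: "g c1 = res X (cdom c) U1 (g c)"
    using restrict_chart[OF c(1) U1] g by (auto simp: c1_def)
  have imB: "im c U1 = B" using B(3) r(2) by (auto simp: U1_def)
  have c1s: "cdom c1 = U1" "cbody c1 = cbody c" "ciso c1 = ciso c" "im c1 (cdom c1) = B"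
    using imB by (auto simp: c1_def)
  have dfB: "deriv f u = a u * a u" if "u \<in> B" for u using f that B(3) DERIV_imp_deriv by blast
  define c2 where "c2 = body_chart c1 f h a"
  note body = fB[folded c1s(4)] h[folded c1s(4)] aB[folded c1s(4)] a_hol(2) dfB[folded c1s(4)]
  have c2: "c2 \<in> coords X" unfolding c2_def by (rule body_chart_jac(1)[OF c1 body])
  have c2s: "cdom c2 = U1" "im c2 U1 = f ` B" "ciso c2 U1 s = body_sfun B f h a (ciso c U1 s)" for s
    using c1s imB by (auto simp: c2_def body_chart_def)
  have gc2: "g c2 \<in> part X True U1" "g c2 \<in> carrier (sec X U1)"
    using conn_odd[OF g c2] part_carrier[OF U1(1)] by (auto simp: c2s)
  have theta0: "ciso c U1 (g c2) u {0} = 0" if u: "u \<in> B" for u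
  proof -
    have uc: "u \<in> im c1 (cdom c1)" using u c1s(4) by simp
    have "a u * ciso c U1 (g c1) u {0} = a u * a u * ciso c U1 (g c2) u {0} + m * deriv a u"
      using body_chart_connection[OF c1 body g uc] by (simp add: c1s c2_def)
    moreover have "ciso c U1 (g c1) u {0} = m * \<gamma> u"
      unfolding gc1 iso_res[OF cc U order_refl U1 conn_closed[OF g c(1)]] using u m
      by (simp add: sfun_restrict_def imB \<gamma>_def)
    moreover have "deriv a u = a u * \<gamma> u" using da u B(3) DERIV_imp_deriv by blast
    ultimately show ?thesis using a_hol(2)[of u] by simp
  qed
  have fBo: "open (f ` B)" using open_mapping_thm3[OF fB(1) B(1) fB(2)] by simp
  then obtain \<rho> where \<rho>: "\<rho> > 0" "ball (f ?w) \<rho> \<subseteq> f ` B" using B(2) open_contains_ball by blast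
  define U3 where "U3 = {y \<in> cdom c2. cbody c2 y \<in> ball (f ?w) \<rho>}"
  have U3: "op U3" "U3 \<subseteq> U1" using chart_continuous[OF coords_chart[OF c2], of "ball (f ?w) \<rho>"] by (auto simp: U3_def c2s)
  define c3 where "c3 = c2\<lparr>cdom := U3\<rparr>"
  have c3: "c3 \<in> coords X" and gc3: "g c3 = res X U1 U3 (g c2)"
    using restrict_chart[OF c2, of U3] U3 g by (auto simp: c3_def c2s)
  have c3s: "cdom c3 = U3" "ciso c3 = ciso c2" "cbody c3 = cbody c2" by (auto simp: c3_def)
  have cb2: "cbody c2 = f \<circ> cbody c" by (simp add: c2_def body_chart_def c1s)
  have x3: "x \<in> U3" using c(2) B(2) \<rho>(1) by (auto simp: U3_def c2s U1_def cb2)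
  have im3: "im c3 (cdom c3) = ball (f ?w) \<rho>"
  proof
    show "ball (f ?w) \<rho> \<subseteq> im c3 (cdom c3)"
    proof
      fix u assume u: "u \<in> ball (f ?w) \<rho>"
      then obtain v where "v \<in> im c U1" "u = f v" using \<rho>(2) imB by blast
      then obtain y where "y \<in> U1" "u = cbody c2 y" by (auto simp: cb2)
      then show "u \<in> im c3 (cdom c3)" using u by (auto simp: c3s U3_def c2s)
    qed
  qed (auto simp: c3s U3_def)
  have "ciso c3 U3 (g c3) u T = 0" if T: "T - {0} = {}" for u T
  proof -
    have "ciso c2 U1 (g c2) u T = 0"
    proof (cases "T = {0}")
      case True
      then show ?thesis using theta0 h(2) by (auto simp: c2s body_sfun_def sfun_restrict_def)
    next
      case False
      \<comment> \<open>Here \<open>T = {}\<close>, and an odd superfunction has no body.\<close>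
      then have "T = {}" using T by auto
      moreover have "ciso c2 U1 (g c2) \<in> sfun_part (ngens X) True (im c2 U1)"
        using iso_sfun_part[OF coords_chart[OF c2] U1(1) _ gc2(1)] c2s(1) by simp
      then have "ciso c2 U1 (g c2) u T \<noteq> 0 \<Longrightarrow> odd (card T)"
        unfolding sfun_part_iff by blast
      ultimately show ?thesis by auto
    qed
    then show ?thesis
      using iso_res[OF coords_chart[OF c2] U1(1) _ U3 gc2(2)] by (simp add: c3s gc3 c2s sfun_restrict_def)
  qed
  then have "g c3 \<in> van c3 {{}} (cdom c3)"
    using conn_closed[OF g c3] by (auto simp: van_def c3s)
  then show thesis
    using that[OF c3] x3 has_primitives_ball[of "f ?w" \<rho>] im3 by (simp add: c3s)
qed

section \<open>Killing the nilpotent part of a connection\<close>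

context
  fixes c W assumes c: "is_chart X c" and W: "op W" "W \<subseteq> cdom c"
begin

interpretation R: ring "sec X W" using W(1) by (rule sec_ring)

lemma van_add: "s \<in> van c Q W \<Longrightarrow> t \<in> van c Q W \<Longrightarrow> s \<oplus>[W] t \<in> van c Q W"
  by (auto simp: van_def iso_add[OF c W])

lemma van_minus: "s \<in> van c Q W \<Longrightarrow> t \<in> van c Q W \<Longrightarrow> s \<ominus>[W] t \<in> van c Q W"
  by (auto simp: van_def iso_minus[OF c W])

context
  fixes Q :: "nat set set" assumes down: "\<And>T T'. T \<in> Q \<Longrightarrow> T' \<subseteq> T \<Longrightarrow> T' \<in> Q"
begin

lemma van_mult_right:
  assumes s: "s \<in> van c Q W" and t: "t \<in> carrier (sec X W)" shows "s \<otimes>[W] t \<in> van c Q W"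
proof -
  have "gmult (ciso c W s w) (ciso c W t w) T = 0" if "T - {0} \<in> Q" for w T
    unfolding gmult_eq
  proof (intro sum.neutral ballI)
    fix T' assume "T' \<in> Pow T"
    then have "T' - {0} \<in> Q" by (intro down[OF that]) blast
    then show "gsign T' (T - T') * ciso c W s w T' * ciso c W t w (T - T') = 0" using s by (simp add: van_def)
  qed
  then show ?thesis using s t by (simp add: van_def iso_mult[OF c W])
qed

lemma van_mult_left:
  assumes s: "s \<in> van c Q W" and t: "t \<in> carrier (sec X W)" shows "t \<otimes>[W] s \<in> van c Q W"
proof -
  have "gmult (ciso c W t w) (ciso c W s w) T = 0" if "T - {0} \<in> Q" for w T
    unfolding gmult_eq
  proof (intro sum.neutral ballI)
    fix T' assume "T' \<in> Pow T"
    have "T - T' - {0} \<in> Q" by (rule down[OF that]) blast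
    then show "gsign T' (T - T') * ciso c W t w T' * ciso c W s w (T - T') = 0" using s by (simp add: van_def)
  qed
  then show ?thesis using s t by (simp add: van_def iso_mult[OF c W])
qed

end

lemma van_D: assumes s: "s \<in> van c Q W" shows "Dc X c W s \<in> van c Q W"
proof -
  have sc: "s \<in> carrier (sec X W)" using s by (simp add: van_def)
  have "sfun_D (im c W) (ciso c W s) w T = 0" if T: "T - {0} \<in> Q" for w T
  proof (cases "0 \<in> T")
    case True
    have "ciso c W s u (T - {0}) = 0" for u using s T by (simp add: van_def)
    then show ?thesis using True by (simp add: sfun_D_def sfun_restrict_def)
  next
    case False
    then have "insert 0 T - {0} \<in> Q" using T by simp
    then have "ciso c W s w (insert 0 T) = 0" using s unfolding van_def by blast
    then show ?thesis using False by (simp add: sfun_D_def sfun_restrict_def)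
  qed
  then show ?thesis using Dc_closed[OF c W sc] by (simp add: van_def iso_Dc[OF c W sc])
qed

lemma van_res: "op V \<Longrightarrow> V \<subseteq> W \<Longrightarrow> s \<in> van c Q W \<Longrightarrow> res X W V s \<in> van c Q V"
  using res_closed[OF W(1)] by (auto simp: van_def iso_res[OF c W] sfun_restrict_def)

text \<open>
  The superfunctions vanishing at all \<open>T\<close> that do not contain \<open>S\<close> are the multiples of \<open>e\<^sub>S\<close>, and
  \<open>e\<^sub>S e\<^sub>S = 0\<close>.
\<close>

lemma van_square_zero:
  assumes S: "S \<noteq> {}" "0 \<notin> S" and s: "s \<in> van c {T. \<not> S \<subseteq> T} W" and t: "t \<in> van c {T. \<not> S \<subseteq> T} W"
  shows "s \<otimes>[W] t = \<zero>[W]"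
proof -
  have "gmult (ciso c W s w) (ciso c W t w) T = 0" for w T
    unfolding gmult_eq
  proof (intro sum.neutral ballI)
    fix T' assume "T' \<in> Pow T"
    have "\<not> S \<subseteq> T' - {0} \<or> \<not> S \<subseteq> T - T' - {0}" using S by blast
    moreover have "\<not> S \<subseteq> T' - {0} \<Longrightarrow> ciso c W s w T' = 0" "\<not> S \<subseteq> T - T' - {0} \<Longrightarrow> ciso c W t w (T - T') = 0"
      using s t unfolding van_def by blast+
    ultimately show "gsign T' (T - T') * ciso c W s w T' * ciso c W t w (T - T') = 0"
      by (elim disjE) simp_all
  qed
  then show ?thesis
    using s t by (intro iso_inj[OF c W]) (auto simp: van_def iso_mult[OF c W] iso_zero[OF c W])
qed

end

lemma down_not_superset: "T \<in> {T. \<not> S \<subseteq> T} \<Longrightarrow> T' \<subseteq> T \<Longrightarrow> T' \<in> {T. \<not> S \<subseteq> T}"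
  by blast

lemma D_surj:
  assumes c: "c \<in> coords X" "has_primitives (im c (cdom c))" and s: "s \<in> part X p (cdom c)" "s \<in> van c Q (cdom c)"
  obtains t where "t \<in> part X (\<not> p) (cdom c)" "t \<in> van c Q (cdom c)" "Dc X c (cdom c) t = s"
proof -
  note cc = coords_chart[OF c(1)]
  note U = op_dom[OF c(1)] order_refl[of "cdom c"]
  have sc: "s \<in> carrier (sec X (cdom c))" using s(2) by (simp add: van_def)
  obtain u where u: "u \<in> sfun_part (ngens X) (\<not> p) (im c (cdom c))" "sfun_D (im c (cdom c)) u = ciso c (cdom c) s"
    "\<forall>Q. (\<forall>w T. T - {0} \<in> Q \<longrightarrow> ciso c (cdom c) s w T = 0) \<longrightarrow> (\<forall>w T. T - {0} \<in> Q \<longrightarrow> u w T = 0)"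
    using sfun_D_surj[OF chart_image[OF cc] c(2) iso_sfun_part[OF cc U s(1)]] .
  have uc: "u \<in> carrier (sfun_ring (ngens X) (im c (cdom c)))" using u(1) by (simp add: sfun_part_iff)
  let ?t = "from_chart X c (cdom c) u"
  have t: "?t \<in> carrier (sec X (cdom c))" "ciso c (cdom c) ?t = u"
    using from_closed[OF cc U uc] iso_from[OF cc U uc] by auto
  have "u w T = 0" if "T - {0} \<in> Q" for w T
    using u(3) s(2) that unfolding van_def by blast
  then have "?t \<in> van c Q (cdom c)" using t by (simp add: van_def)
  moreover have "?t \<in> part X (\<not> p) (cdom c)" using from_part[OF cc U u(1)] .
  moreover have "Dc X c (cdom c) ?t = s"
    using t sc Dc_closed[OF cc U t(1)] by (intro iso_inj[OF cc U]) (auto simp: iso_Dc[OF cc U] u(2))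
  ultimately show thesis using that by blast
qed

text \<open>
  The superconformal vector field with Hamiltonian \<open>2k\<close>, an even derivation. For \<open>k\<close> a multiple of a
  single monomial \<open>e\<^sub>S\<close>, products of two of its values vanish, so that \<open>1\<close> minus this derivation is an
  automorphism.
\<close>

definition vf :: "('a, 's) chart \<Rightarrow> 's \<Rightarrow> 'a set \<Rightarrow> 's \<Rightarrow> 's" where
  "vf c k W s = ((res X (cdom c) W k \<oplus>[W] res X (cdom c) W k) \<otimes>[W] Dc X c W (Dc X c W s))
     \<oplus>[W] (Dc X c W (res X (cdom c) W k) \<otimes>[W] Dc X c W s)"

definition nil_chart :: "('a, 's) chart \<Rightarrow> 's \<Rightarrow> ('a, 's) chart" where
  "nil_chart c k = c\<lparr>ciso := \<lambda>W s. ciso c W (s \<ominus>[W] vf c k W s)\<rparr>"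

context
  fixes c k S
  assumes c: "c \<in> coords X" and k: "k \<in> part X False (cdom c)" "k \<in> van c {T. \<not> S \<subseteq> T} (cdom c)"
    and S: "S \<noteq> {}" "0 \<notin> S"
begin

lemma multiple_mult:
  assumes W: "op W" "W \<subseteq> cdom c" and s: "s \<in> van c {T. \<not> S \<subseteq> T} W" and t: "t \<in> carrier (sec X W)"
  shows "s \<otimes>[W] t \<in> van c {T. \<not> S \<subseteq> T} W"
  by (rule van_mult_right[OF coords_chart[OF c] W _ s t]) (erule down_not_superset)

context
  fixes W assumes W: "op W" "W \<subseteq> cdom c"
begin

interpretation R: ring "sec X W" using W(1) by (rule sec_ring)

lemma k_res:
  "res X (cdom c) W k \<in> part X False W"
  "res X (cdom c) W k \<in> van c {T. \<not> S \<subseteq> T} W"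
  "res X (cdom c) W k \<in> carrier (sec X W)"
  using res_part[OF op_dom[OF c] W k(1)] van_res[OF coords_chart[OF c] op_dom[OF c] order_refl W k(2)] part_carrier[OF W(1)]
  by auto

lemma D_k_res:
  "Dc X c W (res X (cdom c) W k) \<in> part X True W"
  "Dc X c W (res X (cdom c) W k) \<in> van c {T. \<not> S \<subseteq> T} W"
  "Dc X c W (res X (cdom c) W k) \<in> carrier (sec X W)"
  using Dc_part[OF coords_chart[OF c] W k_res(1)] van_D[OF coords_chart[OF c] W k_res(2)] part_carrier[OF W(1)] by auto

lemma two_k_res:
  "res X (cdom c) W k \<oplus>[W] res X (cdom c) W k \<in> part X False W"
  "res X (cdom c) W k \<oplus>[W] res X (cdom c) W k \<in> van c {T. \<not> S \<subseteq> T} W"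
  "res X (cdom c) W k \<oplus>[W] res X (cdom c) W k \<in> carrier (sec X W)"
  using part_add[OF W(1) k_res(1) k_res(1)] van_add[OF coords_chart[OF c] W k_res(2) k_res(2)] k_res(3) by auto

lemma vf_closed: "s \<in> carrier (sec X W) \<Longrightarrow> vf c k W s \<in> carrier (sec X W)"
  using two_k_res(3) D_k_res(3) D_closed[OF c W] by (simp add: vf_def)

lemma vf_add: "s \<in> carrier (sec X W) \<Longrightarrow> t \<in> carrier (sec X W) \<Longrightarrow> vf c k W (s \<oplus>[W] t) = vf c k W s \<oplus>[W] vf c k W t"
  using two_k_res(3) D_k_res(3) D_closed[OF c W] by (simp add: vf_def Dc_add[OF coords_chart[OF c] W] R.r_distr R.a_ac)

lemma vf_N: "s \<in> carrier (sec X W) \<Longrightarrow> vf c k W s \<in> van c {T. \<not> S \<subseteq> T} W"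
  unfolding vf_def
  by (rule van_add[OF coords_chart[OF c] W multiple_mult[OF W two_k_res(2)] multiple_mult[OF W D_k_res(2)]])
     (simp_all add: D_closed[OF c W])

lemma vf_van:
  assumes down: "\<And>T T'. T \<in> Q \<Longrightarrow> T' \<subseteq> T \<Longrightarrow> T' \<in> Q" and s: "s \<in> van c Q W"
  shows "vf c k W s \<in> van c Q W"
  unfolding vf_def
  by (intro van_add[OF coords_chart[OF c] W] van_mult_left[OF coords_chart[OF c] W down] van_D[OF coords_chart[OF c] W] s two_k_res(3) D_k_res(3))

lemma vf_zero_on_N: "s \<in> van c {T. \<not> S \<subseteq> T} W \<Longrightarrow> vf c k W s = \<zero>[W]"
  unfolding vf_def using van_square_zero[OF coords_chart[OF c] W S] two_k_res(2) D_k_res(2) van_D[OF coords_chart[OF c] W] by simp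

lemma vf_part:
  assumes s: "s \<in> part X p W" shows "vf c k W s \<in> part X p W"
proof -
  have Ds: "Dc X c W s \<in> part X (\<not> p) W" using Dc_part[OF coords_chart[OF c] W s] .
  have DDs: "Dc X c W (Dc X c W s) \<in> part X p W" using Dc_part[OF coords_chart[OF c] W Ds] by simp
  show ?thesis
    unfolding vf_def using part_mult[OF W(1) D_k_res(1) Ds] part_mult_even[OF W(1) two_k_res(1) DDs]
    by (intro part_add[OF W(1)]) simp_all
qed

lemma vf_cst: "a \<in> carrier (Lam X) \<Longrightarrow> vf c k W (cst X W a) = \<zero>[W]"
  using two_k_res(3) D_k_res(3) by (simp add: vf_def Dc_cst[OF coords_chart[OF c] W] Dc_zero[OF coords_chart[OF c] W])

text \<open>
  \<open>D\<^sup>2 = \<partial>\<^sub>z\<close> is an even derivation, and in \<open>(D k) D\<close> the sign that \<open>D\<close> produces in passing the first factor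
  is cancelled by the one of the odd \<open>D k\<close>.
\<close>

lemma vf_mult_homogeneous:
  assumes s: "s \<in> part X p W" and t: "t \<in> carrier (sec X W)"
  shows "vf c k W (s \<otimes>[W] t) = (vf c k W s \<otimes>[W] t) \<oplus>[W] (s \<otimes>[W] vf c k W t)"
proof -
  let ?k = "res X (cdom c) W k" and ?D = "Dc X c W"
  note sc = part_carrier[OF W(1) s] and Ds = Dc_part[OF coords_chart[OF c] W s]
  note [simp] = sc t two_k_res(3) k_res(3) D_k_res(3) D_closed[OF c W]
  have comm: "(?k \<oplus>[W] ?k) \<otimes>[W] (s \<otimes>[W] ?D (?D t)) = s \<otimes>[W] ((?k \<oplus>[W] ?k) \<otimes>[W] ?D (?D t))"
    using even_lcommute[OF W(1) two_k_res(1), of s "?D (?D t)"] by simp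
  have cancel: "x \<oplus>[W] (y \<oplus>[W] (\<ominus>[W] x)) = y" if "x \<in> carrier (sec X W)" "y \<in> carrier (sec X W)" for x y
    using that by (simp add: R.a_lcomm[of x y] R.r_neg)
  have DD: "?D (?D (s \<otimes>[W] t)) = (?D (?D s) \<otimes>[W] t) \<oplus>[W] (s \<otimes>[W] ?D (?D t))"
    using Dc_mult[OF coords_chart[OF c] W s t] Dc_mult[OF coords_chart[OF c] W Ds t] Dc_mult[OF coords_chart[OF c] W s, of "?D t"]
    by (cases p) (simp_all add: Dc_add[OF coords_chart[OF c] W] Dc_uminus[OF coords_chart[OF c] W] R.minus_eq R.minus_add R.a_ac R.r_neg1 R.r_neg2 R.r_neg cancel)
  have Dk: "?D ?k \<otimes>[W] ?D (s \<otimes>[W] t) = (?D ?k \<otimes>[W] ?D s \<otimes>[W] t) \<oplus>[W] (s \<otimes>[W] (?D ?k \<otimes>[W] ?D t))"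
  proof -
    have "?D ?k \<otimes>[W] s = (if p then \<ominus>[W] (s \<otimes>[W] ?D ?k) else s \<otimes>[W] ?D ?k)"
      using part_commute[OF W(1) D_k_res(1) s] by simp
    then have "?D ?k \<otimes>[W] (s \<otimes>[W] ?D t) = (if p then \<ominus>[W] (s \<otimes>[W] (?D ?k \<otimes>[W] ?D t)) else s \<otimes>[W] (?D ?k \<otimes>[W] ?D t))"
      by (simp add: R.m_assoc[symmetric] R.l_minus)
    then show ?thesis
      using Dc_mult[OF coords_chart[OF c] W s t] by (cases p) (simp_all add: R.r_distr R.minus_eq R.r_minus R.m_assoc)
  qed
  show ?thesis
    unfolding vf_def DD Dk using comm by (simp add: R.r_distr R.l_distr R.m_assoc R.a_ac)
qed

lemma vf_mult:
  assumes s: "s \<in> carrier (sec X W)" and t: "t \<in> carrier (sec X W)"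
  shows "vf c k W (s \<otimes>[W] t) = (vf c k W s \<otimes>[W] t) \<oplus>[W] (s \<otimes>[W] vf c k W t)"
proof -
  obtain u v where uv: "u \<in> part X False W" "v \<in> part X True W" "s = u \<oplus>[W] v"
    using part_decompose[OF W(1) s] .
  note [simp] = part_carrier[OF W(1) uv(1)] part_carrier[OF W(1) uv(2)] t vf_closed
  show ?thesis
    unfolding uv(3) by (simp add: R.l_distr vf_add vf_mult_homogeneous[OF uv(1) t] vf_mult_homogeneous[OF uv(2) t] R.a_ac)
qed

end

lemma vf_res:
  assumes W: "op W" "W \<subseteq> cdom c" and V: "op V" "V \<subseteq> W" and s: "s \<in> carrier (sec X W)"
  shows "vf c k V (res X W V s) = res X W V (vf c k W s)"
proof -
  interpret R: ring "sec X W" using W(1) by (rule sec_ring)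
  have kc: "k \<in> carrier (sec X (cdom c))" using part_carrier[OF op_dom[OF c] k(1)] .
  have "Dc X c W s \<in> carrier (sec X W)" using D_closed[OF c W s] .
  then show ?thesis
    using s k_res(3)[OF W] D_closed[OF c W] res_res[OF op_dom[OF c] W V kc]
    by (simp add: vf_def res_add[OF W(1) V] res_mult[OF W(1) V] Dc_res[OF coords_chart[OF c] W V])
qed

text \<open>
  Write \<open>v\<close> for the derivation. Then \<open>1 - v\<close> is multiplicative because \<open>v(s) v(t) = 0\<close>, and \<open>1 + v\<close> is its
  inverse because \<open>v(v(s)) = 0\<close>.
\<close>

lemma nil_chart: "is_chart X (nil_chart c k)"
  unfolding nil_chart_def
proof (rule automorphism_chart[OF coords_chart[OF c]])
  fix W assume W: "op W" "W \<subseteq> cdom c"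
  interpret R: ring "sec X W" using W(1) by (rule sec_ring)
  note [simp] = vf_closed[OF W]
  have one: "vf c k W \<one>[W] = \<zero>[W]"
    using vf_cst[OF W, of "gscalar 1"] gscalar_Lam[of 1] by (simp add: cst_one[OF W(1)] grass_part_def)
  have sq: "vf c k W s \<otimes>[W] vf c k W t = \<zero>[W]" if "s \<in> carrier (sec X W)" "t \<in> carrier (sec X W)" for s t
    using van_square_zero[OF coords_chart[OF c] W S vf_N[OF W] vf_N[OF W]] that by simp
  have vv: "vf c k W (vf c k W s) = \<zero>[W]" if "s \<in> carrier (sec X W)" for s
    using vf_zero_on_N[OF W vf_N[OF W that]] .
  have neg: "vf c k W (\<ominus>[W] s) = \<ominus>[W] vf c k W s" if s: "s \<in> carrier (sec X W)" for s
  proof -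
    have "vf c k W (\<ominus>[W] s) \<oplus>[W] vf c k W s = vf c k W \<zero>[W]"
      using vf_add[OF W, of "\<ominus>[W] s" s] s by (simp add: R.l_neg)
    also have "vf c k W \<zero>[W] = \<zero>[W]"
      using vf_mult[OF W, of "\<zero>[W]" "\<zero>[W]"] by simp
    finally show ?thesis using s by (intro R.minus_equality[symmetric]) auto
  qed
  show "(\<lambda>s. s \<ominus>[W] vf c k W s) \<in> ring_hom (sec X W) (sec X W)"
  proof (rule ring_hom_memI)
    fix s t assume st: "s \<in> carrier (sec X W)" "t \<in> carrier (sec X W)"
    have "(s \<ominus>[W] vf c k W s) \<otimes>[W] (t \<ominus>[W] vf c k W t) =
        ((s \<otimes>[W] t) \<ominus>[W] (s \<otimes>[W] vf c k W t)) \<ominus>[W] (vf c k W s \<otimes>[W] t)"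
      using st by (simp add: R.minus_eq R.l_distr R.r_distr R.l_minus R.r_minus sq R.a_ac)
    then show "s \<otimes>[W] t \<ominus>[W] vf c k W (s \<otimes>[W] t) = (s \<ominus>[W] vf c k W s) \<otimes>[W] (t \<ominus>[W] vf c k W t)"
      using st by (simp add: vf_mult[OF W] R.minus_eq R.minus_add R.a_ac)
    show "s \<oplus>[W] t \<ominus>[W] vf c k W (s \<oplus>[W] t) = (s \<ominus>[W] vf c k W s) \<oplus>[W] (t \<ominus>[W] vf c k W t)"
      using st by (simp add: vf_add[OF W] R.minus_eq R.minus_add R.a_ac)
  qed (simp_all add: one R.minus_eq)
  show "bij_betw (\<lambda>s. s \<ominus>[W] vf c k W s) (carrier (sec X W)) (carrier (sec X W))"
    by (rule bij_betw_byWitness[where f' = "\<lambda>s. s \<oplus>[W] vf c k W s"])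
      (auto simp: vf_add[OF W] neg vv R.minus_eq R.a_assoc R.l_neg R.r_neg)
  show "s \<in> part X p W \<Longrightarrow> s \<ominus>[W] vf c k W s \<in> part X p W" for p s
    using vf_part[OF W] by (intro part_minus[OF W(1)]) auto
  show "a \<in> carrier (Lam X) \<Longrightarrow> cst X W a \<ominus>[W] vf c k W (cst X W a) = cst X W a" for a
    using cst_closed[OF W(1)] by (simp add: vf_cst[OF W] R.minus_eq)
  fix V s assume V: "op V" "V \<subseteq> W" and s: "s \<in> carrier (sec X W)"
  show "res X W V s \<ominus>[V] vf c k V (res X W V s) = res X W V (s \<ominus>[W] vf c k W s)"
    using s by (simp add: res_minus[OF W(1) V] vf_res[OF W V])
qed

end


lemma nil_chart_simps: "cdom (nil_chart c k) = cdom c" "im (nil_chart c k) W = im c W"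
  "ciso (nil_chart c k) W s = ciso c W (s \<ominus>[W] vf c k W s)"
  by (simp_all add: nil_chart_def)

context
  fixes c k S
  assumes c: "c \<in> coords X" and k: "k \<in> part X False (cdom c)" "k \<in> van c {T. \<not> S \<subseteq> T} (cdom c)"
    and S: "S \<noteq> {}" "0 \<notin> S"
begin

interpretation R: ring "sec X (cdom c)" using op_dom[OF c] by (rule sec_ring)

text \<open>
  The new coordinates are \<open>z + 2k + (D k) \<theta>\<close> and \<open>\<theta> + D k\<close>, the images of the old ones under \<open>1 + v\<close>.
  Products of two among \<open>D k\<close>, \<open>D\<^sup>2 k\<close>, \<open>D\<^sup>3 k\<close> vanish, which makes all formulas linear in \<open>k\<close>.
\<close>

lemma nil_chart_change:
  defines "E \<equiv> Dc X c (cdom c) (Dc X c (cdom c) k)"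
  shows "nil_chart c k \<in> coords X" "jac X c (nil_chart c k) (cdom c) = \<one>[cdom c] \<oplus>[cdom c] E"
    "(\<one>[cdom c] \<ominus>[cdom c] E) \<otimes>[cdom c] (\<one>[cdom c] \<oplus>[cdom c] E) = \<one>[cdom c]"
    "dlog c (nil_chart c k) (cdom c) = Dc X c (cdom c) E"
proof -
  let ?U = "cdom c" and ?c = "nil_chart c k"
  let ?D = "Dc X c ?U" and ?th = "thetac X c ?U" and ?z = "zc X c ?U"
  note cc = coords_chart[OF c] and c' = nil_chart[OF c k S]
  have U: "op ?U" "?U \<subseteq> ?U" "?U \<subseteq> cdom ?c" using op_dom[OF c] by (simp_all add: nil_chart_simps)
  note th = thetac_part[OF cc U(1,2)] and z = zc_part[OF cc U(1,2)]
  have kc: "k \<in> carrier (sec X ?U)" using part_carrier[OF U(1) k(1)] .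
  have Dk: "?D k \<in> part X True ?U" using Dc_part[OF cc U(1,2) k(1)] by simp
  have E: "E \<in> part X False ?U" unfolding E_def using Dc_part[OF cc U(1,2) Dk] by simp
  have N: "?D k \<in> van c {T. \<not> S \<subseteq> T} ?U" "E \<in> van c {T. \<not> S \<subseteq> T} ?U" "?D E \<in> van c {T. \<not> S \<subseteq> T} ?U"
    unfolding E_def using van_D[OF cc U(1,2)] k(2) by auto
  note sq = van_square_zero[OF cc U(1,2) S]
  note [simp] = kc part_carrier[OF U(1) Dk] part_carrier[OF U(1) E] part_carrier[OF U(1) th]
    part_carrier[OF U(1) z] Dc_closed[OF cc U(1,2)] sq[OF N(2,2)] sq[OF N(1,2)] sq[OF N(2,3)]
  have E': "?D (?D k) = E" by (simp add: E_def)
  have kk: "res X ?U ?U k = k" using res_id[OF U(1) kc] .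
  have v_th: "vf c k ?U ?th = ?D k" and v_z: "vf c k ?U ?z = (k \<oplus>[?U] k) \<oplus>[?U] (?D k \<otimes>[?U] ?th)"
    by (simp_all add: vf_def kk Dc_thetac[OF cc U(1,2)] Dc_one[OF cc U(1,2)] Dc_zc[OF cc U(1,2)])
  have inverse: "ciso ?c ?U (s \<oplus>[?U] vf c k ?U s) = ciso c ?U s" if s: "s \<in> carrier (sec X ?U)" for s
  proof -
    note v = vf_closed[OF c k S U(1,2) s]
    have "vf c k ?U (vf c k ?U s) = \<zero>[?U]"
      using vf_zero_on_N[OF c k S U(1,2) vf_N[OF c k S U(1,2) s]] .
    then have "(s \<oplus>[?U] vf c k ?U s) \<ominus>[?U] vf c k ?U (s \<oplus>[?U] vf c k ?U s) = s"
      using s v by (simp add: vf_add[OF c k S U(1,2)] R.minus_eq R.a_assoc R.r_neg)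
    then show ?thesis by (simp add: nil_chart_simps)
  qed
  have thc: "thetac X ?c ?U = ?th \<oplus>[?U] ?D k"
    using inverse[of ?th] iso_thetac[OF cc U(1,2)]
    by (intro thetac_eqI[OF c' U(1,3)]) (simp_all add: v_th nil_chart_simps)
  have zcc: "zc X ?c ?U = ?z \<oplus>[?U] ((k \<oplus>[?U] k) \<oplus>[?U] (?D k \<otimes>[?U] ?th))"
    using inverse[of ?z] iso_zc[OF cc U(1,2)]
    by (intro zc_eqI[OF c' U(1,3)]) (simp_all add: v_z nil_chart_simps)
  show J: "jac X c ?c ?U = \<one>[?U] \<oplus>[?U] E"
    by (simp add: jac_def thc Dc_add[OF cc U(1,2)] Dc_thetac[OF cc U(1,2)] E')
  have "?D (zc X ?c ?U) = ?th \<oplus>[?U] (?D k \<oplus>[?U] (E \<otimes>[?U] ?th))"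
    by (simp add: zcc Dc_add[OF cc U(1,2)] Dc_zc[OF cc U(1,2)] Dc_mult_odd[OF cc U(1,2) Dk] E' Dc_thetac[OF cc U(1,2)]
      R.minus_eq R.a_assoc R.a_comm[of "E \<otimes>[?U] ?th"] R.r_neg1 R.r_neg2 R.r_neg)
  also have "\<dots> = thetac X ?c ?U \<otimes>[?U] jac X c ?c ?U"
    unfolding J thc even_commute[OF U(1) E part_carrier[OF U(1) th]]
    by (simp add: R.l_distr R.r_distr R.a_ac)
  finally have sc: "superconformal_change X c ?c"
    by (simp add: superconformal_change_def Let_def nil_chart_simps jac_def)
  show c'_coords: "?c \<in> coords X"
    using coordsI[OF c c'] sc by (simp add: nil_chart_simps)
  show inv: "(\<one>[?U] \<ominus>[?U] E) \<otimes>[?U] (\<one>[?U] \<oplus>[?U] E) = \<one>[?U]"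
    by (simp add: R.minus_eq R.l_distr R.r_distr R.l_minus R.a_assoc R.l_neg R.r_neg)
  have "?D E = (\<one>[?U] \<oplus>[?U] E) \<otimes>[?U] dlog c ?c ?U"
    using D_J[OF c c'_coords U] by (simp add: J Dc_add[OF cc U(1,2)] Dc_one[OF cc U(1,2)])
  then have "(\<one>[?U] \<ominus>[?U] E) \<otimes>[?U] ?D E = (\<one>[?U] \<ominus>[?U] E) \<otimes>[?U] ((\<one>[?U] \<oplus>[?U] E) \<otimes>[?U] dlog c ?c ?U)"
    by simp
  also have "\<dots> = dlog c ?c ?U"
    using dlog_closed[OF c c'_coords U] by (simp add: R.m_assoc[symmetric] inv)
  finally show "dlog c ?c ?U = ?D E"
    by (simp add: R.minus_eq R.l_distr R.l_minus)
qed

text \<open>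
  With \<open>E = D\<^sup>2 k\<close>, the law for \<open>g\<close> gives \<open>(1 - E) (g\<^sub>c - m D E)\<close> for the new connection coefficient, and
  neither the factor \<open>1 - E\<close> nor the automorphism leads out of the ideal.
\<close>

lemma nil_chart_connection:
  assumes g: "g \<in> connections m" and down: "\<And>T T'. T \<in> Q \<Longrightarrow> T' \<subseteq> T \<Longrightarrow> T' \<in> Q"
    and x: "g c \<ominus>[cdom c] (cst X (cdom c) (gscalar m) \<otimes>[cdom c]
      Dc X c (cdom c) (Dc X c (cdom c) (Dc X c (cdom c) k))) \<in> van c Q (cdom c)" (is "?x \<in> _")
  shows "g (nil_chart c k) \<in> van (nil_chart c k) Q (cdom c)"
proof -
  let ?U = "cdom c" and ?c = "nil_chart c k"
  let ?E = "Dc X c (cdom c) (Dc X c (cdom c) k)"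
  note cc = coords_chart[OF c] and ch = nil_chart_change
  have U: "op ?U" "?U \<subseteq> ?U" "?U \<subseteq> cdom ?c" using op_dom[OF c] by (simp_all add: nil_chart_simps)
  have kc: "k \<in> carrier (sec X ?U)" using part_carrier[OF U(1) k(1)] .
  have gc: "g c \<in> carrier (sec X ?U)" "g ?c \<in> carrier (sec X ?U)"
    using conn_closed[OF g c] conn_closed[OF g ch(1)] by (simp_all add: nil_chart_simps)
  note [simp] = kc gc Dc_closed[OF cc U(1,2)] scal_closed[OF U(1)]
  have "g c = ((\<one>[?U] \<oplus>[?U] ?E) \<otimes>[?U] g ?c) \<oplus>[?U] (cst X ?U (gscalar m) \<otimes>[?U] Dc X c ?U ?E)"
    using conn_change[OF g c U(1,2) ch(1) U(3)] by (simp add: res_id[OF U(1)] nil_chart_simps ch(2,4))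
  then have "?x = (\<one>[?U] \<oplus>[?U] ?E) \<otimes>[?U] g ?c"
    by (simp add: R.minus_eq R.a_assoc R.r_neg)
  then have "(\<one>[?U] \<ominus>[?U] ?E) \<otimes>[?U] ?x = g ?c"
    by (simp add: R.m_assoc[symmetric] ch(3))
  moreover have "(\<one>[?U] \<ominus>[?U] ?E) \<otimes>[?U] ?x \<in> van c Q ?U"
    by (rule van_mult_left[OF cc U(1,2) down x]) simp_all
  ultimately have v: "g ?c \<in> van c Q ?U" by simp
  have "g ?c \<ominus>[?U] vf c k ?U (g ?c) \<in> van c Q ?U"
    by (rule van_minus[OF cc U(1,2) v vf_van[OF c k S U(1,2) down v]])
  then show ?thesis by (simp add: van_def nil_chart_simps)
qed

end

text \<open>
  The element \<open>r\<close> is the part of \<open>s\<close> belonging to \<open>e\<^sub>S\<close> and \<open>\<theta> e\<^sub>S\<close>, divided by \<open>m\<close>.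
\<close>

lemma monomial_part:
  assumes c: "c \<in> coords X" and m: "m \<noteq> 0" and s: "s \<in> part X p (cdom c)"
  obtains r where "r \<in> part X p (cdom c)" "r \<in> van c {T. \<not> S \<subseteq> T} (cdom c)"
    "\<And>Q. s \<in> van c Q (cdom c) \<Longrightarrow> s \<ominus>[cdom c] (cst X (cdom c) (gscalar m) \<otimes>[cdom c] r) \<in> van c (insert S Q) (cdom c)"
proof -
  let ?U = "cdom c"
  note cc = coords_chart[OF c] and U = op_dom[OF c] order_refl[of "cdom c"]
  interpret R: ring "sec X ?U" using U(1) by (rule sec_ring)
  have sc: "s \<in> carrier (sec X ?U)" using part_carrier[OF U(1) s] .
  note sp = iso_sfun_part[OF cc U s]
  define f where "f w T = (if T - {0} = S then ciso c ?U s w T / m else 0)" for w T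
  have nz: "f w T \<noteq> 0 \<Longrightarrow> ciso c ?U s w T \<noteq> 0" for w T by (auto simp: f_def split: if_splits)
  have "(\<lambda>w. f w T) holomorphic_on im c ?U" for T
    using iso_closed[OF cc U sc] m unfolding f_def sfun_carrier_iff
    by (cases "T - {0} = S") (auto intro!: holomorphic_intros)
  then have f: "f \<in> sfun_part (ngens X) p (im c ?U)"
    using nz sp unfolding sfun_part_iff sfun_carrier_iff by blast
  then have fc: "f \<in> carrier (sfun_ring (ngens X) (im c ?U))" by (simp add: sfun_part_iff)
  define r where "r = from_chart X c ?U f"
  have r: "r \<in> carrier (sec X ?U)" "ciso c ?U r = f"
    using from_closed[OF cc U fc] iso_from[OF cc U fc] by (auto simp: r_def)
  show thesis
  proof (rule that)
    show "r \<in> part X p ?U" unfolding r_def using from_part[OF cc U f] .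
    show "r \<in> van c {T. \<not> S \<subseteq> T} ?U" using r by (auto simp: van_def f_def)
    fix Q assume sQ: "s \<in> van c Q ?U"
    note km = scal_closed[OF U(1), of m]
    have "gmult (sfun_restrict (im c ?U) (\<lambda>w. gscalar m) w) (f w) T = m * f w T" for w T
    proof (cases "w \<in> im c ?U")
      case True
      then show ?thesis
        using sfun_infinite[OF fc, of T w] by (cases "finite T") (simp_all add: sfun_restrict_def gmult_scalar_left gmult_infinite)
    next
      case False
      then show ?thesis using sfun_outside[OF fc False] by (simp add: sfun_restrict_def)
    qed
    then have "ciso c ?U (cst X ?U (gscalar m) \<otimes>[?U] r) w T = m * f w T" for w T
      using iso_cst[OF cc U, of "gscalar m"] gscalar_Lam[of m]
      by (simp add: iso_mult[OF cc U km r(1)] r(2) grass_part_def)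
    then show "s \<ominus>[?U] (cst X ?U (gscalar m) \<otimes>[?U] r) \<in> van c (insert S Q) ?U"
      using sQ sc r(1) km m by (simp add: van_def iso_minus[OF cc U]) (simp add: f_def)
  qed
qed

text \<open>
  The Hamiltonian \<open>k\<close> is obtained by integrating three times, because \<open>m D\<^sup>3 k\<close> has to be the part of \<open>g\<close>
  to be killed.
\<close>

lemma nil_step:
  assumes m: "m \<noteq> 0" and g: "g \<in> connections m"
    and c: "c \<in> coords X" "has_primitives (im c (cdom c))" "g c \<in> van c Q (cdom c)"
    and S: "S \<noteq> {}" "0 \<notin> S" and down: "\<And>T T'. T \<in> insert S Q \<Longrightarrow> T' \<subseteq> T \<Longrightarrow> T' \<in> insert S Q"
  obtains c' where "c' \<in> coords X" "cdom c' = cdom c" "im c' (cdom c) = im c (cdom c)"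
    "g c' \<in> van c' (insert S Q) (cdom c)"
proof -
  obtain r where r: "r \<in> part X True (cdom c)" "r \<in> van c {T. \<not> S \<subseteq> T} (cdom c)"
    "g c \<ominus>[cdom c] (cst X (cdom c) (gscalar m) \<otimes>[cdom c] r) \<in> van c (insert S Q) (cdom c)"
    using monomial_part[OF c(1) m conn_odd[OF g c(1)], of S] c(3) by metis
  obtain t where t: "t \<in> part X False (cdom c)" "t \<in> van c {T. \<not> S \<subseteq> T} (cdom c)" "Dc X c (cdom c) t = r"
    using D_surj[OF c(1,2) r(1,2)] by auto
  obtain u where u: "u \<in> part X True (cdom c)" "u \<in> van c {T. \<not> S \<subseteq> T} (cdom c)" "Dc X c (cdom c) u = t"
    using D_surj[OF c(1,2) t(1,2)] by auto
  obtain k where k: "k \<in> part X False (cdom c)" "k \<in> van c {T. \<not> S \<subseteq> T} (cdom c)" "Dc X c (cdom c) k = u"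
    using D_surj[OF c(1,2) u(1,2)] by auto
  show thesis
  proof (rule that)
    show "nil_chart c k \<in> coords X" using nil_chart_change(1)[OF c(1) k(1,2) S] .
    show "g (nil_chart c k) \<in> van (nil_chart c k) (insert S Q) (cdom c)"
      using r(3) by (intro nil_chart_connection[OF c(1) k(1,2) S g down]) (simp_all add: k(3) u(3) t(3))
  qed (simp_all add: nil_chart_def)
qed

text \<open>
  The monomials are killed in an order in which every \<open>S\<close> comes after its proper subsets; then the set
  \<open>Q\<close> of treated monomials is closed under subsets, and a step does not disturb what has been achieved.
\<close>

lemma nil_steps:
  assumes m: "m \<noteq> 0" and g: "g \<in> connections m"
    and c: "c \<in> coords X" "has_primitives (im c (cdom c))" "g c \<in> van c Q (cdom c)"
    and Q: "Q \<subseteq> Pow {1..ngens X}" "{} \<in> Q" "\<And>T T'. T \<in> Q \<Longrightarrow> T' \<subseteq> T \<Longrightarrow> T' \<in> Q"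
  shows "\<exists>c'\<in>coords X. cdom c' = cdom c \<and> g c' = \<zero>[cdom c]"
  using c Q
proof (induction "card (Pow {1..ngens X} - Q)" arbitrary: c Q rule: less_induct)
  case less
  note c = less.prems(1-3) and Q = less.prems(4-6)
  show ?case
  proof (cases "Q = Pow {1..ngens X}")
    case True
    note cc = coords_chart[OF c(1)] and U = op_dom[OF c(1)] order_refl[of "cdom c"]
    interpret R: ring "sec X (cdom c)" using U(1) by (rule sec_ring)
    note gc = conn_closed[OF g c(1)]
    have "ciso c (cdom c) (g c) w T = 0" for w T
    proof (cases "T \<subseteq> {..ngens X}")
      case True
      then have "T - {0} \<in> Q" using \<open>Q = _\<close> by (auto simp: Suc_le_eq)
      then show ?thesis using c(3) by (simp add: van_def)
    next
      case False
      then show ?thesis using iso_closed[OF cc U gc] unfolding sfun_carrier_iff by blast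
    qed
    then have "g c = \<zero>[cdom c]"
      using gc by (intro iso_inj[OF cc U]) (auto simp: iso_zero[OF cc U])
    then show ?thesis using c(1) by blast
  next
    case False
    then have "Pow {1..ngens X} - Q \<noteq> {}" using Q(1) by auto
    then obtain S' where "S' \<in> Pow {1..ngens X} - Q" by blast
    from ex_has_least_nat[where P = "\<lambda>T. T \<in> Pow {1..ngens X} - Q", OF this, of card]
    obtain S where S: "S \<in> Pow {1..ngens X} - Q" "\<And>T. T \<in> Pow {1..ngens X} - Q \<Longrightarrow> card S \<le> card T"
      by blast
    have fin: "finite S" using S(1) finite_subset[of S "{1..ngens X}"] by auto
    have sub: "T \<in> Q" if "T \<subset> S" for T
      using S(2)[of T] psubset_card_mono[OF fin that] S(1) that by force
    have S0: "S \<noteq> {}" "0 \<notin> S" using S(1) Q(2) by auto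
    have down: "T' \<in> insert S Q" if "T \<in> insert S Q" "T' \<subseteq> T" for T T'
      using that sub[of T'] Q(3)[of T T'] by auto
    obtain c' where c': "c' \<in> coords X" "cdom c' = cdom c" "im c' (cdom c) = im c (cdom c)"
      "g c' \<in> van c' (insert S Q) (cdom c)"
    proof (rule nil_step[OF m g c S0])
      fix T T' assume "T \<in> insert S Q" "T' \<subseteq> T"
      then show "T' \<in> insert S Q" by (rule down)
    qed
    have "card (Pow {1..ngens X} - insert S Q) < card (Pow {1..ngens X} - Q)"
      using S(1) by (intro psubset_card_mono) auto
    then have "\<exists>c''\<in>coords X. cdom c'' = cdom c' \<and> g c'' = \<zero>[cdom c']"
      using c c' S(1) Q down by (intro less.hyps[of "insert S Q" c']) auto
    then show ?thesis using c'(2) by simp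
  qed
qed

lemma flat_chart:
  assumes m: "m \<noteq> 0" and g: "g \<in> connections m" and x: "x \<in> topspace (tsp X)"
  obtains c where "c \<in> coords X" "x \<in> cdom c" "g c = \<zero>[cdom c]"
proof -
  obtain c where c: "c \<in> coords X" "x \<in> cdom c" "has_primitives (im c (cdom c))" "g c \<in> van c {{}} (cdom c)"
    using body_step[OF m g x] .
  have "\<exists>c'\<in>coords X. cdom c' = cdom c \<and> g c' = \<zero>[cdom c]"
    by (rule nil_steps[OF m g c(1,3,4)]) auto
  then obtain c' where "c' \<in> coords X" "cdom c' = cdom c" "g c' = \<zero>[cdom c]" by blast
  then show thesis using c(2) by (intro that[of c']) simp_all
qed


section \<open>Affine structures\<close>

lemma Lam_mult_closed:
  assumes "a \<in> carrier (Lam X)" "b \<in> carrier (Lam X)" shows "a \<otimes>\<^bsub>Lam X\<^esub> b \<in> carrier (Lam X)"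
proof -
  have "S \<subseteq> {1..ngens X}" if nz: "gmult a b S \<noteq> 0" for S
  proof -
    obtain T where "T \<in> Pow S" "gsign T (S - T) * a T * b (S - T) \<noteq> 0"
      using nz unfolding gmult_eq by (rule sum.not_neutral_contains_not_neutral)
    then have "a T \<noteq> 0" "b (S - T) \<noteq> 0" by auto
    then have "T \<subseteq> {1..ngens X}" "S - T \<subseteq> {1..ngens X}"
      using assms by (auto simp: grassmann_def simp del: One_nat_def)
    then show ?thesis by blast
  qed
  then show ?thesis by (simp add: grassmann_def)
qed

lemma Lam_part_carrier: "a \<in> Lam_part X p \<Longrightarrow> a \<in> carrier (Lam X)"
  by (simp add: grass_part_def)

lemma cst_mult:
  "op W \<Longrightarrow> a \<in> carrier (Lam X) \<Longrightarrow> b \<in> carrier (Lam X) \<Longrightarrow>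
     cst X W (a \<otimes>\<^bsub>Lam X\<^esub> b) = cst X W a \<otimes>[W] cst X W b"
  using ring_hom_mult[OF cst_hom] by blast

lemma cst_inj:
  assumes "is_chart X c" "op W" "W \<subseteq> cdom c" "W \<noteq> {}" and a: "a \<in> carrier (Lam X)" "b \<in> carrier (Lam X)"
    and eq: "cst X W a = cst X W b"
  shows "a = b"
proof -
  obtain y where "y \<in> W" using assms(4) by blast
  moreover have "sfun_restrict (im c W) (\<lambda>w. a) = sfun_restrict (im c W) (\<lambda>w. b)"
    using iso_cst[OF assms(1-3)] a eq by metis
  then have "sfun_restrict (im c W) (\<lambda>w. a) (cbody c y) = sfun_restrict (im c W) (\<lambda>w. b) (cbody c y)"
    by simp
  ultimately show ?thesis by (simp add: sfun_restrict_def)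
qed

text \<open>
  \<open>D (f\<^sub>0 + \<theta> f\<^sub>1) = 0\<close> means \<open>f\<^sub>1 = 0\<close> and \<open>f\<^sub>0' = 0\<close>, and a disc is connected.
\<close>

lemma D_kernel:
  assumes c: "c \<in> coords X" and W: "op W" "W \<subseteq> cdom c" and ball: "im c W = ball w0 r" "r > 0"
    and s: "s \<in> part X p W" and D: "Dc X c W s = \<zero>[W]"
  obtains a where "a \<in> Lam_part X p" "s = cst X W a"
proof -
  note cc = coords_chart[OF c]
  have sc: "s \<in> carrier (sec X W)" using part_carrier[OF W(1) s] .
  let ?f = "ciso c W s"
  note fc = iso_closed[OF cc W sc]
  have D0: "sfun_D (ball w0 r) ?f w T = 0" for w T
    using iso_Dc[OF cc W sc, symmetric] D by (simp add: iso_zero[OF cc W] ball(1))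
  have th: "?f w T = 0" if "0 \<in> T" for w T
  proof (cases "w \<in> ball w0 r")
    case True
    then show ?thesis using D0[of w "T - {0}"] that by (simp add: sfun_D_def sfun_restrict_def insert_absorb)
  next
    case False
    then show ?thesis using sfun_outside[OF fc] ball(1) by simp
  qed
  have const: "?f w T = ?f w0 T" if w: "w \<in> ball w0 r" for w T
  proof (cases "0 \<in> T")
    case False
    have "((\<lambda>u. ?f u T) has_field_derivative 0) (at u)" if "u \<in> ball w0 r" for u
    proof -
      have "deriv (\<lambda>u. ?f u T) u = 0"
        using D0[of u "insert 0 T"] False that by (simp add: sfun_D_def sfun_restrict_def)
      moreover have "(\<lambda>u. ?f u T) field_differentiable (at u)"
        using sfun_field_differentiable[OF chart_open[OF cc W] fc, of u] that ball(1) by simp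
      ultimately show ?thesis using field_differentiable_derivI by metis
    qed
    then have "\<exists>k. \<forall>u\<in>ball w0 r. ?f u T = k"
      by (intro has_field_derivative_zero_constant convex_ball) (simp add: has_field_derivative_at_within)
    then show ?thesis using w ball(2) by (metis centre_in_ball)
  qed (simp add: th)
  define a where "a = ?f w0"
  have "T \<subseteq> {1..ngens X}" if "a T \<noteq> 0" for T
  proof -
    have "0 \<notin> T" using th that by (auto simp: a_def)
    moreover have "T \<subseteq> {..ngens X}" using fc that unfolding sfun_carrier_iff a_def by blast
    ultimately show ?thesis by (force simp: Suc_le_eq intro: gr0I)
  qed
  then have ac: "a \<in> carrier (Lam X)" by (simp add: grassmann_def)
  have "odd (card T) = p" if "a T \<noteq> 0" for T
    using iso_sfun_part[OF cc W s] that unfolding sfun_part_iff a_def by blast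
  then have "a \<in> Lam_part X p" using ac by (simp add: grass_part_def)
  moreover have "s = cst X W a"
  proof (rule iso_inj[OF cc W sc cst_closed[OF W(1) ac]])
    show "?f = ciso c W (cst X W a)"
      unfolding iso_cst[OF cc W ac] ball(1) using const sfun_outside[OF fc] ball(1)
      by (auto simp: sfun_restrict_def a_def fun_eq_iff)
  qed
  ultimately show thesis using that by blast
qed

lemma chart_ball:
  assumes c: "is_chart X c" and W: "op W" "W \<subseteq> cdom c" and x: "x \<in> W"
  obtains V r where "op V" "x \<in> V" "V \<subseteq> W" "im c V = ball (cbody c x) r" "r > 0"
proof -
  obtain r where r: "r > 0" "ball (cbody c x) r \<subseteq> im c W"
    using chart_open[OF c W] x open_contains_ball by blast
  define V where "V = {y \<in> cdom c. cbody c y \<in> ball (cbody c x) r}"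
  have V: "op V" unfolding V_def using chart_continuous[OF c open_ball] .
  have "V \<subseteq> W"
  proof
    fix y assume y: "y \<in> V"
    then obtain y' where "y' \<in> W" "cbody c y = cbody c y'" using r(2) by (auto simp: V_def)
    then show "y \<in> W" using chart_inj[OF c] y W(2) unfolding V_def inj_on_def by blast
  qed
  moreover have "im c V = ball (cbody c x) r"
  proof
    show "im c V \<subseteq> ball (cbody c x) r" by (auto simp: V_def)
    show "ball (cbody c x) r \<subseteq> im c V"
    proof
      fix u assume u: "u \<in> ball (cbody c x) r"
      then obtain y where "y \<in> W" "u = cbody c y" using r(2) by blast
      then show "u \<in> im c V" using u W(2) by (auto simp: V_def)
    qed
  qed
  moreover have "x \<in> V" using x W(2) r(1) by (auto simp: V_def)
  ultimately show thesis using that V r(1) by blast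
qed

text \<open>
  Near a point, \<open>J\<close> and its inverse are killed by \<open>D\<^sub>c\<close>, so \<open>J = a\<close> is an invertible constant. Then
  \<open>\<theta>\<^sub>d - \<theta>\<^sub>c a\<close> is killed by \<open>D\<^sub>c\<close> and equals a constant \<open>\<xi>\<close>, and so is \<open>z\<^sub>d - (a\<^sup>2 z\<^sub>c + \<theta>\<^sub>c \<xi> a)\<close>.
\<close>

lemma flat_affine_change:
  assumes c: "c \<in> coords X" and d: "d \<in> coords X" and flat: "dlog c d (cdom c \<inter> cdom d) = \<zero>[cdom c \<inter> cdom d]"
  shows "affine_change X c d"
  unfolding affine_change_def
proof
  fix x assume x: "x \<in> cdom c \<inter> cdom d"
  note cc = coords_chart[OF c] and dd = coords_chart[OF d]
  let ?U = "cdom c \<inter> cdom d"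
  have U: "op ?U" "?U \<subseteq> cdom c" "?U \<subseteq> cdom d" using op_Int_dom[OF op_dom[OF c] d] by auto
  obtain W r where W: "op W" "x \<in> W" "W \<subseteq> ?U" and ball: "im c W = ball (cbody c x) r" "r > 0"
    using chart_ball[OF cc U(1,2) x] .
  have Wc: "W \<subseteq> cdom c" and Wd: "W \<subseteq> cdom d" using W(3) by auto
  interpret R: ring "sec X W" using W(1) by (rule sec_ring)
  let ?D = "Dc X c W" and ?J = "jac X c d W" and ?J' = "jac X d c W"
  let ?th = "thetac X c W" and ?z = "zc X c W" and ?th' = "thetac X d W" and ?z' = "zc X d W"
  note kernel = D_kernel[OF c W(1) Wc ball]
  note th = thetac_part[OF cc W(1) Wc] and z = zc_part[OF cc W(1) Wc]
    and th' = thetac_part[OF dd W(1) Wd] and z' = zc_part[OF dd W(1) Wd]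
  note J = J_even[OF c d W(1) Wc Wd] and J' = J_even[OF d c W(1) Wd Wc]
  note [simp] = part_carrier[OF W(1) th] part_carrier[OF W(1) z] part_carrier[OF W(1) th'] part_carrier[OF W(1) z']
    part_carrier[OF W(1) J] part_carrier[OF W(1) J'] D_closed[OF c W(1) Wc]
  have "dlog c d W = \<zero>[W]"
    using dlog_res[OF c d U W(1,3)] flat res_zero[OF U(1) W(1,3)] by simp
  then have DJ: "?D ?J = \<zero>[W]" using D_J[OF c d W(1) Wc Wd] by simp
  have "?J \<otimes>[W] ?D ?J' = \<zero>[W]"
    using Dc_mult_even[OF cc W(1) Wc J, of ?J'] J_J[OF c d W(1) Wc Wd] by (simp add: DJ Dc_one[OF cc W(1) Wc])
  then have DJ': "?D ?J' = \<zero>[W]"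
    using J_cancel[OF d c W(1) Wd Wc, of "?D ?J'"] by simp
  obtain a where a: "a \<in> Lam_part X False" "?J = cst X W a" using kernel[OF J DJ] .
  obtain a' where a': "a' \<in> Lam_part X False" "?J' = cst X W a'" using kernel[OF J' DJ'] .
  note ac = Lam_part_carrier[OF a(1)] and ac' = Lam_part_carrier[OF a'(1)]
  have Wne: "W \<noteq> {}" using W(2) by auto
  have one: "\<one>\<^bsub>Lam X\<^esub> = gscalar 1" "gscalar 1 \<in> carrier (Lam X)"
    using gscalar_Lam[of 1] by (auto simp: grassmann_def grass_part_def)
  have "a \<otimes>\<^bsub>Lam X\<^esub> a' = \<one>\<^bsub>Lam X\<^esub>" "a' \<otimes>\<^bsub>Lam X\<^esub> a = \<one>\<^bsub>Lam X\<^esub>"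
  proof -
    have "cst X W (a \<otimes>\<^bsub>Lam X\<^esub> a') = cst X W (gscalar 1)" "cst X W (a' \<otimes>\<^bsub>Lam X\<^esub> a) = cst X W (gscalar 1)"
      unfolding cst_mult[OF W(1) ac ac'] cst_mult[OF W(1) ac' ac] cst_one[OF W(1)]
      using J_J[OF c d W(1) Wc Wd] J_J[OF d c W(1) Wd Wc] a(2) a'(2) by simp_all
    then show "a \<otimes>\<^bsub>Lam X\<^esub> a' = \<one>\<^bsub>Lam X\<^esub>" "a' \<otimes>\<^bsub>Lam X\<^esub> a = \<one>\<^bsub>Lam X\<^esub>"
      unfolding one(1) using Lam_mult_closed[OF ac ac'] Lam_mult_closed[OF ac' ac] one(2)
      by (blast intro: cst_inj[OF cc W(1) Wc Wne])+
  qed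
  then have aU: "a \<in> Units (Lam X)" using ac ac' by (auto simp: Units_def)
  let ?a = "cst X W a"
  have ap: "?a \<in> part X False W" and a_cl [simp]: "?a \<in> carrier (sec X W)"
    using cst_part[OF W(1) a(1)] cst_closed[OF W(1) ac] by auto
  have Da: "?D ?a = \<zero>[W]" using DJ a by simp
  have "?D (?th' \<ominus>[W] (?th \<otimes>[W] ?a)) = \<zero>[W]"
    using a(2) by (simp add: Dc_add[OF cc W(1) Wc] Dc_uminus[OF cc W(1) Wc] Dc_mult_odd[OF cc W(1) Wc th] Dc_thetac[OF cc W(1) Wc] Da
      R.minus_eq jac_def R.r_neg)
  moreover have "?th' \<ominus>[W] (?th \<otimes>[W] ?a) \<in> part X True W"
    using part_minus[OF W(1) th'] part_mult[OF W(1) th ap] by simp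
  ultimately obtain \<xi> where \<xi>: "\<xi> \<in> Lam_part X True" "?th' \<ominus>[W] (?th \<otimes>[W] ?a) = cst X W \<xi>"
    using kernel by metis
  note \<xi>c = Lam_part_carrier[OF \<xi>(1)]
  let ?x = "cst X W \<xi>"
  have xp: "?x \<in> part X True W" and x_cl [simp]: "?x \<in> carrier (sec X W)"
    using cst_part[OF W(1) \<xi>(1)] cst_closed[OF W(1) \<xi>c] by auto
  have theta: "?th' = (?th \<otimes>[W] ?a) \<oplus>[W] ?x"
    unfolding \<xi>(2)[symmetric] by (simp add: R.minus_eq R.a_lcomm R.r_neg)
  have Dx: "?D (?x \<otimes>[W] ?a) = \<zero>[W]"
    using Dc_cst[OF cc W(1) Wc \<xi>c] by (simp add: Dc_mult_odd[OF cc W(1) Wc xp] Da R.minus_eq)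
  have aap: "?a \<otimes>[W] ?a \<in> part X False W" using part_mult_even[OF W(1) ap ap] .
  let ?e = "?z' \<ominus>[W] ((?a \<otimes>[W] ?a \<otimes>[W] ?z) \<oplus>[W] (?th \<otimes>[W] (?x \<otimes>[W] ?a)))"
  have "?D ((?a \<otimes>[W] ?a) \<otimes>[W] ?z) = ?th \<otimes>[W] (?a \<otimes>[W] ?a)"
    using even_commute[OF W(1) aap, of ?th]
    by (simp add: Dc_mult_even[OF cc W(1) Wc aap] Dc_mult_even[OF cc W(1) Wc ap] Da Dc_zc[OF cc W(1) Wc])
  moreover have "?D (?th \<otimes>[W] (?x \<otimes>[W] ?a)) = ?x \<otimes>[W] ?a"
    by (simp add: Dc_mult_odd[OF cc W(1) Wc th] Dx Dc_thetac[OF cc W(1) Wc] R.minus_eq)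
  moreover have "?D ?z' = (?th \<otimes>[W] (?a \<otimes>[W] ?a)) \<oplus>[W] (?x \<otimes>[W] ?a)"
    using superconformal_change_on[OF cc dd coords_change[OF c d] W(1) Wc Wd]
    by (simp add: a(2) theta R.l_distr R.m_assoc)
  ultimately have De: "?D ?e = \<zero>[W]"
    by (simp add: Dc_uminus[OF cc W(1) Wc] Dc_add[OF cc W(1) Wc] R.minus_eq R.r_neg)
  have "?e \<in> part X False W"
    using part_mult_even[OF W(1) aap z] odd_mult_odd[OF W(1) th, of "?x \<otimes>[W] ?a"] part_mult[OF W(1) xp ap] z'
    by (intro part_minus[OF W(1)] part_add[OF W(1)]) simp_all
  then obtain b where b: "b \<in> Lam_part X False" "?e = cst X W b" using kernel De by metis
  have "?z' = (?a \<otimes>[W] ?a \<otimes>[W] ?z) \<oplus>[W] (?th \<otimes>[W] (?x \<otimes>[W] ?a)) \<oplus>[W] cst X W b"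
    unfolding b(2)[symmetric] by (simp add: R.minus_eq R.minus_add R.a_ac R.r_neg1 R.r_neg2 R.r_neg)
  then have "?z' = (cst X W (a \<otimes>\<^bsub>Lam X\<^esub> a) \<otimes>[W] ?z) \<oplus>[W] (?th \<otimes>[W] cst X W (\<xi> \<otimes>\<^bsub>Lam X\<^esub> a)) \<oplus>[W] cst X W b"
    by (simp only: cst_mult[OF W(1) ac ac] cst_mult[OF W(1) \<xi>c ac])
  then show "\<exists>W\<in>opens X. x \<in> W \<and> W \<subseteq> cdom c \<inter> cdom d \<and>
        (\<exists>a\<in>Lam_part X False \<inter> Units (Lam X). \<exists>b\<in>Lam_part X False. \<exists>\<xi>\<in>Lam_part X True.
           zc X d W = (cst X W (a \<otimes>\<^bsub>Lam X\<^esub> a) \<otimes>[W] zc X c W)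
             \<oplus>[W] (thetac X c W \<otimes>[W] cst X W (\<xi> \<otimes>\<^bsub>Lam X\<^esub> a)) \<oplus>[W] cst X W b \<and>
           thetac X d W = (thetac X c W \<otimes>[W] cst X W a) \<oplus>[W] cst X W \<xi>)"
    using W aU a(1) b(1) \<xi>(1) theta by blast
qed

text \<open>
  Here \<open>J = D\<^sub>c (\<theta>\<^sub>c a + \<xi>)\<close> is locally the constant \<open>a\<close>.
\<close>

lemma affine_change_flat:
  assumes c: "c \<in> coords X" and d: "d \<in> coords X" and aff: "affine_change X c d"
  shows "dlog c d (cdom c \<inter> cdom d) = \<zero>[cdom c \<inter> cdom d]"
proof -
  note cc = coords_chart[OF c]
  let ?U = "cdom c \<inter> cdom d"
  have U: "op ?U" "?U \<subseteq> cdom c" "?U \<subseteq> cdom d" using op_Int_dom[OF op_dom[OF c] d] by auto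
  interpret U: ring "sec X ?U" using U(1) by (rule sec_ring)
  show ?thesis
  proof (rule sections_eqI[OF U(1) dlog_closed[OF c d U] U.zero_closed])
    fix x assume "x \<in> ?U"
    then obtain W a \<xi> where W: "op W" "x \<in> W" "W \<subseteq> ?U" and a: "a \<in> Lam_part X False" and \<xi>: "\<xi> \<in> Lam_part X True"
      and th: "thetac X d W = (thetac X c W \<otimes>[W] cst X W a) \<oplus>[W] cst X W \<xi>"
      using aff unfolding affine_change_def by blast
    have Wc: "W \<subseteq> cdom c" and Wd: "W \<subseteq> cdom d" using W(3) by auto
    interpret R: ring "sec X W" using W(1) by (rule sec_ring)
    note ac = Lam_part_carrier[OF a] and \<xi>c = Lam_part_carrier[OF \<xi>]
    note t = thetac_part[OF cc W(1) Wc]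
    note [simp] = cst_closed[OF W(1) ac] cst_closed[OF W(1) \<xi>c] part_carrier[OF W(1) t]
      Dc_cst[OF cc W(1) Wc ac] Dc_cst[OF cc W(1) Wc \<xi>c]
    have "jac X c d W = cst X W a"
      by (simp add: jac_def th Dc_add[OF cc W(1) Wc] Dc_mult_odd[OF cc W(1) Wc t] Dc_thetac[OF cc W(1) Wc] R.minus_eq)
    then have "dlog c d W = \<zero>[W]"
      using J_closed[OF d c W(1) Wd Wc] by (simp add: dlog_eq[OF c d W(1) Wc Wd])
    then show "\<exists>V. op V \<and> x \<in> V \<and> V \<subseteq> ?U \<and> res X ?U V (dlog c d ?U) = res X ?U V \<zero>[?U]"
      using W dlog_res[OF c d U W(1,3)] res_zero[OF U(1) W(1,3)] by metis
  qed
qed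

lemma scal_inverse:
  assumes W: "op W" and k: "k \<noteq> 0" and s: "s \<in> carrier (sec X W)" and z: "cst X W (gscalar k) \<otimes>[W] s = \<zero>[W]"
  shows "s = \<zero>[W]"
proof -
  interpret R: ring "sec X W" using W by (rule sec_ring)
  have Lam: "gscalar l \<in> carrier (Lam X)" for l using gscalar_Lam by (auto simp: grass_part_def)
  have inf: "infinite S \<Longrightarrow> gscalar 1 S = 0" and mult: "inverse k * gscalar k S = gscalar 1 S" for S
    using k by (auto simp: gscalar_def)
  have "gmult (gscalar (inverse k)) (gscalar k) S = gscalar 1 S" for S
    by (cases "finite S") (simp_all add: gmult_scalar_left gmult_infinite inf mult)
  then have "gscalar (inverse k) \<otimes>\<^bsub>Lam X\<^esub> gscalar k = gscalar 1" by (auto simp: grassmann_def)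
  then have "cst X W (gscalar (inverse k)) \<otimes>[W] cst X W (gscalar k) = \<one>[W]"
    using cst_mult[OF W Lam Lam, of "inverse k" k] cst_one[OF W] by simp
  then have "s = cst X W (gscalar (inverse k)) \<otimes>[W] (cst X W (gscalar k) \<otimes>[W] s)"
    using s scal_closed[OF W] by (simp add: R.m_assoc[symmetric])
  then show ?thesis using scal_closed[OF W] by (simp add: z)
qed

lemma flat_charts_affine:
  assumes m: "m \<noteq> 0" and g: "g \<in> connections m" and c: "c \<in> coords X" "g c = \<zero>[cdom c]"
    and d: "d \<in> coords X" "g d = \<zero>[cdom d]"
  shows "affine_change X c d"
proof (rule flat_affine_change[OF c(1) d(1)])
  let ?U = "cdom c \<inter> cdom d"
  have U: "op ?U" "?U \<subseteq> cdom c" "?U \<subseteq> cdom d" using op_Int_dom[OF op_dom[OF c(1)] d(1)] by auto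
  interpret U: ring "sec X ?U" using U(1) by (rule sec_ring)
  have "cst X ?U (gscalar m) \<otimes>[?U] dlog c d ?U = \<zero>[?U]"
    using conn_change[OF g c(1) U(1,2) d(1) U(3)] J_closed[OF c(1) d(1) U] dlog_closed[OF c(1) d(1) U] scal_closed[OF U(1), of m]
    by (simp add: c(2) d(2) res_zero[OF op_dom[OF c(1)] U(1,2)] res_zero[OF op_dom[OF d(1)] U(1,3)])
  then show "dlog c d ?U = \<zero>[?U]"
    using scal_inverse[OF U(1) m dlog_closed[OF c(1) d(1) U]] by simp
qed

text \<open>
  On overlaps with a chart \<open>d\<close> of the covering, the law determines \<open>g\<^sub>c\<close> from \<open>g\<^sub>d\<close>.
\<close>

lemma connection_eqI:
  assumes g: "g \<in> connections m" "g' \<in> connections m" and A: "A \<subseteq> coords X" "\<Union>(cdom ` A) = topspace (tsp X)"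
    and eq: "\<And>c. c \<in> A \<Longrightarrow> g c = g' c"
  shows "g = g'"
proof (rule PiE_ext)
  show "g \<in> (\<Pi>\<^sub>E c\<in>coords X. part X True (cdom c))" "g' \<in> (\<Pi>\<^sub>E c\<in>coords X. part X True (cdom c))"
    using g by (auto simp: connections_def)
  fix c assume c: "c \<in> coords X"
  show "g c = g' c"
  proof (rule sections_eqI[OF op_dom[OF c] conn_closed[OF g(1) c] conn_closed[OF g(2) c]])
    fix x assume x: "x \<in> cdom c"
    then have "x \<in> \<Union>(cdom ` A)" using A(2) openin_subset[OF op_dom[OF c]] by auto
    then obtain d where dA: "d \<in> A" "x \<in> cdom d" by blast
    have d: "d \<in> coords X" using dA A by auto
    let ?W = "cdom c \<inter> cdom d"
    have W: "op ?W" "?W \<subseteq> cdom c" "?W \<subseteq> cdom d" using op_Int_dom[OF op_dom[OF c] d] by auto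
    have "res X (cdom c) ?W (g c) = res X (cdom c) ?W (g' c)"
      unfolding conn_change[OF g(1) c W(1,2) d W(3)] conn_change[OF g(2) c W(1,2) d W(3)] eq[OF dA(1)] ..
    then show "\<exists>V. op V \<and> x \<in> V \<and> V \<subseteq> cdom c \<and> res X (cdom c) V (g c) = res X (cdom c) V (g' c)"
      using W x dA by blast
  qed
qed

text \<open>
  In arbitrary coordinates \<open>c\<close> the law forces \<open>g\<^sub>c = m (D\<^sub>c J) / J\<close> for the Jacobian \<open>J\<close> to any chart of the
  atlas. By the cocycle rule this does not depend on that chart, because the logarithmic derivatives
  between charts of the atlas vanish.
\<close>

lemma affine_atlas_connection:
  assumes A: "affine_atlas X A"
  obtains g where "g \<in> connections m" "\<forall>c\<in>A. g c = \<zero>[cdom c]"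
proof -
  have Ac: "A \<subseteq> coords X" and cov: "\<Union>(cdom ` A) = topspace (tsp X)"
    and aff: "\<And>c d. c \<in> A \<Longrightarrow> d \<in> A \<Longrightarrow> affine_change X c d"
    using A by (auto simp: affine_atlas_def)
  have coverA: "\<exists>d\<in>A. x \<in> cdom d" if "op U" "x \<in> U" for U x
  proof -
    have "x \<in> \<Union>(cdom ` A)" using that openin_subset cov by auto
    then show ?thesis by blast
  qed
  have AA: "dlog d e W = \<zero>[W]" if "d \<in> A" "e \<in> A" "op W" "W \<subseteq> cdom d" "W \<subseteq> cdom e" for d e W
  proof -
    have d: "d \<in> coords X" and e: "e \<in> coords X" using that Ac by auto
    have U: "op (cdom d \<inter> cdom e)" "W \<subseteq> cdom d \<inter> cdom e" using op_Int_dom[OF op_dom[OF d] e] that by auto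
    show ?thesis
      using dlog_res[OF d e U(1) _ _ that(3) U(2)] affine_change_flat[OF d e aff[OF that(1,2)]]
        res_zero[OF U(1) that(3) U(2)] by simp
  qed
  have indep: "dlog c d W = dlog c e W"
    if "c \<in> coords X" "d \<in> A" "e \<in> A" "op W" "W \<subseteq> cdom c" "W \<subseteq> cdom d" "W \<subseteq> cdom e" for c d e W
  proof -
    have d: "d \<in> coords X" and e: "e \<in> coords X" using that Ac by auto
    interpret R: ring "sec X W" using that(4) by (rule sec_ring)
    show ?thesis
      using dlog_cocycle[OF that(1) d e that(4-7)] AA[OF that(2,3,4,6,7)]
        J_closed[OF that(1) d that(4-6)] dlog_closed[OF that(1) d that(4-6)] by simp
  qed
  have "\<exists>t. t \<in> carrier (sec X (cdom c)) \<and> (\<forall>d\<in>A. res X (cdom c) (cdom c \<inter> cdom d) t =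
      cst X (cdom c \<inter> cdom d) (gscalar m) \<otimes>[cdom c \<inter> cdom d] dlog c d (cdom c \<inter> cdom d))" if c: "c \<in> coords X" for c
  proof -
    let ?s = "\<lambda>d. cst X (cdom c \<inter> cdom d) (gscalar m) \<otimes>[cdom c \<inter> cdom d] dlog c d (cdom c \<inter> cdom d)"
    have V: "op (cdom c \<inter> cdom d)" "cdom c \<inter> cdom d \<subseteq> cdom c" "cdom c \<inter> cdom d \<subseteq> cdom d" "d \<in> coords X" if "d \<in> A" for d
      using that Ac op_Int_dom[OF op_dom[OF c]] by auto
    have s: "?s d \<in> carrier (sec X (cdom c \<inter> cdom d))" if d: "d \<in> A" for d
    proof -
      interpret R: ring "sec X (cdom c \<inter> cdom d)" using V(1)[OF d] by (rule sec_ring)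
      show ?thesis using scal_closed[OF V(1)[OF d]] dlog_closed[OF c V(4,1,2,3)[OF d]] by simp
    qed
    have r: "res X (cdom c \<inter> cdom d) W (?s d) = cst X W (gscalar m) \<otimes>[W] dlog c d W"
      if d: "d \<in> A" and W: "op W" "W \<subseteq> cdom c \<inter> cdom d" for d W
      by (simp add: res_mult[OF V(1)[OF d] W scal_closed[OF V(1)[OF d]] dlog_closed[OF c V(4,1,2,3)[OF d]]]
        scal_res[OF V(1)[OF d] W] dlog_res[OF c V(4,1,2,3)[OF d] W])
    obtain t where "t \<in> carrier (sec X (cdom c))" "\<And>d. d \<in> A \<Longrightarrow> res X (cdom c) (cdom c \<inter> cdom d) t = ?s d"
    proof (rule sections_glue[of A "\<lambda>d. cdom c \<inter> cdom d" "cdom c" ?s])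
      show "cdom c = (\<Union>d\<in>A. cdom c \<inter> cdom d)" using coverA[OF op_dom[OF c]] by blast
      fix d e assume d: "d \<in> A" and e: "e \<in> A"
      let ?W = "cdom c \<inter> cdom d \<inter> (cdom c \<inter> cdom e)"
      have W: "op ?W" "?W \<subseteq> cdom c \<inter> cdom d" "?W \<subseteq> cdom c \<inter> cdom e" "?W \<subseteq> cdom c" "?W \<subseteq> cdom d" "?W \<subseteq> cdom e"
        using V(1)[OF d] V(1)[OF e] by auto
      show "res X (cdom c \<inter> cdom d) ?W (?s d) = res X (cdom c \<inter> cdom e) ?W (?s e)"
        unfolding r[OF d W(1,2)] r[OF e W(1,3)] indep[OF c d e W(1,4,5,6)] ..
    qed (use V(1) s in blast)+
    then show ?thesis by blast
  qed
  then obtain g0 where g0: "\<And>c. c \<in> coords X \<Longrightarrow> g0 c \<in> carrier (sec X (cdom c))"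
    "\<And>c d. c \<in> coords X \<Longrightarrow> d \<in> A \<Longrightarrow> res X (cdom c) (cdom c \<inter> cdom d) (g0 c) =
      cst X (cdom c \<inter> cdom d) (gscalar m) \<otimes>[cdom c \<inter> cdom d] dlog c d (cdom c \<inter> cdom d)"
    by metis
  have g0_on: "res X (cdom c) W (g0 c) = cst X W (gscalar m) \<otimes>[W] dlog c d W"
    if c: "c \<in> coords X" and dA: "d \<in> A" and W: "op W" "W \<subseteq> cdom c" "W \<subseteq> cdom d" for c d W
  proof -
    let ?V = "cdom c \<inter> cdom d"
    have d: "d \<in> coords X" using dA Ac by auto
    have V: "op ?V" "?V \<subseteq> cdom c" "?V \<subseteq> cdom d" "W \<subseteq> ?V" using op_Int_dom[OF op_dom[OF c] d] W by auto
    have "res X ?V W (res X (cdom c) ?V (g0 c)) = cst X W (gscalar m) \<otimes>[W] dlog c d W"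
      unfolding g0(2)[OF c dA]
      by (simp add: res_mult[OF V(1) W(1) V(4) scal_closed[OF V(1)] dlog_closed[OF c d V(1-3)]]
        scal_res[OF V(1) W(1) V(4)] dlog_res[OF c d V(1-3) W(1) V(4)])
    then show ?thesis by (simp add: res_res[OF op_dom[OF c] V(1,2) W(1) V(4) g0(1)[OF c]])
  qed
  have g0_odd: "g0 c \<in> part X True (cdom c)" if c: "c \<in> coords X" for c
  proof (rule part_local[OF op_dom[OF c] g0(1)[OF c]])
    fix x assume x: "x \<in> cdom c"
    then obtain d where d: "d \<in> A" "x \<in> cdom d" using coverA[OF op_dom[OF c]] by blast
    have dc: "d \<in> coords X" using d Ac by auto
    let ?W = "cdom c \<inter> cdom d"
    have W: "op ?W" "?W \<subseteq> cdom c" "?W \<subseteq> cdom d" using op_Int_dom[OF op_dom[OF c] dc] by auto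
    have "res X (cdom c) ?W (g0 c) \<in> part X True ?W"
      unfolding g0_on[OF c d(1) W] using part_mult_even[OF W(1) scal_even[OF W(1)] dlog_odd[OF c dc W]] .
    then show "\<exists>V. op V \<and> x \<in> V \<and> V \<subseteq> cdom c \<and> res X (cdom c) V (g0 c) \<in> part X True V"
      using W x d by blast
  qed
  define g where "g = restrict g0 (coords X)"
  have "res X (cdom c) W (g0 c) = (jac X c c' W \<otimes>[W] res X (cdom c') W (g0 c')) \<oplus>[W] (cst X W (gscalar m) \<otimes>[W] dlog c c' W)"
    if c: "c \<in> coords X" and c': "c' \<in> coords X" and W_def: "W = cdom c \<inter> cdom c'" for c c' W
  proof -
    have W: "op W" "W \<subseteq> cdom c" "W \<subseteq> cdom c'" using op_Int_dom[OF op_dom[OF c] c'] W_def by auto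
    interpret R: ring "sec X W" using W(1) by (rule sec_ring)
    note gc = res_closed[OF op_dom[OF c] W(1,2) g0(1)[OF c]] and gc' = res_closed[OF op_dom[OF c'] W(1,3) g0(1)[OF c']]
    note [simp] = gc gc' J_closed[OF c c' W] dlog_closed[OF c c' W] scal_closed[OF W(1)]
    show ?thesis
    proof (rule sections_eqI[OF W(1) gc])
      fix x assume x: "x \<in> W"
      then obtain d where dA: "d \<in> A" "x \<in> cdom d" using coverA[OF W(1)] by blast
      have d: "d \<in> coords X" using dA Ac by auto
      let ?V = "W \<inter> cdom d"
      have V: "op ?V" "?V \<subseteq> W" "?V \<subseteq> cdom c" "?V \<subseteq> cdom c'" "?V \<subseteq> cdom d" using op_Int_dom[OF W(1) d] W by auto
      interpret V: ring "sec X ?V" using V(1) by (rule sec_ring)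
      note [simp] = J_closed[OF c c' V(1,3,4)] dlog_closed[OF c c' V(1,3,4)] dlog_closed[OF c' d V(1,4,5)] scal_closed[OF V(1)]
      have "res X W ?V (res X (cdom c) W (g0 c)) = cst X ?V (gscalar m) \<otimes>[?V] dlog c d ?V"
        by (simp add: res_res[OF op_dom[OF c] W(1,2) V(1,2) g0(1)[OF c]] g0_on[OF c dA(1) V(1,3,5)])
      also have "\<dots> = (jac X c c' ?V \<otimes>[?V] (cst X ?V (gscalar m) \<otimes>[?V] dlog c' d ?V)) \<oplus>[?V] (cst X ?V (gscalar m) \<otimes>[?V] dlog c c' ?V)"
        using even_lcommute[OF V(1) scal_even[OF V(1), of m], of "jac X c c' ?V" "dlog c' d ?V"]
        by (simp add: dlog_cocycle[OF c c' d V(1,3,4,5)] V.r_distr V.a_comm)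
      also have "\<dots> = res X W ?V ((jac X c c' W \<otimes>[W] res X (cdom c') W (g0 c')) \<oplus>[W] (cst X W (gscalar m) \<otimes>[W] dlog c c' W))"
        by (simp add: res_add[OF W(1) V(1,2)] res_mult[OF W(1) V(1,2)] J_res[OF c c' W V(1,2)] dlog_res[OF c c' W V(1,2)]
          scal_res[OF W(1) V(1,2)] res_res[OF op_dom[OF c'] W(1,3) V(1,2) g0(1)[OF c']] g0_on[OF c' dA(1) V(1,4,5)])
      finally show "\<exists>V. op V \<and> x \<in> V \<and> V \<subseteq> W \<and> res X W V (res X (cdom c) W (g0 c)) =
          res X W V ((jac X c c' W \<otimes>[W] res X (cdom c') W (g0 c')) \<oplus>[W] (cst X W (gscalar m) \<otimes>[W] dlog c c' W))"
        using V(1,2) x dA by blast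
    qed simp
  qed
  then have g: "g \<in> connections m" using g0_odd by (auto simp: connections_def Let_def g_def)
  have "g c = \<zero>[cdom c]" if cA: "c \<in> A" for c
  proof -
    have c: "c \<in> coords X" using cA Ac by auto
    note U = op_dom[OF c]
    interpret U: ring "sec X (cdom c)" using U by (rule sec_ring)
    have "g0 c = cst X (cdom c) (gscalar m) \<otimes>[cdom c] dlog c c (cdom c)"
      using g0_on[OF c cA U order_refl order_refl] res_id[OF U g0(1)[OF c]] by simp
    then show ?thesis using dlog_self[OF c U order_refl] scal_closed[OF U] c by (simp add: g_def)
  qed
  with g that show thesis by blast
qed

text \<open>The equivalence class of affine atlases that belongs to a connection.\<close>

definition flat_atlases :: "(('a, 's) chart \<Rightarrow> 's) \<Rightarrow> ('a, 's) chart set set" where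
  "flat_atlases g = {A. affine_atlas X A \<and> (\<forall>c\<in>A. g c = \<zero>[cdom c])}"

context
  fixes m :: complex assumes m: "m \<noteq> 0"
begin

lemma flat_atlases_nonempty:
  assumes g: "g \<in> connections m" shows "{c \<in> coords X. g c = \<zero>[cdom c]} \<in> flat_atlases g"
proof -
  let ?A = "{c \<in> coords X. g c = \<zero>[cdom c]}"
  have "topspace (tsp X) \<subseteq> \<Union>(cdom ` ?A)"
  proof
    fix x assume "x \<in> topspace (tsp X)"
    then obtain c where "c \<in> coords X" "x \<in> cdom c" "g c = \<zero>[cdom c]" using flat_chart[OF m g] by metis
    then show "x \<in> \<Union>(cdom ` ?A)" by blast
  qed
  moreover have "\<Union>(cdom ` ?A) \<subseteq> topspace (tsp X)"
    using openin_subset[OF op_dom] by blast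
  moreover have "affine_change X c d" if "c \<in> ?A" "d \<in> ?A" for c d
    using flat_charts_affine[OF m g] that by blast
  ultimately show ?thesis by (auto simp: flat_atlases_def affine_atlas_def)
qed

lemma flat_atlases_class:
  assumes g: "g \<in> connections m" and A: "A \<in> flat_atlases g"
  shows "flat_atlases g = affine_equiv X `` {A}"
proof
  have Ac: "A \<subseteq> coords X" "\<Union>(cdom ` A) = topspace (tsp X)" "\<And>c. c \<in> A \<Longrightarrow> g c = \<zero>[cdom c]" "affine_atlas X A"
    using A by (auto simp: flat_atlases_def affine_atlas_def)
  show "flat_atlases g \<subseteq> affine_equiv X `` {A}"
  proof
    fix B assume B: "B \<in> flat_atlases g"
    then have Bc: "B \<subseteq> coords X" "\<Union>(cdom ` B) = topspace (tsp X)" "\<And>c. c \<in> B \<Longrightarrow> g c = \<zero>[cdom c]" "affine_atlas X B"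
      by (auto simp: flat_atlases_def affine_atlas_def)
    have "affine_change X c d" if "c \<in> A \<union> B" "d \<in> A \<union> B" for c d
      using flat_charts_affine[OF m g, of c d] that Ac(1,3) Bc(1,3) by blast
    then have "affine_atlas X (A \<union> B)"
      using Ac(1,2) Bc(1,2) by (simp add: affine_atlas_def)
    then show "B \<in> affine_equiv X `` {A}" using Ac(4) Bc(4) by (simp add: affine_equiv_def)
  qed
  show "affine_equiv X `` {A} \<subseteq> flat_atlases g"
  proof
    fix B assume "B \<in> affine_equiv X `` {A}"
    then have B: "affine_atlas X B" "affine_atlas X (A \<union> B)" by (auto simp: affine_equiv_def)
    obtain g' where g': "g' \<in> connections m" "\<forall>c\<in>A \<union> B. g' c = \<zero>[cdom c]"
      by (rule affine_atlas_connection[where m = m, OF B(2)])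
    have "g' = g"
      by (rule connection_eqI[OF g'(1) g Ac(1,2)]) (simp add: g'(2) Ac(3))
    then show "B \<in> flat_atlases g" using B(1) g'(2) by (simp add: flat_atlases_def)
  qed
qed

lemma bij_flat_atlases: "bij_betw flat_atlases (connections m) (affine_structures X)"
proof (rule bij_betw_imageI)
  show "inj_on flat_atlases (connections m)"
  proof (rule inj_onI)
    fix g g' assume g: "g \<in> connections m" "g' \<in> connections m" and eq: "flat_atlases g = flat_atlases g'"
    let ?A = "{c \<in> coords X. g c = \<zero>[cdom c]}"
    have A: "?A \<in> flat_atlases g" "?A \<in> flat_atlases g'" using flat_atlases_nonempty[OF g(1)] eq by auto
    then show "g = g'"
      by (intro connection_eqI[OF g, of ?A]) (auto simp: flat_atlases_def affine_atlas_def)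
  qed
  show "flat_atlases ` connections m = affine_structures X"
  proof
    show "flat_atlases ` connections m \<subseteq> affine_structures X"
    proof
      fix \<A> assume "\<A> \<in> flat_atlases ` connections m"
      then obtain g where g: "g \<in> connections m" "\<A> = flat_atlases g" by blast
      note A = flat_atlases_nonempty[OF g(1)]
      then have "affine_atlas X {c \<in> coords X. g c = \<zero>[cdom c]}" by (simp add: flat_atlases_def)
      then show "\<A> \<in> affine_structures X"
        using flat_atlases_class[OF g(1) A] g(2) unfolding affine_structures_def by (auto intro: quotientI)
    qed
    show "affine_structures X \<subseteq> flat_atlases ` connections m"
    proof
      fix \<A> assume "\<A> \<in> affine_structures X"
      then obtain A where A: "affine_atlas X A" "\<A> = affine_equiv X `` {A}"
        unfolding affine_structures_def by (auto elim: quotientE)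
      obtain g where g: "g \<in> connections m" "\<forall>c\<in>A. g c = \<zero>[cdom c]"
        by (rule affine_atlas_connection[where m = m, OF A(1)])
      then have "A \<in> flat_atlases g" using A(1) by (simp add: flat_atlases_def)
      then show "\<A> \<in> flat_atlases ` connections m"
        using flat_atlases_class[OF g(1)] A(2) g(1) by blast
    qed
  qed
qed

end

end

section \<open>The correspondences\<close>

theorem theorem3p3p5:
  fixes X :: "('a, 's) scurve" and m :: complex
  assumes "superconformal_curve X" and "m \<noteq> 0"
  shows "\<exists>\<Phi> \<Xi>.
    bij_betw \<Phi> (ber_ops X m) (affine_structures X) \<and>
    (\<forall>\<D>\<in>ber_ops X m. \<forall>A\<in>\<Phi> \<D>. \<forall>c\<in>A. has_local_form X m \<D> c \<zero>\<^bsub>sec X (cdom c)\<^esub>) \<and>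
    bij_betw \<Xi> (affine_structures X) (splittings X m) \<and>
    (\<forall>\<A>\<in>affine_structures X. \<forall>A\<in>\<A>. \<forall>c\<in>A. split_trivial X m (\<Xi> \<A>) c)"
proof -
  interpret curve X by unfold_locales (rule assms(1))
  note flat = bij_flat_atlases[OF assms(2)]
  define \<Phi> where "\<Phi> = flat_atlases \<circ> inv_into (connections m) (conn_op m)"
  define \<Xi> where "\<Xi> = conn_split m \<circ> inv_into (connections m) flat_atlases"
  have "bij_betw \<Phi> (ber_ops X m) (affine_structures X)"
    unfolding \<Phi>_def using bij_betw_trans[OF bij_betw_inv_into[OF bij_conn_op] flat] .
  moreover have "has_local_form X m \<D> c \<zero>\<^bsub>sec X (cdom c)\<^esub>"
    if \<D>: "\<D> \<in> ber_ops X m" and A: "A \<in> \<Phi> \<D>" "c \<in> A" for \<D> A c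
  proof -
    define g where "g = inv_into (connections m) (conn_op m) \<D>"
    have "\<D> = conn_op m g"
      using bij_betw_inv_into_right[OF bij_conn_op \<D>] by (simp add: g_def)
    moreover have "g c = \<zero>\<^bsub>sec X (cdom c)\<^esub>" "c \<in> coords X"
      using A by (auto simp: \<Phi>_def g_def flat_atlases_def affine_atlas_def)
    ultimately show ?thesis using conn_op_local_form[of c m g] by simp
  qed
  moreover have "bij_betw \<Xi> (affine_structures X) (splittings X m)"
    unfolding \<Xi>_def using bij_betw_trans[OF bij_betw_inv_into[OF flat] bij_conn_split] .
  moreover have "split_trivial X m (\<Xi> \<A>) c"
    if \<A>: "\<A> \<in> affine_structures X" and A: "A \<in> \<A>" "c \<in> A" for \<A> A c
  proof -
    define g where "g = inv_into (connections m) flat_atlases \<A>"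
    have g: "g \<in> connections m"
      using bij_betwE[OF bij_betw_inv_into[OF flat]] \<A> by (simp add: g_def)
    have "flat_atlases g = \<A>"
      using bij_betw_inv_into_right[OF flat \<A>] by (simp add: g_def)
    then have "g c = \<zero>\<^bsub>sec X (cdom c)\<^esub>" "c \<in> coords X"
      using A by (auto simp: flat_atlases_def affine_atlas_def)
    then show ?thesis using conn_split_trivial[OF g] by (simp add: \<Xi>_def g_def)
  qed
  ultimately show ?thesis by blast
qed

end
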